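(* Let $n\ge 2$, $R>0$, let $a\in C(B_R(o))\cap L^\infty(B_R(o))$ with $a(x)>0$, and let $\lambda>0$. Assume that $a(x)=a(|x|)$ is radial. Let $\delta\ge 0$, and let $u$ solve, with $r=|x|$, $$u(x)=u(r)=m-(3\lambda)^{1/3}\int_0^r\left[\int_0^t a(s)u(s)^3\,ds\right]^{1/3}dt,\qquad(\ast)$$ where $u(o)=m>0$ is so chosen that $u(R)=\delta$. Then $u\in C(\overline{B_R(o)})$ and the following hold. (i) If $\lambda<\lambda_B$ and $\delta>0$ in $(\ast)$, then $u>0$ in $B_R(o)$, and $u$ is the unique solution to $$\Delta_\infty u+\lambda a(x)u^3=0,\quad u>0,\ \text{ in }B_R(o),\quad\text{and}\quad u=\delta\text{ on }\partial B_R(o).\qquad(\ast\ast)$$ (ii) If $\lambda=\lambda_B$ in $(\ast)$, then there is a positive function $v$ that solves $(\ast)$ in $B_R(o)$, with $m=1$ and $v(R)=0$. Moreover, $v$ is a radial first eigenfunction, i.e. $\Delta_\infty v+\lambda_B a(x)v^3=0$ in $B_R(o)$ and $v=0$ on $\partial B_R(o)$. (iii) Let $a(x)=k$ be a positive constant, and let $F(t)=\int_t^1\frac{ds}{(1-s^4)^{1/4}}$ for $0\le t\le 1$. Then the positive function $u$ defined by $$F\left(\frac{u(r)}{m}\right)=(\lambda k)^{1/4}\,r$$ is a radial solution to $(\ast\ast)$ with $\delta\ge 0$. Moreover, $(\lambda k)^{1/4}R=F(\delta/m)$.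
   Context: $B_R(o)$ is the open ball of radius $R$ centered at the origin $o$ of $\mathbb{R}^n$. The infinity-Laplacian is $\Delta_\infty u=\sum_{i,j=1}^n \frac{\partial u}{\partial x_i}\frac{\partial u}{\partial x_j}\frac{\partial^2 u}{\partial x_i\partial x_j}$. Differential equations are understood in the viscosity sense: for an open set $\Omega$ and $F\in C(\Omega\times\mathbb{R})$, a function $u\in C(\Omega)$ satisfies $\Delta_\infty u\ge F(x,u)$ in $\Omega$ if, whenever $\psi\in C^2(\Omega)$ and $u-\psi$ has a local maximum at $p\in\Omega$, one has $\Delta_\infty\psi(p)\ge F(p,u(p))$; it satisfies $\Delta_\infty u\le F(x,u)$ in $\Omega$ if, whenever $\psi\in C^2(\Omega)$ and $u-\psi$ has a local minimum at $q\in\Omega$, one has $\Delta_\infty\psi(q)\le F(q,u(q))$; $\Delta_\infty u=F(x,u)$ means both. Here $\Delta_\infty u+\lambda a(x)u^3=0$ means $\Delta_\infty u=-\lambda a(x)u^3$. Solutions to boundary value problems are functions in $C(\overline{B_R(o)})$. The first eigenvalue $\lambda_B=\lambda_{B_R(o)}$ (with weight $a$) is $\sup S$, where, for a fixed $\delta_0>0$, $S$ is the set of all $\lambda\ge 0$ such that the problem $\Delta_\infty w+\lambda a(x)w^3=0$ in $B_R(o)$, $w=\delta_0$ on $\partial B_R(o)$, has a positive solution $w\in C(\overline{B_R(o)})$. By scaling, $S$ does not depend on $\delta_0>0$. In part (iii), $m=u(o)$ and $u(R)=\delta$ as in the formula $(\ast)$. Cube roots are real cube roots. *)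

theory Defs
  imports "HOL-Analysis.Analysis"
begin

definition partial :: "'n \<Rightarrow> (real ^ 'n \<Rightarrow> real) \<Rightarrow> real ^ 'n \<Rightarrow> real" where
  "partial i f x = frechet_derivative f (at x) (axis i 1)"

text \<open>The two predicates below are meant for open sets \<open>\<Omega>\<close>, on which \<open>differentiable_on\<close> is
  differentiability at every point.\<close>

definition C1_on :: "(real ^ 'n) set \<Rightarrow> (real ^ 'n \<Rightarrow> real) \<Rightarrow> bool" where
  "C1_on \<Omega> f \<longleftrightarrow> f differentiable_on \<Omega> \<and> (\<forall>i. continuous_on \<Omega> (partial i f))"

definition C2_on :: "(real ^ 'n) set \<Rightarrow> (real ^ 'n \<Rightarrow> real) \<Rightarrow> bool" where
  "C2_on \<Omega> f \<longleftrightarrow> C1_on \<Omega> f \<and> (\<forall>i. C1_on \<Omega> (partial i f))"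

definition inf_laplacian :: "(real ^ 'n \<Rightarrow> real) \<Rightarrow> real ^ 'n \<Rightarrow> real" where
  "inf_laplacian f x =
     (\<Sum>i\<in>UNIV. \<Sum>j\<in>UNIV. partial i f x * partial j f x * partial i (partial j f) x)"

definition viscosity_subsolution ::
    "(real ^ 'n) set \<Rightarrow> (real ^ 'n \<Rightarrow> real \<Rightarrow> real) \<Rightarrow> (real ^ 'n \<Rightarrow> real) \<Rightarrow> bool" where
  "viscosity_subsolution \<Omega> F u \<longleftrightarrow> continuous_on \<Omega> u \<and>
     (\<forall>\<psi> p. C2_on \<Omega> \<psi> \<and> p \<in> \<Omega> \<and> (\<forall>\<^sub>F x in nhds p. u x - \<psi> x \<le> u p - \<psi> p)
        \<longrightarrow> inf_laplacian \<psi> p \<ge> F p (u p))"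

definition viscosity_supersolution ::
    "(real ^ 'n) set \<Rightarrow> (real ^ 'n \<Rightarrow> real \<Rightarrow> real) \<Rightarrow> (real ^ 'n \<Rightarrow> real) \<Rightarrow> bool" where
  "viscosity_supersolution \<Omega> F u \<longleftrightarrow> continuous_on \<Omega> u \<and>
     (\<forall>\<psi> q. C2_on \<Omega> \<psi> \<and> q \<in> \<Omega> \<and> (\<forall>\<^sub>F x in nhds q. u x - \<psi> x \<ge> u q - \<psi> q)
        \<longrightarrow> inf_laplacian \<psi> q \<le> F q (u q))"

definition viscosity_solution ::
    "(real ^ 'n) set \<Rightarrow> (real ^ 'n \<Rightarrow> real \<Rightarrow> real) \<Rightarrow> (real ^ 'n \<Rightarrow> real) \<Rightarrow> bool" where
  "viscosity_solution \<Omega> F u \<longleftrightarrow> viscosity_subsolution \<Omega> F u \<and> viscosity_supersolution \<Omega> F u"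

definition dirichlet_solution ::
    "real \<Rightarrow> (real ^ 'n \<Rightarrow> real) \<Rightarrow> real \<Rightarrow> real \<Rightarrow> (real ^ 'n \<Rightarrow> real) \<Rightarrow> bool" where
  "dirichlet_solution R a lam \<delta> u \<longleftrightarrow>
     continuous_on (cball 0 R) u \<and>
     viscosity_solution (ball 0 R) (\<lambda>x s. - lam * a x * s ^ 3) u \<and>
     (\<forall>x\<in>sphere 0 R. u x = \<delta>)"

definition positive_dirichlet_solution ::
    "real \<Rightarrow> (real ^ 'n \<Rightarrow> real) \<Rightarrow> real \<Rightarrow> real \<Rightarrow> (real ^ 'n \<Rightarrow> real) \<Rightarrow> bool" where
  "positive_dirichlet_solution R a lam \<delta> u \<longleftrightarrow>
     dirichlet_solution R a lam \<delta> u \<and> (\<forall>x\<in>ball 0 R. u x > 0)"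

text \<open>The supremum is taken in the extended reals, so that its meaning does not depend on knowing
  beforehand that the set is bounded above.\<close>

definition first_eigenvalue :: "real \<Rightarrow> real \<Rightarrow> (real ^ 'n \<Rightarrow> real) \<Rightarrow> ereal" where
  "first_eigenvalue \<delta>\<^sub>0 R a =
     (SUP lam \<in> {lam. lam \<ge> 0 \<and> (\<exists>w. positive_dirichlet_solution R a lam \<delta>\<^sub>0 w)}. ereal lam)"

text \<open>Here \<open>\<alpha>\<close> is the radial profile of the weight and \<open>u\<close> that of the solution.  Integrability
  is demanded explicitly, because a divergent \<open>integral\<close> has the value \<open>0\<close>.  The value \<open>\<alpha> R\<close>,
  about which nothing is known, does not influence the integrals.  At \<open>r = 0\<close> the equation
  reads \<open>u 0 = m\<close>.\<close>

definition solves_radial_integral_eq ::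
    "real \<Rightarrow> (real \<Rightarrow> real) \<Rightarrow> real \<Rightarrow> real \<Rightarrow> (real \<Rightarrow> real) \<Rightarrow> bool" where
  "solves_radial_integral_eq R \<alpha> lam m u \<longleftrightarrow>
     (\<forall>t\<in>{0..R}. (\<lambda>s. \<alpha> s * u s ^ 3) integrable_on {0..t}) \<and>
     (\<lambda>t. root 3 (integral {0..t} (\<lambda>s. \<alpha> s * u s ^ 3))) integrable_on {0..R} \<and>
     (\<forall>r\<in>{0..R}. u r = m - root 3 (3 * lam) *
        integral {0..r} (\<lambda>t. root 3 (integral {0..t} (\<lambda>s. \<alpha> s * u s ^ 3))))"

text \<open>At the singular endpoint \<open>s = 1\<close> the integrand is \<open>1 / 0 = 0\<close>; a single point does not
  matter.\<close>

definition F :: "real \<Rightarrow> real" where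
  "F t = integral {t..1} (\<lambda>s. 1 / root 4 (1 - s ^ 4))"

end

theory Submission
  imports Defs
begin

text \<open>
Write a radial function as a profile \<open>U\<close> with \<open>U'\<^sup>3 = - Z\<close>, \<open>Z' = h\<close> and \<open>Z 0 = 0\<close>.  Then
\<open>\<Delta>\<^sub>\<infinity>U = U'\<^sup>2 U'' = - h / 3\<close> away from the origin, and the integral equation says precisely
that \<open>h = 3 lam \<alpha> u\<^sup>3\<close>.  At the origin \<open>U\<close> has a cusp of order \<open>4/3\<close> and is not an admissible
test function.  The main technical point is that it may nevertheless be used as one
(\<open>supersolution_touched_by_profile\<close>, \<open>subsolution_touched_by_profile\<close>): the constant of the cusp,
fixed by \<open>h 0\<close>, is exactly the critical one for a viscosity sub- or supersolution at the origin
(\<open>cusp_bound_of_supersolution\<close>, \<open>cusp_bound_of_subsolution\<close>).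

Consequently an arbitrary positive viscosity solution can be compared with a strict radial sub- or
supersolution by looking at the extremum of their quotient (\<open>strict_radial_subsolution_le\<close>,
\<open>subsolution_le_strict_radial_supersolution\<close>); the equation is homogeneous of degree three, so
multiples of profiles are again profiles.  Strict sub- and supersolutions come for free: the
infinity-Laplacian ignores constants, so \<open>u + c\<close> is a strict subsolution and \<open>u - c\<close> a strict
supersolution whenever \<open>u\<close> is a positive solution.

For a parameter below the first eigenvalue there is a positive solution for some larger parameter.
Compared with it, a radial solution cannot reach zero (\<open>radial_solution_positive\<close>); uniqueness
follows from the comparison with \<open>u \<plusminus> c\<close> as \<open>c\<close> tends to zero (\<open>dirichlet_solution_unique\<close>).
At the eigenvalue, let \<open>v\<close> be the solution with \<open>v 0 = 1\<close> of the equation in which \<open>v\<close> is replaced by its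
truncation (\<open>truncated_radial_equation_has_solution\<close>).  If \<open>v R\<close> were negative or positive, a constant
could be added to or subtracted from \<open>v\<close>, giving a strict subsolution below or a positive
supersolution above the eigenvalue; both contradict its definition
(\<open>eigenvalue_solution_vanishes_on_boundary\<close>).  For a constant weight, the energy
\<open>u'\<^sup>4 + lam k u\<^sup>4\<close> is conserved, and separation of variables leads to the function \<open>F\<close>.
\<close>

section \<open>Test functions with explicit infinity-Laplacian\<close>

lemma partial_eq_gradient:
  fixes f :: "real ^ 'n \<Rightarrow> real"
  assumes "(f has_derivative (\<lambda>v. g \<bullet> v)) (at x)"
  shows "partial i f x = g $ i"
  unfolding partial_def frechet_derivative_at[OF assms, symmetric]
  by (simp add: inner_axis)

lemma frechet_derivative_eq_sum_partial:
  fixes f :: "real ^ 'n \<Rightarrow> real"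
  assumes "f differentiable (at x)"
  shows "frechet_derivative f (at x) v = (\<Sum>i\<in>UNIV. v $ i * partial i f x)"
proof -
  interpret linear "frechet_derivative f (at x)"
    by (rule linear_frechet_derivative[OF assms])
  have "frechet_derivative f (at x) v = frechet_derivative f (at x) (\<Sum>i\<in>UNIV. v $ i *\<^sub>R axis i 1)"
    by (simp add: basis_expansion flip: scalar_mult_eq_scaleR)
  also have "\<dots> = (\<Sum>i\<in>UNIV. v $ i * partial i f x)"
    by (simp add: sum scale partial_def)
  finally show ?thesis .
qed

lemma linear_eq_sum_axis:
  fixes L :: "real ^ 'n \<Rightarrow> 'b::real_vector"
  assumes "linear L"
  shows "L v = (\<Sum>i\<in>UNIV. v $ i *\<^sub>R L (axis i 1))"
proof -
  interpret linear L by fact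
  have "L v = L (\<Sum>i\<in>UNIV. v $ i *\<^sub>R axis i 1)"
    by (simp add: basis_expansion flip: scalar_mult_eq_scaleR)
  then show ?thesis
    by (simp add: sum scale)
qed

text \<open>Test functions are handled without coordinates: once gradient and Hessian are known as maps,
\<open>\<Delta>\<^sub>\<infinity>f\<close> is the Hessian applied twice to the gradient.\<close>

lemma C2_and_inf_laplacian_from_hessian:
  fixes f :: "real ^ 'n \<Rightarrow> real"
  assumes grad: "\<And>x. (f has_derivative (\<lambda>v. g x \<bullet> v)) (at x)"
    and hess: "\<And>x. (g has_derivative H x) (at x)"
    and cont: "\<And>v. continuous_on UNIV (\<lambda>x. H x v)"
  shows "C2_on S f" and "inf_laplacian f x = H x (g x) \<bullet> g x"
proof -
  have p1: "partial i f = (\<lambda>x. g x $ i)" for i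
    using partial_eq_gradient[OF grad] by auto
  have d2: "((\<lambda>x. g x $ j) has_derivative (\<lambda>v. H x v $ j)) (at x)" for j x
    using bounded_linear.has_derivative[OF bounded_linear_vec_nth hess] .
  have p2: "partial i (partial j f) = (\<lambda>x. H x (axis i 1) $ j)" for i j
    using frechet_derivative_at[OF d2] by (simp add: partial_def p1 fun_eq_iff)
  have c1: "continuous_on S (partial i f)" for i
    unfolding p1
    by (intro continuous_at_imp_continuous_on ballI has_derivative_continuous[OF d2])
  have c2: "continuous_on S (partial i (partial j f))" for i j
    unfolding p2 using cont continuous_on_subset subset_UNIV
    by (blast intro!: continuous_on_component)
  show "C2_on S f"
    unfolding C2_on_def C1_on_def
    using c1 c2 grad d2 differentiable_def p1
    by (metis differentiable_at_imp_differentiable_on)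
  have lin: "linear (H x)"
    using hess has_derivative_linear by blast
  have "inf_laplacian f x = (\<Sum>j\<in>UNIV. (\<Sum>i\<in>UNIV. g x $ i * H x (axis i 1) $ j) * g x $ j)"
    unfolding inf_laplacian_def p1 p2[unfolded p1]
    by (subst sum.swap) (simp add: sum_distrib_right sum_distrib_left mult_ac)
  also have "\<dots> = (\<Sum>j\<in>UNIV. H x (g x) $ j * g x $ j)"
    by (subst linear_eq_sum_axis[OF lin, of "g x"]) simp
  also have "\<dots> = H x (g x) \<bullet> g x"
    by (simp add: inner_vec_def)
  finally show "inf_laplacian f x = H x (g x) \<bullet> g x" .
qed

text \<open>Radial test functions are polynomials in \<open>\<bar>x\<bar>\<^sup>2\<close>, not in \<open>\<bar>x\<bar>\<close>, so that they are
smooth at the origin as well.\<close>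

definition radial_quadratic :: "real \<Rightarrow> real \<Rightarrow> real \<Rightarrow> real \<Rightarrow> real ^ 'n \<Rightarrow> real" where
  "radial_quadratic s A B C x = A + B * (x \<bullet> x - s) + C * (x \<bullet> x - s)\<^sup>2"

lemma radial_quadratic_test:
  fixes x :: "real ^ 'n" and S :: "(real ^ 'n) set"
  shows "C2_on S (radial_quadratic s A B C)"
    and "x \<bullet> x = s \<Longrightarrow> inf_laplacian (radial_quadratic s A B C) x = 8 * B ^ 3 * s + 32 * B\<^sup>2 * C * s\<^sup>2"
proof -
  let ?g = "\<lambda>x::real^'n. (2 * (B + 2 * C * (x \<bullet> x - s))) *\<^sub>R x"
  let ?H = "\<lambda>(x::real^'n) v. (2 * (B + 2 * C * (x \<bullet> x - s))) *\<^sub>R v + (8 * C * (x \<bullet> v)) *\<^sub>R x"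
  have 1: "(radial_quadratic s A B C has_derivative (\<lambda>v. ?g x \<bullet> v)) (at x)" for x :: "real^'n"
    unfolding radial_quadratic_def[abs_def]
    by (rule derivative_eq_intros refl)+ (auto simp: fun_eq_iff algebra_simps inner_commute power2_eq_square)
  have 2: "(?g has_derivative ?H x) (at x)" for x
    by (rule derivative_eq_intros refl)+ (auto simp: fun_eq_iff algebra_simps inner_commute)
  have 3: "continuous_on UNIV (\<lambda>x. ?H x v)" for v
    by (intro continuous_intros)
  show "C2_on S (radial_quadratic s A B C)"
    by (rule C2_and_inf_laplacian_from_hessian(1)[where g = ?g and H = ?H, OF 1 2 3])
  assume "x \<bullet> x = s"
  then show "inf_laplacian (radial_quadratic s A B C) x = 8 * B ^ 3 * s + 32 * B\<^sup>2 * C * s\<^sup>2"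
    by (simp add: C2_and_inf_laplacian_from_hessian(2)[where g = ?g and H = ?H, OF 1 2 3] inner_add_left algebra_simps
        power2_eq_square power3_eq_cube)
qed

text \<open>A smooth radial function has zero gradient, hence zero infinity-Laplacian, at the origin.  Where a
large negative value is needed there, a parabola in one direction with a small slope serves instead.\<close>

definition plane_quadratic :: "real ^ 'n \<Rightarrow> real \<Rightarrow> real ^ 'n \<Rightarrow> real" where
  "plane_quadratic v0 K x = v0 \<bullet> x - K * (v0 \<bullet> x)\<^sup>2"

lemma plane_quadratic_test:
  fixes v0 :: "real ^ 'n"
  shows "C2_on S (plane_quadratic v0 K)"
    and "inf_laplacian (plane_quadratic v0 K) 0 = - 2 * K * norm v0 ^ 4"
proof -
  let ?g = "\<lambda>x::real^'n. (1 - 2 * K * (v0 \<bullet> x)) *\<^sub>R v0"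
  let ?H = "\<lambda>(x::real^'n) v. (- 2 * K * (v0 \<bullet> v)) *\<^sub>R v0"
  have 1: "(plane_quadratic v0 K has_derivative (\<lambda>v. ?g x \<bullet> v)) (at x)" for x :: "real^'n"
    unfolding plane_quadratic_def[abs_def]
    by (rule derivative_eq_intros refl)+ (auto simp: fun_eq_iff algebra_simps inner_commute power2_eq_square)
  have 2: "(?g has_derivative ?H x) (at x)" for x
    by (rule derivative_eq_intros refl)+ (auto simp: fun_eq_iff algebra_simps inner_commute)
  have 3: "continuous_on UNIV (\<lambda>x. ?H x v)" for v
    by (intro continuous_intros)
  show "C2_on S (plane_quadratic v0 K)"
    by (rule C2_and_inf_laplacian_from_hessian(1)[where g = ?g and H = ?H, OF 1 2 3])
  show "inf_laplacian (plane_quadratic v0 K) 0 = - 2 * K * norm v0 ^ 4"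
    by (simp add: C2_and_inf_laplacian_from_hessian(2)[where g = ?g and H = ?H, OF 1 2 3] power4_eq_xxxx
        flip: power2_norm_eq_inner power2_eq_square)
qed

section \<open>Radial functions touching a viscosity sub- or supersolution away from the origin\<close>

lemma strict_local_min_if_second_derivative_pos:
  fixes f f' :: "real \<Rightarrow> real"
  assumes d1: "\<forall>\<^sub>F t in nhds r. (f has_real_derivative f' t) (at t)"
    and zero: "f' r = 0"
    and d2: "(f' has_real_derivative d) (at r)"
    and pos: "d > 0"
  shows "\<forall>\<^sub>F t in nhds r. t \<noteq> r \<longrightarrow> f r < f t"
proof -
  obtain e1 where e1: "e1 > 0" "\<And>t. dist t r < e1 \<Longrightarrow> (f has_real_derivative f' t) (at t)"
    using d1 unfolding eventually_nhds_metric by auto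
  obtain e2 where e2: "e2 > 0" "\<And>h. 0 < h \<Longrightarrow> h < e2 \<Longrightarrow> f' r < f' (r + h)"
    using DERIV_pos_inc_right[OF d2 pos] by auto
  obtain e3 where e3: "e3 > 0" "\<And>h. 0 < h \<Longrightarrow> h < e3 \<Longrightarrow> f' (r - h) < f' r"
    using DERIV_pos_inc_left[OF d2 pos] by auto
  define e where "e = min e1 (min e2 e3)"
  have cont: "continuous_on S f" if "\<And>t. t \<in> S \<Longrightarrow> dist t r < e" for S
    using that e1(2) by (force simp: e_def intro!: continuous_at_imp_continuous_on DERIV_isCont)
  have "f r < f t" if t: "dist t r < e" "t \<noteq> r" for t
  proof (cases "r < t")
    case True
    show ?thesis
    proof (rule DERIV_pos_imp_increasing_open[OF True])
      fix x assume "r < x" "x < t"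
      then show "\<exists>y. DERIV f x :> y \<and> 0 < y"
        using e1(2)[of x] e2(2)[of "x - r"] t zero by (auto simp: e_def dist_real_def)
    qed (use t in \<open>auto intro!: cont simp: dist_real_def\<close>)
  next
    case False
    then have "t < r" using t by auto
    then show ?thesis
    proof (rule DERIV_neg_imp_decreasing_open)
      fix x assume "t < x" "x < r"
      then show "\<exists>y. DERIV f x :> y \<and> y < 0"
        using e1(2)[of x] e3(2)[of "r - x"] t zero by (auto simp: e_def dist_real_def)
    qed (use t in \<open>auto intro!: cont simp: dist_real_def\<close>)
  qed
  moreover have "e > 0" using e1 e2 e3 by (auto simp: e_def)
  ultimately show ?thesis
    unfolding eventually_nhds_metric by auto
qed

lemma second_derivative_nonpos_at_local_max:
  fixes f f' :: "real \<Rightarrow> real"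
  assumes d1: "\<forall>\<^sub>F t in nhds r. (f has_real_derivative f' t) (at t)"
    and d2: "(f' has_real_derivative d) (at r)"
    and max: "\<forall>\<^sub>F t in nhds r. f t \<le> f r"
  shows "f' r = 0" "d \<le> 0"
proof -
  obtain e where "e > 0" "\<And>t. dist t r < e \<Longrightarrow> f t \<le> f r"
    using max unfolding eventually_nhds_metric by auto
  then show z: "f' r = 0"
    using DERIV_local_max[OF eventually_nhds_x_imp_x[OF d1]]
    by (auto simp: dist_real_def abs_minus_commute)
  show "d \<le> 0"
  proof (rule ccontr)
    assume "\<not> d \<le> 0"
    then have "\<forall>\<^sub>F t in nhds r. t \<noteq> r \<longrightarrow> f r < f t"
      by (intro strict_local_min_if_second_derivative_pos[OF d1 z d2]) auto
    then have "\<forall>\<^sub>F t in nhds r. t = r"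
      using max by eventually_elim force
    then obtain e where "e > 0" "\<And>t. dist t r < e \<Longrightarrow> t = r"
      unfolding eventually_nhds_metric by auto
    from this(2)[of "r + e/2"] this(1) show False
      by (auto simp: dist_real_def)
  qed
qed

lemma tendsto_norm_nhds: "((\<lambda>x::'a::real_normed_vector. norm x) \<longlongrightarrow> norm p) (nhds p)"
  by (rule tendsto_norm[OF filterlim_ident])

text \<open>The polynomial is the second order Taylor polynomial of \<open>g\<close> in the variable \<open>r\<^sup>2\<close>, with its
last coefficient lowered a little; the second derivative test then makes it lie below \<open>g\<close>.  Its
infinity-Laplacian at \<open>p\<close> differs from the formal value \<open>g'\<^sup>2 g''\<close> by a multiple of \<open>e\<close>.\<close>

lemma radial_quadratic_below:
  fixes p :: "real ^ 'n"
  assumes p: "p \<noteq> 0"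
    and d1: "\<forall>\<^sub>F t in nhds (norm p). (g has_real_derivative g' t) (at t)"
    and d2: "(g' has_real_derivative g2) (at (norm p))"
    and e: "e > 0"
  obtains A B C where
    "\<forall>\<^sub>F x in nhds p. radial_quadratic (p \<bullet> p) A B C x \<le> g (norm x)"
    "radial_quadratic (p \<bullet> p) A B C p = g (norm p)"
    "8 * B ^ 3 * (p \<bullet> p) + 32 * B\<^sup>2 * C * (p \<bullet> p)\<^sup>2 = (g' (norm p))\<^sup>2 * (g2 - e)"
proof -
  define r where "r = norm p"
  define s where "s = p \<bullet> p"
  have r: "r > 0" "s = r\<^sup>2"
    using p by (auto simp: r_def s_def power2_norm_eq_inner)
  define B where "B = g' r / (2 * r)"
  define C where "C = (g2 - g' r / r - e) / (8 * r\<^sup>2)"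
  define f where "f = (\<lambda>t. g t - (B * (t\<^sup>2 - s) + C * (t\<^sup>2 - s)\<^sup>2))"
  have "\<forall>\<^sub>F t in nhds r. (f has_real_derivative g' t - (2 * B * t + 4 * C * (t * (t\<^sup>2 - s)))) (at t)"
    using d1 unfolding f_def r_def[symmetric]
    by eventually_elim (auto intro!: derivative_eq_intros simp: algebra_simps)
  moreover have "g' r - (2 * B * r + 4 * C * (r * (r\<^sup>2 - s))) = 0"
    using r by (simp add: B_def)
  moreover have "((\<lambda>t. g' t - (2 * B * t + 4 * C * (t * (t\<^sup>2 - s)))) has_real_derivative
      g2 - (2 * B + 8 * C * r\<^sup>2)) (at r)"
    using d2 unfolding r_def[symmetric] using r
    by (auto intro!: derivative_eq_intros simp: algebra_simps power2_eq_square)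
  moreover have "g2 - (2 * B + 8 * C * r\<^sup>2) > 0"
  proof -
    have "2 * B = g' r / r" "8 * C * r\<^sup>2 = g2 - g' r / r - e"
      using r by (auto simp: B_def C_def)
    then show ?thesis using e by simp
  qed
  ultimately have "\<forall>\<^sub>F t in nhds r. t \<noteq> r \<longrightarrow> f r < f t"
    by (rule strict_local_min_if_second_derivative_pos)
  from eventually_compose_filterlim[OF this[unfolded r_def] tendsto_norm_nhds]
  have "\<forall>\<^sub>F x in nhds p. radial_quadratic s (g r) B C x \<le> g (norm x)"
  proof eventually_elim
    case (elim x)
    then have "norm x = r \<or> f r < f (norm x)" by (auto simp: r_def)
    then show ?case
      using r by (auto simp: radial_quadratic_def f_def dot_square_norm)
  qed
  moreover have "radial_quadratic s (g r) B C p = g r"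
    by (simp add: radial_quadratic_def s_def)
  moreover have "8 * B ^ 3 * s + 32 * B\<^sup>2 * C * s\<^sup>2 = (g' r)\<^sup>2 * (g2 - e)"
    using r by (simp add: B_def C_def field_simps power2_eq_square power3_eq_cube)
  ultimately show thesis
    using that unfolding r_def s_def by blast
qed

text \<open>The function \<open>g\<close> need not be twice differentiable except at one point, so it is no admissible test
function itself; its quadratic minorants are, and \<open>e\<close> tends to zero.\<close>

lemma supersolution_touched_by_radial:
  fixes p :: "real ^ 'n"
  assumes w: "viscosity_supersolution \<Omega> G w" and p: "p \<in> \<Omega>" "p \<noteq> 0"
    and min: "\<forall>\<^sub>F x in nhds p. w x - g (norm x) \<ge> w p - g (norm p)"
    and d1: "\<forall>\<^sub>F t in nhds (norm p). (g has_real_derivative g' t) (at t)"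
    and d2: "(g' has_real_derivative g2) (at (norm p))"
  shows "(g' (norm p))\<^sup>2 * g2 \<le> G p (w p)"
proof -
  have "(g' (norm p))\<^sup>2 * (g2 - e) \<le> G p (w p)" if e: "e > 0" for e
  proof -
    obtain A B C where *:
      "\<forall>\<^sub>F x in nhds p. radial_quadratic (p \<bullet> p) A B C x \<le> g (norm x)"
      "radial_quadratic (p \<bullet> p) A B C p = g (norm p)"
      "8 * B ^ 3 * (p \<bullet> p) + 32 * B\<^sup>2 * C * (p \<bullet> p)\<^sup>2 = (g' (norm p))\<^sup>2 * (g2 - e)"
      using radial_quadratic_below[OF p(2) d1 d2 e] by blast
    have "\<forall>\<^sub>F x in nhds p. w x - radial_quadratic (p \<bullet> p) A B C x \<ge> w p - radial_quadratic (p \<bullet> p) A B C p"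
      using *(1) min by eventually_elim (simp add: *(2))
    then have "inf_laplacian (radial_quadratic (p \<bullet> p) A B C) p \<le> G p (w p)"
      using w p radial_quadratic_test(1) unfolding viscosity_supersolution_def by blast
    then show ?thesis
      by (simp add: radial_quadratic_test(2) *(3))
  qed
  then have "\<forall>\<^sub>F e in at_right 0. (g' (norm p))\<^sup>2 * (g2 - e) \<le> G p (w p)"
    by (simp add: eventually_at_right_less eventually_mono[OF eventually_at_right_less[of 0]])
  moreover have "((\<lambda>e. (g' (norm p))\<^sup>2 * (g2 - e)) \<longlongrightarrow> (g' (norm p))\<^sup>2 * (g2 - 0)) (at_right 0)"
    by (intro tendsto_intros)
  ultimately show ?thesis
    using tendsto_upperbound[of _ _ "at_right (0::real)"] by fastforce
qed

lemma subsolution_touched_by_radial: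
  fixes p :: "real ^ 'n"
  assumes w: "viscosity_subsolution \<Omega> G w" and p: "p \<in> \<Omega>" "p \<noteq> 0"
    and max: "\<forall>\<^sub>F x in nhds p. w x - g (norm x) \<le> w p - g (norm p)"
    and d1: "\<forall>\<^sub>F t in nhds (norm p). (g has_real_derivative g' t) (at t)"
    and d2: "(g' has_real_derivative g2) (at (norm p))"
  shows "(g' (norm p))\<^sup>2 * g2 \<ge> G p (w p)"
proof -
  have d1': "\<forall>\<^sub>F t in nhds (norm p). ((\<lambda>t. - g t) has_real_derivative - g' t) (at t)"
    using d1 by eventually_elim (rule DERIV_minus)
  have d2': "((\<lambda>t. - g' t) has_real_derivative - g2) (at (norm p))"
    using d2 by (rule DERIV_minus)
  have "(g' (norm p))\<^sup>2 * (g2 + e) \<ge> G p (w p)" if e: "e > 0" for e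
  proof -
    obtain A B C where *:
      "\<forall>\<^sub>F x in nhds p. radial_quadratic (p \<bullet> p) A B C x \<le> - g (norm x)"
      "radial_quadratic (p \<bullet> p) A B C p = - g (norm p)"
      "8 * B ^ 3 * (p \<bullet> p) + 32 * B\<^sup>2 * C * (p \<bullet> p)\<^sup>2 = (- g' (norm p))\<^sup>2 * (- g2 - e)"
      using radial_quadratic_below[OF p(2) d1' d2' e] by blast
    have neg: "radial_quadratic (p \<bullet> p) (-A) (-B) (-C) x = - radial_quadratic (p \<bullet> p) A B C x" for x
      by (simp add: radial_quadratic_def)
    have "\<forall>\<^sub>F x in nhds p. w x - radial_quadratic (p \<bullet> p) (-A) (-B) (-C) x
        \<le> w p - radial_quadratic (p \<bullet> p) (-A) (-B) (-C) p"
      using *(1) max by eventually_elim (simp add: *(2) neg)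
    then have "inf_laplacian (radial_quadratic (p \<bullet> p) (-A) (-B) (-C)) p \<ge> G p (w p)"
      using w p radial_quadratic_test(1) unfolding viscosity_subsolution_def by blast
    then show ?thesis
      using *(3) by (simp add: radial_quadratic_test(2) algebra_simps)
  qed
  then have "\<forall>\<^sub>F e in at_right 0. (g' (norm p))\<^sup>2 * (g2 + e) \<ge> G p (w p)"
    by (simp add: eventually_mono[OF eventually_at_right_less[of 0]])
  moreover have "((\<lambda>e. (g' (norm p))\<^sup>2 * (g2 + e)) \<longlongrightarrow> (g' (norm p))\<^sup>2 * (g2 + 0)) (at_right 0)"
    by (intro tendsto_intros)
  ultimately show ?thesis
    using tendsto_lowerbound[of _ _ "at_right (0::real)"] by fastforce
qed

section \<open>Cusps of order four thirds at the origin\<close>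

text \<open>A gap between centre and boundary sphere survives small perturbations; it forces the perturbed
function to attain its minimum at an interior point.\<close>

lemma sphere_gap_min_inside:
  fixes f :: "'a::euclidean_space \<Rightarrow> real"
  assumes "continuous_on (cball 0 \<rho>) f" "\<rho> > 0" "\<And>x. norm x = \<rho> \<Longrightarrow> f 0 < f x"
  obtains p where "p \<in> ball 0 \<rho>" "\<forall>\<^sub>F x in nhds p. f p \<le> f x"
proof -
  obtain p where p: "p \<in> cball 0 \<rho>" "\<And>x. x \<in> cball 0 \<rho> \<Longrightarrow> f p \<le> f x"
    using continuous_attains_inf[OF compact_cball _ assms(1)] assms(2) by auto
  have "norm p \<noteq> \<rho>"
    using p(2)[of 0] assms(2) assms(3)[of p] by force
  then have "p \<in> ball 0 \<rho>" using p(1) by auto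
  moreover have "\<forall>\<^sub>F x in nhds p. f p \<le> f x"
    using eventually_nhds_in_open[OF open_ball \<open>p \<in> ball 0 \<rho>\<close>]
    by eventually_elim (use p(2) in auto)
  ultimately show thesis using that by blast
qed

text \<open>The function \<open>c t\<^sup>4\<^sup>/\<^sup>3\<close> has infinity-Laplacian \<open>64/81 c\<^sup>3\<close> away from the origin but is
not twice differentiable there.  Translating its singularity to \<open>t = -e\<close> makes it
smooth for \<open>t \<ge> 0\<close>.\<close>

definition blunt_cusp :: "real \<Rightarrow> real \<Rightarrow> real \<Rightarrow> real" where
  "blunt_cusp c e t = c * ((t + e) powr (4/3) - e powr (4/3))"

lemma blunt_cusp_tendsto:
  assumes "t > 0"
  shows "((\<lambda>e. blunt_cusp c e t) \<longlongrightarrow> c * t powr (4/3)) (at_right 0)"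
proof -
  have "((\<lambda>e. blunt_cusp c e t) \<longlongrightarrow> c * ((t + 0) powr (4/3) - 0 powr (4/3))) (at_right 0)"
    unfolding blunt_cusp_def
    using assms eventually_at_right_less[of "0::real"]
    by (intro tendsto_intros) (auto elim: eventually_mono)
  then show ?thesis by simp
qed

lemma powr_thirds:
  assumes "(s::real) > 0"
  shows "(s powr (1/3))\<^sup>2 * s powr - (2/3) = 1"
  using assms by (simp add: power2_eq_square flip: powr_add)

text \<open>If the bound failed, a slightly steeper cusp \<open>w 0 - c \<bar>x\<bar>\<^sup>4\<^sup>/\<^sup>3\<close> would still have an
infinity-Laplacian above \<open>-\<kappa>\<close>, and a regularisation of it could be moved until it touches \<open>w\<close>
from below at an interior point \<open>p\<close>.  Away from the origin this contradicts the equation by the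
computation of \<open>f1\<^sup>2 f2\<close>; at the origin the regularisation has zero gradient, so a parabola
with zero infinity-Laplacian touches \<open>w\<close>, while \<open>\<kappa> > 0\<close>.\<close>

lemma cusp_bound_of_supersolution:
  fixes w :: "real ^ 'n \<Rightarrow> real"
  assumes w: "viscosity_supersolution \<Omega> G w"
    and \<rho>: "\<rho> > 0" "ball 0 \<rho> \<subseteq> \<Omega>"
    and C: "C \<ge> 0" and \<kappa>: "\<kappa> > 0"
    and cusp: "\<And>x. norm x < \<rho> \<Longrightarrow> w x \<ge> w 0 - C * norm x powr (4/3)"
    and G: "\<And>x. norm x < \<rho> \<Longrightarrow> G x (w x) \<le> - \<kappa>"
  shows "\<kappa> \<le> 64/81 * C ^ 3"
proof (rule ccontr)
  assume "\<not> \<kappa> \<le> 64/81 * C ^ 3"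
  then have less: "C ^ 3 < 81/64 * \<kappa>" by simp
  \<comment> \<open>the mean of the cubes keeps \<open>c\<close> strictly between \<open>C\<close> and the critical slope\<close>
  define c where "c = root 3 ((C ^ 3 + 81/64 * \<kappa>) / 2)"
  have c3: "c ^ 3 = (C ^ 3 + 81/64 * \<kappa>) / 2"
    unfolding c_def using C \<kappa> by (intro real_root_pow_pos2) auto
  have c: "c > 0" unfolding c_def using C \<kappa> by (auto intro!: add_nonneg_pos)
  have "C < c"
    using less c3 c by (intro power_less_imp_less_base[of C 3 c]) auto
  define r where "r = \<rho> / 2"
  have r: "0 < r" "r < \<rho>" using \<rho> by (auto simp: r_def)
  \<comment> \<open>subtracting the tangent line makes the comparison function flat to second order at the origin\<close>
  define f where "f = (\<lambda>e t. blunt_cusp c e t - 4/3 * c * e powr (1/3) * t)"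
  have "((\<lambda>e. f e r) \<longlongrightarrow> c * r powr (4/3) - 4/3 * c * 0 powr (1/3) * r) (at_right 0)"
    unfolding f_def
    by (intro tendsto_intros blunt_cusp_tendsto r) (use eventually_at_right_less[of "0::real"] in \<open>auto elim: eventually_mono\<close>)
  moreover have "C * r powr (4/3) < c * r powr (4/3)" using \<open>C < c\<close> r by simp
  ultimately have "\<forall>\<^sub>F e in at_right 0. C * r powr (4/3) < f e r"
    by (auto intro: order_tendstoD(1))
  then have "\<forall>\<^sub>F e in at_right 0. e > 0 \<and> C * r powr (4/3) < f e r"
    using eventually_at_right_less[of 0] by eventually_elim auto
  then obtain e where e: "e > 0" "C * r powr (4/3) < f e r"
    using eventually_happens'[OF trivial_limit_at_right_real] by blast
  have f0: "f e 0 = 0" by (simp add: f_def blunt_cusp_def)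
  define f1 where "f1 = (\<lambda>t. 4/3 * c * ((t + e) powr (1/3) - e powr (1/3)))"
  define f2 where "f2 = (\<lambda>t. 4/9 * c * (t + e) powr - (2/3))"
  have d1: "(f e has_real_derivative f1 t) (at t)" if "t > - e" for t
    unfolding f_def blunt_cusp_def f1_def
    by (rule derivative_eq_intros refl | use that in \<open>simp add: algebra_simps\<close>)+
  have d2: "(f1 has_real_derivative f2 t) (at t)" if "t > - e" for t
    unfolding f1_def f2_def
    by (rule derivative_eq_intros refl | use that in \<open>simp add: algebra_simps\<close>)+
  have d1': "\<forall>\<^sub>F t in nhds s. (f e has_real_derivative f1 t) (at t)" if "s > - e" for s
    using eventually_nhds_in_open[of "{-e<..}" s] that by (auto elim!: eventually_mono intro: d1)
  have contf: "continuous_on (cball 0 r) (\<lambda>x::real^'n. f e (norm x))"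
    by (rule continuous_on_compose2[of "{0..}" "f e"])
       (use e in \<open>auto intro!: continuous_intros continuous_at_imp_continuous_on DERIV_isCont[OF d1]\<close>)
  have contw: "continuous_on (cball 0 r) w"
    using w \<rho> r unfolding viscosity_supersolution_def
    by (auto elim!: continuous_on_subset simp: subset_iff)
  obtain p where p: "p \<in> ball 0 r" "\<forall>\<^sub>F x in nhds p. w p + f e (norm p) \<le> w x + f e (norm x)"
  proof (rule sphere_gap_min_inside[of r "\<lambda>x. w x + f e (norm x)"])
    show "w 0 + f e (norm (0::real^'n)) < w x + f e (norm x)" if "norm x = r" for x
      using cusp[of x] e(2) r that by (simp add: f0)
  qed (use r contf contw in \<open>auto intro!: continuous_intros\<close>)
  have pO: "p \<in> \<Omega>" "norm p < \<rho>" using p(1) r \<rho> by auto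
  show False
  proof (cases "p = 0")
    case True
    let ?h = "\<lambda>t. f2 0 * t\<^sup>2 - f e t"
    have "\<forall>\<^sub>F t in nhds 0. (?h has_real_derivative 2 * f2 0 * t - f1 t) (at t)"
      using d1'[of 0] e by (auto elim!: eventually_mono intro!: derivative_eq_intros)
    moreover have "((\<lambda>t. 2 * f2 0 * t - f1 t) has_real_derivative 2 * f2 0 - f2 0) (at 0)"
      using d2[of 0] e by (auto intro!: derivative_eq_intros)
    moreover have "2 * f2 0 - f2 0 > 0" using c e by (simp add: f2_def)
    ultimately have "\<forall>\<^sub>F t in nhds 0. t \<noteq> 0 \<longrightarrow> ?h 0 < ?h t"
      by (intro strict_local_min_if_second_derivative_pos) (auto simp: f1_def)
    then have "\<forall>\<^sub>F t in nhds (norm p). f e t \<le> f2 0 * t\<^sup>2"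
      unfolding True by (simp, elim eventually_mono) (use f0 in \<open>force\<close>)
    from eventually_compose_filterlim[OF this tendsto_norm_nhds]
    have "\<forall>\<^sub>F x in nhds p. w x - radial_quadratic 0 0 (- f2 0) 0 x \<ge> w p - radial_quadratic 0 0 (- f2 0) 0 p"
      using p(2) by eventually_elim (simp add: True radial_quadratic_def f0 power2_norm_eq_inner)
    then have "inf_laplacian (radial_quadratic 0 0 (- f2 0) 0) p \<le> G p (w p)"
      using w pO radial_quadratic_test(1) unfolding viscosity_supersolution_def by blast
    then show False
      using G[OF pO(2)] \<kappa> by (simp add: True radial_quadratic_test(2))
  next
    case False
    let ?s = "norm p + e"
    have s: "?s > 0" using e by (simp add: add_nonneg_pos)
    have "(- f1 (norm p))\<^sup>2 * (- f2 (norm p)) \<le> G p (w p)"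
    proof (rule supersolution_touched_by_radial[OF w pO(1) False, where g = "\<lambda>t. - f e t"])
      show "\<forall>\<^sub>F t in nhds (norm p). ((\<lambda>a. - f e a) has_real_derivative - f1 t) (at t)"
        using d1'[of "norm p"] s by (auto elim!: eventually_mono intro!: derivative_eq_intros)
      show "((\<lambda>t. - f1 t) has_real_derivative - f2 (norm p)) (at (norm p))"
        using d2[of "norm p"] s by (auto intro!: derivative_eq_intros)
    qed (use p(2) in simp)
    then have "\<kappa> \<le> (f1 (norm p))\<^sup>2 * f2 (norm p)"
      using G[OF pO(2)] by simp
    also have "\<dots> \<le> (4/3 * c * ?s powr (1/3))\<^sup>2 * f2 (norm p)"
    proof (intro mult_right_mono power_mono)
      have "e powr (1/3) \<le> ?s powr (1/3)"
        using e by (intro powr_mono2) auto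
      then show "f1 (norm p) \<le> 4/3 * c * ?s powr (1/3)" "0 \<le> f1 (norm p)"
        using c by (auto simp: f1_def)
    qed (use c in \<open>simp add: f2_def\<close>)
    also have "\<dots> = 64/81 * c ^ 3 * ((?s powr (1/3))\<^sup>2 * ?s powr - (2/3))"
      by (simp add: f2_def power_mult_distrib power2_eq_square power3_eq_cube)
    also have "\<dots> = 64/81 * c ^ 3"
      by (simp only: powr_thirds[OF s])
    finally show False using less c3 by simp
  qed
qed

text \<open>The dual statement needs a different regularisation.  A flat function touching from above at the
origin gives no contradiction there, since \<open>0 \<ge> -\<kappa>\<close> is true.  The comparison function
therefore keeps a conical tip: below a cone of positive slope there is room for a tilted parabola
whose infinity-Laplacian is as negative as desired.\<close>

lemma cusp_bound_of_subsolution: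
  fixes w :: "real ^ 'n \<Rightarrow> real"
  assumes w: "viscosity_subsolution \<Omega> G w"
    and \<rho>: "\<rho> > 0" "ball 0 \<rho> \<subseteq> \<Omega>"
    and C: "C \<ge> 0" and \<kappa>: "\<kappa> > 0"
    and cusp: "\<And>x. norm x < \<rho> \<Longrightarrow> w x \<le> w 0 - C * norm x powr (4/3)"
    and G: "\<And>x. norm x < \<rho> \<Longrightarrow> G x (w x) \<ge> - \<kappa>"
  shows "64/81 * C ^ 3 \<le> \<kappa>"
proof (rule ccontr)
  assume "\<not> 64/81 * C ^ 3 \<le> \<kappa>"
  then have less: "81/64 * \<kappa> < C ^ 3" by simp
  \<comment> \<open>the mean of the cubes keeps \<open>c\<close> strictly between \<open>C\<close> and the critical slope\<close>
  define c where "c = root 3 ((C ^ 3 + 81/64 * \<kappa>) / 2)"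
  have c3: "c ^ 3 = (C ^ 3 + 81/64 * \<kappa>) / 2"
    unfolding c_def using C \<kappa> by (intro real_root_pow_pos2) auto
  have c: "c > 0" unfolding c_def using C \<kappa> by (auto intro!: add_nonneg_pos)
  have "c < C"
    using less c3 C by (intro power_less_imp_less_base[of c 3 C]) auto
  define r where "r = \<rho> / 2"
  have r: "0 < r" "r < \<rho>" using \<rho> by (auto simp: r_def)
  have "c * r powr (4/3) < C * r powr (4/3)" using \<open>c < C\<close> r by simp
  then have "\<forall>\<^sub>F e in at_right 0. blunt_cusp c e r < C * r powr (4/3)"
    by (rule order_tendstoD(2)[OF blunt_cusp_tendsto[OF r(1)]])
  then have "\<forall>\<^sub>F e in at_right 0. e > 0 \<and> blunt_cusp c e r < C * r powr (4/3)"
    using eventually_at_right_less[of 0] by eventually_elim auto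
  then obtain e where e: "e > 0" "blunt_cusp c e r < C * r powr (4/3)"
    using eventually_happens'[OF trivial_limit_at_right_real] by blast
  define f where "f = blunt_cusp c e"
  have f0: "f 0 = 0" by (simp add: f_def blunt_cusp_def)
  define f1 where "f1 = (\<lambda>t. 4/3 * c * (t + e) powr (1/3))"
  define f2 where "f2 = (\<lambda>t. 4/9 * c * (t + e) powr - (2/3))"
  have d1: "(f has_real_derivative f1 t) (at t)" if "t > - e" for t
    unfolding f_def blunt_cusp_def f1_def
    by (rule derivative_eq_intros refl | use that in \<open>simp add: algebra_simps\<close>)+
  have d2: "(f1 has_real_derivative f2 t) (at t)" if "t > - e" for t
    unfolding f1_def f2_def
    by (rule derivative_eq_intros refl | use that in \<open>simp add: algebra_simps\<close>)+
  have d1': "\<forall>\<^sub>F t in nhds s. (f has_real_derivative f1 t) (at t)" if "s > - e" for s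
    using eventually_nhds_in_open[of "{-e<..}" s] that by (auto elim!: eventually_mono intro: d1)
  have contf: "continuous_on (cball 0 r) (\<lambda>x::real^'n. f (norm x))"
    by (rule continuous_on_compose2[of "{0..}" "f"])
       (use e in \<open>auto intro!: continuous_intros continuous_at_imp_continuous_on DERIV_isCont[OF d1]\<close>)
  have contw: "continuous_on (cball 0 r) w"
    using w \<rho> r unfolding viscosity_subsolution_def
    by (auto elim!: continuous_on_subset simp: subset_iff)
  obtain p where p: "p \<in> ball 0 r"
    "\<forall>\<^sub>F x in nhds p. - (w p + f (norm p)) \<le> - (w x + f (norm x))"
  proof (rule sphere_gap_min_inside[of r "\<lambda>x. - (w x + f (norm x))"])
    show "- (w 0 + f (norm (0::real^'n))) < - (w x + f (norm x))" if "norm x = r" for x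
      using cusp[of x] e(2) r that f0 by (simp add: f_def)
  qed (use r contf contw in \<open>auto intro!: continuous_intros\<close>)
  have pO: "p \<in> \<Omega>" "norm p < \<rho>" using p(1) r \<rho> by auto
  show False
  proof (cases "p = 0")
    case True
    define s where "s = f1 0"
    have s: "s > 0" using c e by (simp add: s_def f1_def)
    \<comment> \<open>the cone of slope \<open>s/2\<close> leaves room for a tilted parabola of arbitrarily large curvature\<close>
    have "((\<lambda>t. f t - s / 2 * t) has_real_derivative s / 2) (at 0)"
      using d1[of 0] e unfolding s_def by (auto intro!: derivative_eq_intros)
    then obtain d where d: "d > 0" "\<And>h. 0 < h \<Longrightarrow> h < d \<Longrightarrow> f h \<ge> s / 2 * h"
      using DERIV_pos_inc_right[of "\<lambda>t. f t - s / 2 * t" "s/2" 0] s f0 by force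
    define v0 :: "real ^ 'n" where "v0 = (s / 4) *\<^sub>R axis undefined 1"
    have v0: "norm v0 = s / 4" using s by (simp add: v0_def)
    \<comment> \<open>then \<open>\<Delta>\<^sub>\<infinity>\<close> of the tilted parabola is \<open>- 2 \<kappa>\<close> at the origin\<close>
    define K where "K = \<kappa> / norm v0 ^ 4"
    have "norm v0 > 0" unfolding v0 using s by simp
    then have K: "K > 0" unfolding K_def using \<kappa> by (intro divide_pos_pos) auto
    have "\<forall>\<^sub>F x in nhds p. norm x < min d (4 / (K * s))"
      using eventually_nhds_in_open[OF open_ball, of p 0 "min d (4 / (K * s))"] d K s True
      by (auto elim: eventually_mono)
    then have "\<forall>\<^sub>F x in nhds p. w x - plane_quadratic v0 K x \<le> w p - plane_quadratic v0 K p"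
      using p(2)
    proof eventually_elim
      case (elim x)
      have "f (norm x) \<ge> s / 2 * norm x"
        using d(2)[of "norm x"] elim(1) f0 by (cases "x = 0") auto
      moreover have cs: "\<bar>v0 \<bullet> x\<bar> \<le> s / 4 * norm x"
        using Cauchy_Schwarz_ineq2[of v0 x] v0 by simp
      moreover have "K * (v0 \<bullet> x)\<^sup>2 \<le> s / 4 * norm x"
      proof -
        have "(v0 \<bullet> x)\<^sup>2 \<le> (s / 4 * norm x)\<^sup>2"
          using cs s by (intro power2_le_iff_abs_le[THEN iffD2]) auto
        then have "K * (v0 \<bullet> x)\<^sup>2 \<le> K * (s / 4 * norm x)\<^sup>2"
          using K by simp
        also have "\<dots> = s / 4 * norm x * (K * s * norm x / 4)"
          by (simp add: power2_eq_square)
        also have "\<dots> \<le> s / 4 * norm x * 1"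
          using elim(1) K s by (intro mult_left_mono) (auto simp: field_simps)
        finally show ?thesis by simp
      qed
      ultimately show ?case
        using elim(2) f0 by (simp add: True plane_quadratic_def)
    qed
    then have "inf_laplacian (plane_quadratic v0 K) p \<ge> G p (w p)"
      using w pO plane_quadratic_test(1) unfolding viscosity_subsolution_def by blast
    then have "- \<kappa> \<le> - 2 * K * norm v0 ^ 4"
      using G[OF pO(2)] by (simp add: True plane_quadratic_test(2))
    then show False using v0 s \<kappa> by (simp add: K_def)
  next
    case False
    let ?s = "norm p + e"
    have s: "?s > 0" using e by (simp add: add_nonneg_pos)
    have "(- f1 (norm p))\<^sup>2 * (- f2 (norm p)) \<ge> G p (w p)"
    proof (rule subsolution_touched_by_radial[OF w pO(1) False, where g = "\<lambda>t. - f t"])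
      show "\<forall>\<^sub>F t in nhds (norm p). ((\<lambda>a. - f a) has_real_derivative - f1 t) (at t)"
        using d1'[of "norm p"] s by (auto elim!: eventually_mono intro!: derivative_eq_intros)
      show "((\<lambda>t. - f1 t) has_real_derivative - f2 (norm p)) (at (norm p))"
        using d2[of "norm p"] s by (auto intro!: derivative_eq_intros)
    qed (use p(2) in \<open>auto elim: eventually_mono\<close>)
    then have "(f1 (norm p))\<^sup>2 * f2 (norm p) \<le> \<kappa>"
      using G[OF pO(2)] by simp
    also have "(f1 (norm p))\<^sup>2 * f2 (norm p) = 64/81 * c ^ 3 * ((?s powr (1/3))\<^sup>2 * ?s powr - (2/3))"
      by (simp add: f1_def f2_def power_mult_distrib power2_eq_square power3_eq_cube)
    also have "\<dots> = 64/81 * c ^ 3"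
      by (simp only: powr_thirds[OF s])
    finally show False using less c3 by simp
  qed
qed

section \<open>Radial profiles as test functions\<close>

text \<open>The equation \<open>U'\<^sup>2 U'' = - h / 3\<close> is kept in divergence form: \<open>U'\<^sup>3 = - Z\<close> and
\<open>Z' = h\<close>.  The point of this form is that \<open>h\<close> is continuous up to the origin, whereas \<open>U''\<close> is
unbounded there.  \<open>Z\<close> and \<open>h\<close> are controlled for \<open>r < \<rho>\<close> only, because the weight may be
discontinuous at the boundary.\<close>

definition radial_profile :: "real \<Rightarrow> (real \<Rightarrow> real) \<Rightarrow> (real \<Rightarrow> real) \<Rightarrow> (real \<Rightarrow> real) \<Rightarrow> bool" where
  "radial_profile \<rho> U Z h \<longleftrightarrow> \<rho> > 0 \<and> continuous_on {0..\<rho>} U \<and>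
     continuous_on {0..<\<rho>} Z \<and> continuous_on {0..<\<rho>} h \<and> Z 0 = 0 \<and> h 0 > 0 \<and>
     (\<forall>r\<in>{0<..<\<rho>}. Z r > 0 \<and> (U has_real_derivative - root 3 (Z r)) (at r) \<and>
        (Z has_real_derivative h r) (at r))"

lemma eventually_near_zero:
  fixes h :: "real \<Rightarrow> real"
  assumes "continuous_on {0..<\<rho>} h" "\<rho> > 0"
  shows "a < h 0 \<Longrightarrow> \<exists>d>0. d < \<rho> \<and> (\<forall>r\<in>{0..d}. a < h r)"
    and "h 0 < a \<Longrightarrow> \<exists>d>0. d < \<rho> \<and> (\<forall>r\<in>{0..d}. h r < a)"
proof -
  have "(h \<longlongrightarrow> h 0) (at 0 within {0..<\<rho>})"
    using assms by (auto simp: continuous_on)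
  then have *: "\<exists>d>0. \<forall>x\<in>{0..<\<rho>}. x \<noteq> 0 \<and> dist x 0 < d \<longrightarrow> P (h x)"
    if "\<forall>\<^sub>F x in at 0 within {0..<\<rho>}. P (h x)" for P
    using that by (simp add: eventually_at)
  have **: "\<exists>d>0. d < \<rho> \<and> (\<forall>r\<in>{0..d}. P (h r))"
    if ev: "\<forall>\<^sub>F x in at 0 within {0..<\<rho>}. P (h x)" and P0: "P (h 0)" for P
  proof -
    obtain d where d: "d > 0" "\<forall>x\<in>{0..<\<rho>}. x \<noteq> 0 \<and> dist x 0 < d \<longrightarrow> P (h x)"
      using *[OF ev] by blast
    then show ?thesis
    proof (intro exI[of _ "min (d/2) (\<rho>/2)"] conjI ballI)
      fix r assume "r \<in> {0..min (d/2) (\<rho>/2)}"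
      then show "P (h r)"
        using d P0 assms(2) by (cases "r = 0") (auto simp: dist_real_def)
    qed (use d assms(2) in auto)
  qed
  show "a < h 0 \<Longrightarrow> \<exists>d>0. d < \<rho> \<and> (\<forall>r\<in>{0..d}. a < h r)"
    using **[of "\<lambda>y. a < y"] order_tendstoD(1)[OF \<open>(h \<longlongrightarrow> h 0) _\<close>] by blast
  show "h 0 < a \<Longrightarrow> \<exists>d>0. d < \<rho> \<and> (\<forall>r\<in>{0..d}. h r < a)"
    using **[of "\<lambda>y. y < a"] order_tendstoD(2)[OF \<open>(h \<longlongrightarrow> h 0) _\<close>] by blast
qed

lemma root3_mult_powr:
  assumes "C \<ge> 0" "r > 0"
  shows "root 3 (64/27 * C ^ 3 * r) = 4/3 * C * r powr (1/3)"
proof -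
  have "(r powr (1/3)) ^ 3 = r"
    using assms by (simp add: power3_eq_cube flip: powr_add)
  then have "64/27 * C ^ 3 * r = (4/3 * C * r powr (1/3)) ^ 3"
    by (simp add: power_mult_distrib power_divide)
  then show ?thesis
    using assms by (simp add: real_root_power_cancel)
qed

lemma powr_four_thirds_has_derivative:
  assumes "r > 0"
  shows "((\<lambda>r. C * r powr (4/3)) has_real_derivative 4/3 * C * r powr (1/3)) (at r)"
  by (rule derivative_eq_intros refl | use assms in \<open>simp add: algebra_simps\<close>)+

text \<open>Near the origin \<open>Z r\<close> is asymptotic to \<open>h 0 * r\<close>, so \<open>U\<close> descends like \<open>C r\<^sup>4\<^sup>/\<^sup>3\<close>
with \<open>64/81 C\<^sup>3 = h 0 / 3\<close>.  This is exactly the critical constant in the cusp bounds above.\<close>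

lemma radial_profile_cusp:
  assumes prof: "radial_profile \<rho> U Z h" and C: "C \<ge> 0"
  shows "64/81 * C ^ 3 < h 0 / 3 \<Longrightarrow> \<exists>d>0. d < \<rho> \<and> (\<forall>r\<in>{0..d}. U r \<le> U 0 - C * r powr (4/3))"
    and "h 0 / 3 < 64/81 * C ^ 3 \<Longrightarrow> \<exists>d>0. d < \<rho> \<and> (\<forall>r\<in>{0..d}. U r \<ge> U 0 - C * r powr (4/3))"
proof -
  let ?a = "64/27 * C ^ 3"
  have \<rho>: "\<rho> > 0" and cU: "continuous_on {0..\<rho>} U" and cZ: "continuous_on {0..<\<rho>} Z"
    and ch: "continuous_on {0..<\<rho>} h" and Z0: "Z 0 = 0"
    and der: "\<And>r. 0 < r \<Longrightarrow> r < \<rho> \<Longrightarrow> (U has_real_derivative - root 3 (Z r)) (at r)"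
             "\<And>r. 0 < r \<Longrightarrow> r < \<rho> \<Longrightarrow> (Z has_real_derivative h r) (at r)"
    using prof by (auto simp: radial_profile_def)
  have "continuous_on {0..r} (\<lambda>t::real. t powr (4/3))" for r
    by (rule continuous_on_powr') (auto intro!: continuous_intros)
  then have cont: "continuous_on {0..r} (\<lambda>t. U t + C * t powr (4/3))" if "r < \<rho>" for r
    using that by (intro continuous_on_add continuous_on_mult continuous_on_const continuous_on_subset[OF cU]) auto
  have contZ: "continuous_on {0..r} (\<lambda>t. Z t - ?a * t)" if "r < \<rho>" for r
    using that by (auto intro!: continuous_intros continuous_on_subset[OF cZ])
  have dU: "((\<lambda>t. U t + C * t powr (4/3)) has_real_derivative root 3 (?a * r) - root 3 (Z r)) (at r)"
    if "0 < r" "r < \<rho>" for r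
    using DERIV_add[OF der(1)[OF that] powr_four_thirds_has_derivative[OF that(1), of C]]
    unfolding root3_mult_powr[OF C that(1)] by (simp add: algebra_simps)
  have dZ: "((\<lambda>t. Z t - ?a * t) has_real_derivative h r - ?a) (at r)" if "0 < r" "r < \<rho>" for r
    using der(2)[OF that] by (auto intro!: derivative_eq_intros)
  {
    assume "64/81 * C ^ 3 < h 0 / 3"
    then have "?a < h 0" by simp
    then obtain d where d: "d > 0" "d < \<rho>" "\<forall>r\<in>{0..d}. ?a < h r"
      using eventually_near_zero(1)[OF ch \<rho>] by blast
    have Z: "?a * r \<le> Z r" if "0 < r" "r \<le> d" for r
    proof -
      have "Z 0 - ?a * 0 \<le> Z r - ?a * r"
      proof (rule DERIV_nonneg_imp_increasing_open[OF _ _ contZ])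
        fix x assume "0 < x" "x < r"
        then show "\<exists>y. ((\<lambda>t. Z t - ?a * t) has_real_derivative y) (at x) \<and> 0 \<le> y"
          using dZ[of x] d that by (intro exI[of _ "h x - ?a"]) (auto simp: less_imp_le)
      qed (use that d in auto)
      then show ?thesis using Z0 by simp
    qed
    have "U r \<le> U 0 - C * r powr (4/3)" if "r \<in> {0..d}" for r
    proof -
      have "U r + C * r powr (4/3) \<le> U 0 + C * 0 powr (4/3)"
      proof (rule DERIV_nonpos_imp_decreasing_open[OF _ _ cont])
        fix x assume "0 < x" "x < r"
        then show "\<exists>y. ((\<lambda>t. U t + C * t powr (4/3)) has_real_derivative y) (at x) \<and> y \<le> 0"
          using dU[of x] Z[of x] d that
          by (intro exI[of _ "root 3 (?a * x) - root 3 (Z x)"]) auto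
      qed (use that d in auto)
      then show ?thesis by simp
    qed
    then show "\<exists>d>0. d < \<rho> \<and> (\<forall>r\<in>{0..d}. U r \<le> U 0 - C * r powr (4/3))"
      using d by blast
  }
  {
    assume "h 0 / 3 < 64/81 * C ^ 3"
    then have "h 0 < ?a" by simp
    then obtain d where d: "d > 0" "d < \<rho>" "\<forall>r\<in>{0..d}. h r < ?a"
      using eventually_near_zero(2)[OF ch \<rho>] by blast
    have Z: "?a * r \<ge> Z r" if "0 < r" "r \<le> d" for r
    proof -
      have "Z r - ?a * r \<le> Z 0 - ?a * 0"
      proof (rule DERIV_nonpos_imp_decreasing_open[OF _ _ contZ])
        fix x assume "0 < x" "x < r"
        then show "\<exists>y. ((\<lambda>t. Z t - ?a * t) has_real_derivative y) (at x) \<and> y \<le> 0"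
          using dZ[of x] d that by (intro exI[of _ "h x - ?a"]) (auto simp: less_imp_le)
      qed (use that d in auto)
      then show ?thesis using Z0 by simp
    qed
    have "U r \<ge> U 0 - C * r powr (4/3)" if "r \<in> {0..d}" for r
    proof -
      have "U 0 + C * 0 powr (4/3) \<le> U r + C * r powr (4/3)"
      proof (rule DERIV_nonneg_imp_increasing_open[OF _ _ cont])
        fix x assume "0 < x" "x < r"
        then show "\<exists>y. ((\<lambda>t. U t + C * t powr (4/3)) has_real_derivative y) (at x) \<and> 0 \<le> y"
          using dU[of x] Z[of x] d that
          by (intro exI[of _ "root 3 (?a * x) - root 3 (Z x)"]) auto
      qed (use that d in auto)
      then show ?thesis by simp
    qed
    then show "\<exists>d>0. d < \<rho> \<and> (\<forall>r\<in>{0..d}. U r \<ge> U 0 - C * r powr (4/3))"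
      using d by blast
  }
qed

lemma radial_profile_second_derivative:
  assumes prof: "radial_profile \<rho> U Z h" and r: "0 < r" "r < \<rho>"
  shows "\<forall>\<^sub>F t in nhds r. (U has_real_derivative - root 3 (Z t)) (at t)"
    and "((\<lambda>t. - root 3 (Z t)) has_real_derivative - (h r / (3 * (root 3 (Z r))\<^sup>2))) (at r)"
    and "(- root 3 (Z r))\<^sup>2 * - (h r / (3 * (root 3 (Z r))\<^sup>2)) = - h r / 3"
proof -
  have *: "\<And>r. 0 < r \<Longrightarrow> r < \<rho> \<Longrightarrow> (U has_real_derivative - root 3 (Z r)) (at r)"
    "Z r > 0" "(Z has_real_derivative h r) (at r)"
    using prof r by (auto simp: radial_profile_def)
  show "\<forall>\<^sub>F t in nhds r. (U has_real_derivative - root 3 (Z t)) (at t)"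
    using eventually_nhds_in_open[of "{0<..<\<rho>}" r] r by (auto elim!: eventually_mono intro: *)
  show "((\<lambda>t. - root 3 (Z t)) has_real_derivative - (h r / (3 * (root 3 (Z r))\<^sup>2))) (at r)"
    using *(2) DERIV_minus[OF DERIV_chain2[OF DERIV_real_root[of 3 "Z r"] *(3)]]
    by (simp add: field_simps)
  show "(- root 3 (Z r))\<^sup>2 * - (h r / (3 * (root 3 (Z r))\<^sup>2)) = - h r / 3"
    using *(2) by (simp add: power2_eq_square)
qed

lemma root3_scaled_cubed:
  assumes "m > 0"
  shows "64/81 * (root 3 (81/64 * m)) ^ 3 = m" and "root 3 (81/64 * m) \<ge> 0"
  using assms by (auto simp: real_root_pow_pos2)

lemma eventually_near_origin:
  fixes f :: "'a::real_normed_vector \<Rightarrow> real"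
  assumes "\<forall>\<^sub>F x in nhds 0. P x"
  obtains d where "d > 0" "\<And>x::'a. norm x < d \<Longrightarrow> P x"
  using assms unfolding eventually_nhds_metric by (auto simp: dist_norm)

text \<open>A radial profile behaves like a smooth test function with infinity-Laplacian \<open>- h / 3\<close>, even at the
origin.  There the cusp bound replaces the missing second derivatives: any violated inequality
leaves room for a constant \<open>m\<close> between \<open>h 0 / 3\<close> and \<open>\<kappa>\<close>.\<close>

lemma supersolution_touched_by_profile:
  fixes p :: "real ^ 'n"
  assumes w: "viscosity_supersolution \<Omega> G w" and prof: "radial_profile \<rho> U Z h"
    and \<Omega>: "ball 0 \<rho> \<subseteq> \<Omega>" and contG: "continuous_on (ball 0 \<rho>) (\<lambda>x. G x (w x))"
    and p: "norm p < \<rho>"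
    and min: "\<forall>\<^sub>F x in nhds p. w x - U (norm x) \<ge> w p - U (norm p)"
  shows "- h (norm p) / 3 \<le> G p (w p)"
proof (cases "p = 0")
  case False
  note d = radial_profile_second_derivative[OF prof, of "norm p"]
  have "(- root 3 (Z (norm p)))\<^sup>2 * - (h (norm p) / (3 * (root 3 (Z (norm p)))\<^sup>2)) \<le> G p (w p)"
    using False p d(1,2) \<Omega> by (intro supersolution_touched_by_radial[OF w _ _ min]) auto
  then show ?thesis
    using d(3) False p by simp
next
  case True
  have h0: "h 0 > 0" and \<rho>: "\<rho> > 0" using prof by (auto simp: radial_profile_def)
  show ?thesis
  proof (rule ccontr)
    assume "\<not> ?thesis"
    then have less: "G 0 (w 0) < - (h 0 / 3)" using True by simp
    have "h 0 / 3 < - G 0 (w 0)" using less by simp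
    then obtain \<kappa> where "h 0 / 3 < \<kappa>" "\<kappa> < - G 0 (w 0)" using dense by blast
    moreover then obtain m where "h 0 / 3 < m" "m < \<kappa>" using dense by blast
    ultimately have \<kappa>: "0 < \<kappa>" "h 0 / 3 < m" "m < \<kappa>" "G 0 (w 0) < - \<kappa>" "m > 0"
      using h0 by auto
    obtain d1 where d1: "d1 > 0" "d1 < \<rho>"
      "\<And>r. r \<in> {0..d1} \<Longrightarrow> U r \<ge> U 0 - root 3 (81/64 * m) * r powr (4/3)"
      using radial_profile_cusp(2)[OF prof root3_scaled_cubed(2)[OF \<kappa>(5)]] \<kappa>(2)
      unfolding root3_scaled_cubed(1)[OF \<kappa>(5)] by blast
    obtain d2 where d2: "d2 > 0" "\<And>x. norm x < d2 \<Longrightarrow> w x - U (norm x) \<ge> w 0 - U 0"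
      using eventually_near_origin min True by auto
    have "\<forall>\<^sub>F x in nhds 0. G x (w x) < - \<kappa>"
    proof -
      have "isCont (\<lambda>x. G x (w x)) 0"
        using contG \<rho> by (auto simp: continuous_on_eq_continuous_at)
      then have "((\<lambda>x. G x (w x)) \<longlongrightarrow> G 0 (w 0)) (nhds 0)"
        by (simp add: isCont_def tendsto_at_iff_tendsto_nhds[where g = "\<lambda>x. G x (w x)"])
      then show ?thesis
        by (rule order_tendstoD(2)) (rule \<kappa>(4))
    qed
    then obtain d3 where d3: "d3 > 0" "\<And>x. norm x < d3 \<Longrightarrow> G x (w x) < - \<kappa>"
      using eventually_near_origin by auto
    define d where "d = min d1 (min d2 d3)"
    have "\<kappa> \<le> 64/81 * (root 3 (81/64 * m)) ^ 3"
    proof (rule cusp_bound_of_supersolution[OF w, of d])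
      fix x :: "real ^ 'n" assume x: "norm x < d"
      then show "w x \<ge> w 0 - root 3 (81/64 * m) * norm x powr (4/3)"
        using d1(3)[of "norm x"] d2(2)[of x] by (auto simp: d_def)
      show "G x (w x) \<le> - \<kappa>"
        using d3(2)[of x] x by (simp add: d_def)
    qed (use d1 d2 d3 \<kappa> \<Omega> in \<open>auto simp: d_def\<close>)
    then show False
      using \<kappa> by (simp add: root3_scaled_cubed)
  qed
qed

lemma subsolution_touched_by_profile:
  fixes p :: "real ^ 'n"
  assumes w: "viscosity_subsolution \<Omega> G w" and prof: "radial_profile \<rho> U Z h"
    and \<Omega>: "ball 0 \<rho> \<subseteq> \<Omega>" and contG: "continuous_on (ball 0 \<rho>) (\<lambda>x. G x (w x))"
    and p: "norm p < \<rho>"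
    and max: "\<forall>\<^sub>F x in nhds p. w x - U (norm x) \<le> w p - U (norm p)"
  shows "- h (norm p) / 3 \<ge> G p (w p)"
proof (cases "p = 0")
  case False
  note d = radial_profile_second_derivative[OF prof, of "norm p"]
  have "(- root 3 (Z (norm p)))\<^sup>2 * - (h (norm p) / (3 * (root 3 (Z (norm p)))\<^sup>2)) \<ge> G p (w p)"
    using False p d(1,2) \<Omega> by (intro subsolution_touched_by_radial[OF w _ _ max]) auto
  then show ?thesis
    using d(3) False p by simp
next
  case True
  have h0: "h 0 > 0" and \<rho>: "\<rho> > 0" using prof by (auto simp: radial_profile_def)
  show ?thesis
  proof (rule ccontr)
    assume "\<not> ?thesis"
    then have less: "G 0 (w 0) > - (h 0 / 3)" using True by simp
    have "max (- G 0 (w 0)) 0 < h 0 / 3" using less h0 by simp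
    then obtain \<kappa> where "max (- G 0 (w 0)) 0 < \<kappa>" "\<kappa> < h 0 / 3" using dense by blast
    moreover then obtain m where "\<kappa> < m" "m < h 0 / 3" using dense by blast
    ultimately have \<kappa>: "0 < \<kappa>" "m < h 0 / 3" "\<kappa> < m" "G 0 (w 0) > - \<kappa>" "m > 0"
      by auto
    obtain d1 where d1: "d1 > 0" "d1 < \<rho>"
      "\<And>r. r \<in> {0..d1} \<Longrightarrow> U r \<le> U 0 - root 3 (81/64 * m) * r powr (4/3)"
      using radial_profile_cusp(1)[OF prof root3_scaled_cubed(2)[OF \<kappa>(5)]] \<kappa>(2)
      unfolding root3_scaled_cubed(1)[OF \<kappa>(5)] by blast
    obtain d2 where d2: "d2 > 0" "\<And>x. norm x < d2 \<Longrightarrow> w x - U (norm x) \<le> w 0 - U 0"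
      using eventually_near_origin max True by auto
    have "\<forall>\<^sub>F x in nhds 0. G x (w x) > - \<kappa>"
    proof -
      have "isCont (\<lambda>x. G x (w x)) 0"
        using contG \<rho> by (auto simp: continuous_on_eq_continuous_at)
      then have "((\<lambda>x. G x (w x)) \<longlongrightarrow> G 0 (w 0)) (nhds 0)"
        by (simp add: isCont_def tendsto_at_iff_tendsto_nhds[where g = "\<lambda>x. G x (w x)"])
      then show ?thesis
        by (rule order_tendstoD(1)) (rule \<kappa>(4))
    qed
    then obtain d3 where d3: "d3 > 0" "\<And>x. norm x < d3 \<Longrightarrow> G x (w x) > - \<kappa>"
      using eventually_near_origin by auto
    define d where "d = min d1 (min d2 d3)"
    have "64/81 * (root 3 (81/64 * m)) ^ 3 \<le> \<kappa>"
    proof (rule cusp_bound_of_subsolution[OF w, of d])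
      fix x :: "real ^ 'n" assume x: "norm x < d"
      then show "w x \<le> w 0 - root 3 (81/64 * m) * norm x powr (4/3)"
        using d1(3)[of "norm x"] d2(2)[of x] by (auto simp: d_def)
      show "G x (w x) \<ge> - \<kappa>"
        using d3(2)[of x] x by (simp add: d_def)
    qed (use d1 d2 d3 \<kappa> \<Omega> in \<open>auto simp: d_def\<close>)
    then show False
      using \<kappa> by (simp add: root3_scaled_cubed)
  qed
qed

section \<open>Radial profiles are viscosity solutions\<close>

text \<open>The infinity-Laplacian only sees second derivatives along the gradient, so it can be computed from
the restriction to one line.\<close>

lemma C2_along_line:
  fixes p \<nu> :: "real ^ 'n"
  assumes "C2_on \<Omega> \<psi>" "open \<Omega>" "p \<in> \<Omega>"
  defines "\<phi>' \<equiv> \<lambda>t. \<Sum>i\<in>UNIV. \<nu> $ i * partial i \<psi> (p + t *\<^sub>R \<nu>)"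
  shows "\<forall>\<^sub>F t in nhds 0. ((\<lambda>t. \<psi> (p + t *\<^sub>R \<nu>)) has_real_derivative \<phi>' t) (at t)"
    and "(\<phi>' has_real_derivative (\<Sum>i\<in>UNIV. \<Sum>j\<in>UNIV. \<nu> $ i * \<nu> $ j * partial i (partial j \<psi>) p)) (at 0)"
proof -
  have line: "((\<lambda>t. p + t *\<^sub>R \<nu>) has_derivative (\<lambda>t. t *\<^sub>R \<nu>)) (at t)" for t
    by (auto intro!: derivative_eq_intros)
  have chain: "((\<lambda>t. f (p + t *\<^sub>R \<nu>)) has_real_derivative (\<Sum>i\<in>UNIV. \<nu> $ i * partial i f (p + t *\<^sub>R \<nu>))) (at t)"
    if "f differentiable (at (p + t *\<^sub>R \<nu>))" for f t
  proof -
    have "((\<lambda>t. f (p + t *\<^sub>R \<nu>)) has_derivative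
        (\<lambda>s. frechet_derivative f (at (p + t *\<^sub>R \<nu>)) (s *\<^sub>R \<nu>))) (at t)"
      using has_derivative_compose[OF line] that frechet_derivative_works by blast
    moreover have "frechet_derivative f (at (p + t *\<^sub>R \<nu>)) (s *\<^sub>R \<nu>)
        = (\<Sum>i\<in>UNIV. \<nu> $ i * partial i f (p + t *\<^sub>R \<nu>)) * s" for s
      unfolding frechet_derivative_eq_sum_partial[OF that]
      by (simp add: sum_distrib_right sum_distrib_left mult_ac)
    ultimately show ?thesis
      by (simp add: has_field_derivative_def)
  qed
  have diff: "\<psi> differentiable (at x)" "partial i \<psi> differentiable (at x)" if "x \<in> \<Omega>" for x i
    using assms(1,2) that unfolding C2_on_def C1_on_def
    by (metis differentiable_on_def at_within_open)+
  have "((\<lambda>t. p + t *\<^sub>R \<nu>) \<longlongrightarrow> p + 0 *\<^sub>R \<nu>) (nhds 0)"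
    by (intro tendsto_intros filterlim_ident)
  then have "\<forall>\<^sub>F t in nhds 0. p + t *\<^sub>R \<nu> \<in> \<Omega>"
    using assms(2,3) by (auto dest: topological_tendstoD)
  then show "\<forall>\<^sub>F t in nhds 0. ((\<lambda>t. \<psi> (p + t *\<^sub>R \<nu>)) has_real_derivative \<phi>' t) (at t)"
    by eventually_elim (auto simp: \<phi>'_def intro!: chain diff)
  have "((\<lambda>t. partial j \<psi> (p + t *\<^sub>R \<nu>)) has_real_derivative
      (\<Sum>i\<in>UNIV. \<nu> $ i * partial i (partial j \<psi>) p)) (at 0)" for j
    using chain[of "partial j \<psi>" 0] diff(2)[OF assms(3)] by simp
  then have "(\<phi>' has_real_derivative
      (\<Sum>j\<in>UNIV. \<nu> $ j * (\<Sum>i\<in>UNIV. \<nu> $ i * partial i (partial j \<psi>) p))) (at 0)"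
    unfolding \<phi>'_def by (auto intro!: DERIV_sum DERIV_cmult)
  also have "(\<Sum>j\<in>UNIV. \<nu> $ j * (\<Sum>i\<in>UNIV. \<nu> $ i * partial i (partial j \<psi>) p))
      = (\<Sum>i\<in>UNIV. \<Sum>j\<in>UNIV. \<nu> $ i * \<nu> $ j * partial i (partial j \<psi>) p)"
    by (subst sum.swap) (simp add: sum_distrib_left mult_ac)
  finally show "(\<phi>' has_real_derivative
      (\<Sum>i\<in>UNIV. \<Sum>j\<in>UNIV. \<nu> $ i * \<nu> $ j * partial i (partial j \<psi>) p)) (at 0)" .
qed

lemma inf_laplacian_along_gradient:
  assumes "\<And>i. partial i \<psi> p = c * \<nu> $ i"
  shows "inf_laplacian \<psi> p = c\<^sup>2 * (\<Sum>i\<in>UNIV. \<Sum>j\<in>UNIV. \<nu> $ i * \<nu> $ j * partial i (partial j \<psi>) p)"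
  unfolding inf_laplacian_def assms
  by (simp add: sum_distrib_left power2_eq_square mult_ac)

lemma norm_has_derivative:
  fixes p :: "'a::real_inner"
  assumes "p \<noteq> 0"
  shows "(norm has_derivative (\<lambda>v. (p /\<^sub>R norm p) \<bullet> v)) (at p)"
  using has_derivative_norm[OF assms] by (simp add: sgn_div_norm inner_commute)

lemma radial_has_derivative:
  fixes p :: "'a::real_inner"
  assumes "p \<noteq> 0" "(g has_real_derivative d) (at (norm p))"
  shows "((\<lambda>x. g (norm x)) has_derivative (\<lambda>v. (d *\<^sub>R (p /\<^sub>R norm p)) \<bullet> v)) (at p)"
proof -
  have "((\<lambda>x. g (norm x)) has_derivative (\<lambda>v. d * ((p /\<^sub>R norm p) \<bullet> v))) (at p)"
    using has_derivative_compose[OF norm_has_derivative[OF assms(1)]] assms(2)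
    unfolding has_field_derivative_def by blast
  then show ?thesis by (simp add: mult.assoc)
qed

lemma radial_profile_le_center:
  assumes "radial_profile \<rho> U Z h" "0 \<le> r" "r \<le> \<rho>"
  shows "U r \<le> U 0"
proof (rule DERIV_nonpos_imp_decreasing_open[OF assms(2)])
  show "continuous_on {0..r} U"
    using assms by (auto simp: radial_profile_def elim: continuous_on_subset)
  fix x assume "0 < x" "x < r"
  then show "\<exists>y. (U has_real_derivative y) (at x) \<and> y \<le> 0"
    using assms unfolding radial_profile_def
    by (intro exI[of _ "- root 3 (Z x)"]) (auto simp: less_imp_le)
qed

lemma radial_profile_flat_at_origin:
  assumes prof: "radial_profile \<rho> U Z h"
  shows "((\<lambda>x::real^'n. U (norm x)) has_derivative (\<lambda>v. 0 \<bullet> v)) (at 0)"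
proof -
  define C where "C = root 3 (81/64 * h 0)"
  have h0: "h 0 > 0" and \<rho>: "\<rho> > 0" using prof by (auto simp: radial_profile_def)
  obtain d where d: "d > 0" "d < \<rho>" "\<And>r. r \<in> {0..d} \<Longrightarrow> U r \<ge> U 0 - C * r powr (4/3)"
    using radial_profile_cusp(2)[OF prof root3_scaled_cubed(2)[OF h0]] h0
    unfolding root3_scaled_cubed(1)[OF h0] C_def by auto
  have bound: "norm (U (norm x) - U 0) / norm x \<le> C * norm x powr (1/3)"
    if "x \<noteq> 0" "norm x < d" for x :: "real^'n"
  proof -
    have "\<bar>U (norm x) - U 0\<bar> \<le> C * norm x powr (4/3)"
    proof -
      have "U 0 - C * norm x powr (4/3) \<le> U (norm x)" using d(3)[of "norm x"] that by simp
      moreover have "U (norm x) \<le> U 0"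
        using radial_profile_le_center[OF prof, of "norm x"] that d by simp
      ultimately show ?thesis by linarith
    qed
    also have "norm x powr (4/3) = norm x powr (1/3) * norm x"
      using powr_add[of "norm x" "1/3" 1] that by simp
    finally show ?thesis using that by (simp add: field_simps)
  qed
  have lim: "((\<lambda>x::real^'n. C * norm x powr (1/3)) \<longlongrightarrow> C * norm (0::real^'n) powr (1/3)) (at 0)"
    by (intro tendsto_intros) auto
  have "((\<lambda>x::real^'n. norm (U (norm x) - U 0) / norm x) \<longlongrightarrow> 0) (at 0)"
  proof (rule tendsto_sandwich[OF _ _ tendsto_const])
    show "\<forall>\<^sub>F x::real^'n in at 0. norm (U (norm x) - U 0) / norm x \<le> C * norm x powr (1/3)"
      unfolding eventually_at using bound d by (auto simp: dist_norm)
    show "((\<lambda>x::real^'n. C * norm x powr (1/3)) \<longlongrightarrow> 0) (at 0)" using lim by simp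
  qed auto
  then show ?thesis
    by (simp add: has_derivative_at)
qed

lemma partial_eq_at_local_max:
  fixes \<psi> :: "real ^ 'n \<Rightarrow> real"
  assumes "\<psi> differentiable (at p)" "(u has_derivative (\<lambda>v. g \<bullet> v)) (at p)"
    and "(\<forall>\<^sub>F x in nhds p. u x - \<psi> x \<le> u p - \<psi> p) \<or> (\<forall>\<^sub>F x in nhds p. u x - \<psi> x \<ge> u p - \<psi> p)"
  shows "partial i \<psi> p = g $ i"
proof -
  have "((\<lambda>x. u x - \<psi> x) has_derivative (\<lambda>v. g \<bullet> v - frechet_derivative \<psi> (at p) v)) (at p)"
    using assms(1,2) by (intro has_derivative_diff) (auto simp: frechet_derivative_works)
  moreover obtain S where "open S" "p \<in> S"
    "(\<forall>x\<in>S. u x - \<psi> x \<le> u p - \<psi> p) \<or> (\<forall>x\<in>S. u x - \<psi> x \<ge> u p - \<psi> p)"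
    using assms(3) unfolding eventually_nhds by blast
  ultimately have "(\<lambda>v. g \<bullet> v - frechet_derivative \<psi> (at p) v) = (\<lambda>v. 0)"
    using differential_zero_maxmin[of p S "\<lambda>x. u x - \<psi> x"] by blast
  then show ?thesis
    by (auto simp: partial_def inner_axis dest: fun_cong[of _ _ "axis i 1"])
qed

text \<open>Away from the origin a test function touching \<open>U\<close> has the gradient of \<open>U\<close>, which is radial, and the
second derivative test along the radius compares \<open>\<Delta>\<^sub>\<infinity>\<psi>\<close> with
\<open>U'\<^sup>2 U''\<close>.  At the origin the gradient of \<open>\<psi>\<close> vanishes.  This is harmless when \<open>\<psi>\<close>
touches from above, because \<open>0 \<ge> - h 0 / 3\<close>; it is impossible when \<open>\<psi>\<close> touches from below,
because \<open>\<psi>\<close> decreases at most quadratically and \<open>U\<close> decreases like a power \<open>4/3\<close>.\<close>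

lemma radial_profile_viscosity_solution:
  fixes G :: "real ^ 'n \<Rightarrow> real \<Rightarrow> real"
  assumes prof: "radial_profile \<rho> U Z h"
    and G: "\<And>x. norm x < \<rho> \<Longrightarrow> G x (U (norm x)) = - h (norm x) / 3"
  shows "viscosity_solution (ball 0 \<rho>) G (\<lambda>x. U (norm x))"
proof -
  have h0: "h 0 > 0" and \<rho>: "\<rho> > 0" and cont: "continuous_on {0..\<rho>} U"
    using prof by (auto simp: radial_profile_def)
  have contU: "continuous_on (ball 0 \<rho>) (\<lambda>x::real^'n. U (norm x))"
    by (rule continuous_on_compose2[OF cont]) (auto intro!: continuous_intros)
  have away: "(\<forall>\<^sub>F x in nhds p. U (norm x) - \<psi> x \<le> U (norm p) - \<psi> p) \<longrightarrow> - h (norm p) / 3 \<le> inf_laplacian \<psi> p"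
    "(\<forall>\<^sub>F x in nhds p. U (norm x) - \<psi> x \<ge> U (norm p) - \<psi> p) \<longrightarrow> inf_laplacian \<psi> p \<le> - h (norm p) / 3"
    if C2: "C2_on (ball 0 \<rho>) \<psi>" and p: "p \<in> ball 0 \<rho>" "p \<noteq> 0" for \<psi> and p :: "real ^ 'n"
  proof -
    define r where "r = norm p"
    define \<nu> where "\<nu> = p /\<^sub>R norm p"
    have r: "0 < r" "r < \<rho>" using p by (auto simp: r_def)
    have p_eq: "p = r *\<^sub>R \<nu>" "norm \<nu> = 1" using p by (auto simp: r_def \<nu>_def)
    define c where "c = - root 3 (Z r)"
    define D where "D = (\<Sum>i\<in>UNIV. \<Sum>j\<in>UNIV. \<nu> $ i * \<nu> $ j * partial i (partial j \<psi>) p)"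
    define \<phi>' where "\<phi>' = (\<lambda>t. \<Sum>i\<in>UNIV. \<nu> $ i * partial i \<psi> (p + t *\<^sub>R \<nu>))"
    define U2 where "U2 = - (h r / (3 * (root 3 (Z r))\<^sup>2))"
    note along = C2_along_line[OF C2 open_ball p(1), of \<nu>, folded \<phi>'_def D_def]
    note second = radial_profile_second_derivative[OF prof r, folded U2_def]
    have line: "((\<lambda>t. p + t *\<^sub>R \<nu>) \<longlongrightarrow> p) (nhds 0)"
    proof -
      have "((\<lambda>t. p + t *\<^sub>R \<nu>) \<longlongrightarrow> p + 0 *\<^sub>R \<nu>) (nhds 0)"
        by (intro tendsto_intros filterlim_ident)
      then show ?thesis by simp
    qed
    have shift: "((\<lambda>t. r + t) \<longlongrightarrow> r) (nhds 0)"
    proof -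
      have "((\<lambda>t. r + t) \<longlongrightarrow> r + 0) (nhds 0)"
        by (intro tendsto_intros filterlim_ident)
      then show ?thesis by simp
    qed
    have normline: "\<forall>\<^sub>F t in nhds 0. norm (p + t *\<^sub>R \<nu>) = r + t"
    proof -
      have "\<forall>\<^sub>F t in nhds (0::real). t > - r"
        using eventually_nhds_in_open[of "{-r<..}" 0] r by simp
      then show ?thesis
      proof eventually_elim
        case (elim t)
        have "norm (p + t *\<^sub>R \<nu>) = norm ((r + t) *\<^sub>R \<nu>)"
          by (simp add: p_eq(1) scaleR_left_distrib)
        then show ?case using elim p_eq(2) by simp
      qed
    qed
    have dU: "\<forall>\<^sub>F t in nhds 0. ((\<lambda>t. U (r + t)) has_real_derivative - root 3 (Z (r + t))) (at t)"
      using eventually_compose_filterlim[OF second(1) shift]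
      by eventually_elim (simp add: DERIV_shift add.commute)
    have dU2: "((\<lambda>t. - root 3 (Z (r + t))) has_real_derivative U2) (at 0)"
      using second(2) DERIV_shift[of "\<lambda>t. - root 3 (Z t)" U2 0 r] by (simp add: add.commute)
    have d1: "\<forall>\<^sub>F t in nhds 0. ((\<lambda>t. U (r + t) - \<psi> (p + t *\<^sub>R \<nu>)) has_real_derivative
        - root 3 (Z (r + t)) - \<phi>' t) (at t)"
      using dU along(1) by eventually_elim (auto simp: \<phi>'_def intro!: DERIV_diff)
    have d2: "((\<lambda>t. - root 3 (Z (r + t)) - \<phi>' t) has_real_derivative U2 - D) (at 0)"
      by (rule DERIV_diff[OF dU2 along(2)])
    have diff: "\<psi> differentiable (at p)"
      using C2 p unfolding C2_on_def C1_on_def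
      by (metis differentiable_on_def at_within_open open_ball)
    have dUp: "((\<lambda>x. U (norm x)) has_derivative (\<lambda>v. (c *\<^sub>R \<nu>) \<bullet> v)) (at p)"
      unfolding \<nu>_def c_def r_def
      by (rule radial_has_derivative[OF p(2)]) (use prof r in \<open>auto simp: radial_profile_def r_def\<close>)
    have lap: "inf_laplacian \<psi> p = c\<^sup>2 * D"
      if "(\<forall>\<^sub>F x in nhds p. U (norm x) - \<psi> x \<le> U (norm p) - \<psi> p)
        \<or> (\<forall>\<^sub>F x in nhds p. U (norm x) - \<psi> x \<ge> U (norm p) - \<psi> p)"
      unfolding D_def
      by (rule inf_laplacian_along_gradient) (simp add: partial_eq_at_local_max[OF diff dUp that])
    have cU2: "c\<^sup>2 * U2 = - h (norm p) / 3"
      using second(3) by (simp add: c_def r_def)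
    show "(\<forall>\<^sub>F x in nhds p. U (norm x) - \<psi> x \<le> U (norm p) - \<psi> p) \<longrightarrow> - h (norm p) / 3 \<le> inf_laplacian \<psi> p"
    proof
      assume max: "\<forall>\<^sub>F x in nhds p. U (norm x) - \<psi> x \<le> U (norm p) - \<psi> p"
      have "\<forall>\<^sub>F t in nhds 0. U (r + t) - \<psi> (p + t *\<^sub>R \<nu>) \<le> U (r + 0) - \<psi> (p + 0 *\<^sub>R \<nu>)"
        using eventually_compose_filterlim[OF max line] normline
        by eventually_elim (simp add: r_def)
      then have "U2 - D \<le> 0"
        by (rule second_derivative_nonpos_at_local_max(2)[OF d1 d2])
      then have "c\<^sup>2 * U2 \<le> c\<^sup>2 * D" by (intro mult_left_mono) auto
      then show "- h (norm p) / 3 \<le> inf_laplacian \<psi> p"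
        using lap max cU2 by simp
    qed
    show "(\<forall>\<^sub>F x in nhds p. U (norm x) - \<psi> x \<ge> U (norm p) - \<psi> p) \<longrightarrow> inf_laplacian \<psi> p \<le> - h (norm p) / 3"
    proof
      assume min: "\<forall>\<^sub>F x in nhds p. U (norm x) - \<psi> x \<ge> U (norm p) - \<psi> p"
      have max: "\<forall>\<^sub>F t in nhds 0. - (U (r + t) - \<psi> (p + t *\<^sub>R \<nu>)) \<le> - (U (r + 0) - \<psi> (p + 0 *\<^sub>R \<nu>))"
        using eventually_compose_filterlim[OF min line] normline
        by eventually_elim (simp add: r_def)
      have d1': "\<forall>\<^sub>F t in nhds 0. ((\<lambda>t. - (U (r + t) - \<psi> (p + t *\<^sub>R \<nu>))) has_real_derivative
          - (- root 3 (Z (r + t)) - \<phi>' t)) (at t)"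
        using d1 by eventually_elim (rule DERIV_minus)
      have "- (U2 - D) \<le> 0"
        by (rule second_derivative_nonpos_at_local_max(2)[OF d1' DERIV_minus[OF d2] max])
      then have "c\<^sup>2 * U2 \<ge> c\<^sup>2 * D" by (intro mult_left_mono) auto
      then show "inf_laplacian \<psi> p \<le> - h (norm p) / 3"
        using lap min cU2 by simp
    qed
  qed
  have center: "inf_laplacian \<psi> 0 = 0"
    if C2: "C2_on (ball 0 \<rho>) \<psi>"
      and ext: "(\<forall>\<^sub>F x in nhds 0. U (norm x) - \<psi> x \<le> U (norm (0::real^'n)) - \<psi> 0)
        \<or> (\<forall>\<^sub>F x in nhds 0. U (norm x) - \<psi> x \<ge> U (norm (0::real^'n)) - \<psi> 0)"
    for \<psi> :: "real ^ 'n \<Rightarrow> real"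
  proof -
    have diff: "\<psi> differentiable (at 0)"
      using C2 \<rho> unfolding C2_on_def C1_on_def
      by (metis differentiable_on_def at_within_open open_ball centre_in_ball)
    have "partial i \<psi> 0 = 0" for i
      using partial_eq_at_local_max[OF diff radial_profile_flat_at_origin[OF prof] ext, of i] by simp
    then show ?thesis by (simp add: inf_laplacian_def)
  qed
  have vacuous: False
    if C2: "C2_on (ball 0 \<rho>) \<psi>"
      and min: "\<forall>\<^sub>F x in nhds 0. U (norm x) - \<psi> x \<ge> U (norm (0::real^'n)) - \<psi> 0"
    for \<psi> :: "real ^ 'n \<Rightarrow> real"
  proof -
    define \<nu> :: "real ^ 'n" where "\<nu> = axis undefined 1"
    have \<nu>: "norm \<nu> = 1" by (simp add: \<nu>_def)
    define D where "D = (\<Sum>i\<in>UNIV. \<Sum>j\<in>UNIV. \<nu> $ i * \<nu> $ j * partial i (partial j \<psi>) 0)"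
    define \<phi>' where "\<phi>' = (\<lambda>t. \<Sum>i\<in>UNIV. \<nu> $ i * partial i \<psi> (0 + t *\<^sub>R \<nu>))"
    have "0 \<in> ball (0::real^'n) \<rho>" using \<rho> by simp
    note along = C2_along_line[OF C2 open_ball this, of \<nu>, folded \<phi>'_def D_def]
    have diff: "\<psi> differentiable (at 0)"
      using C2 \<rho> unfolding C2_on_def C1_on_def
      by (metis differentiable_on_def at_within_open open_ball centre_in_ball)
    have zero: "\<phi>' 0 = 0"
      using partial_eq_at_local_max[OF diff radial_profile_flat_at_origin[OF prof]] min
      by (simp add: \<phi>'_def)
    define K where "K = \<bar>D\<bar> + 1"
    let ?f = "\<lambda>t. \<psi> (0 + t *\<^sub>R \<nu>) + K * t\<^sup>2"
    have "\<forall>\<^sub>F t in nhds 0. (?f has_real_derivative \<phi>' t + K * (2 * t)) (at t)"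
      using along(1) by eventually_elim (auto simp: \<phi>'_def intro!: derivative_eq_intros)
    moreover have "((\<lambda>t. \<phi>' t + K * (2 * t)) has_real_derivative D + K * 2) (at 0)"
      by (rule derivative_eq_intros along refl | simp)+
    moreover have "D + K * 2 > 0" by (simp add: K_def)
    ultimately have "\<forall>\<^sub>F t in nhds 0. t \<noteq> 0 \<longrightarrow> ?f 0 < ?f t"
      by (intro strict_local_min_if_second_derivative_pos) (auto simp: zero)
    then obtain d1 where d1: "d1 > 0" "\<And>t. \<bar>t\<bar> < d1 \<Longrightarrow> \<psi> 0 \<le> \<psi> (t *\<^sub>R \<nu>) + K * t\<^sup>2"
      unfolding eventually_nhds_metric by (force simp: dist_real_def)
    obtain d2 where d2: "d2 > 0" "\<And>x. norm x < d2 \<Longrightarrow> U (norm x) - \<psi> x \<ge> U 0 - \<psi> 0"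
      using eventually_near_origin min by auto
    \<comment> \<open>half of the critical value \<open>h 0 / 3\<close>, so that \<open>U\<close> lies below this cusp\<close>
    define C where "C = root 3 (81/64 * (h 0 / 6))"
    have C: "C > 0" using h0 by (simp add: C_def)
    have "h 0 / 6 > 0" using h0 by simp
    then obtain d3 where d3: "d3 > 0" "d3 < \<rho>" "\<And>r. r \<in> {0..d3} \<Longrightarrow> U r \<le> U 0 - C * r powr (4/3)"
      using radial_profile_cusp(1)[OF prof root3_scaled_cubed(2), of "h 0 / 6"]
      by (auto simp: root3_scaled_cubed(1) C_def)
    define d where "d = min d1 (min d2 d3)"
    have d: "d > 0" using d1 d2 d3 by (simp add: d_def)
    have "C \<le> K * t powr (2/3)" if t: "0 < t" "t < d" for t
    proof -
      have "C * t powr (4/3) \<le> K * t\<^sup>2"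
        using d1(2)[of t] d2(2)[of "t *\<^sub>R \<nu>"] d3(3)[of t] t \<nu> by (simp add: d_def)
      also have "t\<^sup>2 = t powr (2/3) * t powr (4/3)"
      proof -
        have "t\<^sup>2 = t powr 2" using t by simp
        then show ?thesis by (simp flip: powr_add)
      qed
      finally have "C * t powr (4/3) \<le> (K * t powr (2/3)) * t powr (4/3)"
        by (simp add: mult_ac)
      then show ?thesis
        by (rule mult_right_le_imp_le) (use t in simp)
    qed
    then have "\<forall>\<^sub>F t in at_right 0. C \<le> K * t powr (2/3)"
      unfolding eventually_at_right_field using d by blast
    moreover have "((\<lambda>t. K * t powr (2/3)) \<longlongrightarrow> K * 0 powr (2/3)) (at_right 0)"
      using eventually_at_right_less[of "0::real"]
      by (intro tendsto_intros) (auto elim: eventually_mono)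
    ultimately have "C \<le> K * 0 powr (2/3)"
      using tendsto_lowerbound[of _ _ "at_right (0::real)"] by fastforce
    then show False using C by simp
  qed
  show ?thesis
    unfolding viscosity_solution_def viscosity_subsolution_def viscosity_supersolution_def
  proof (intro conjI allI impI contU; elim conjE)
    fix \<psi> :: "real ^ 'n \<Rightarrow> real" and p :: "real ^ 'n"
    assume *: "C2_on (ball 0 \<rho>) \<psi>" "p \<in> ball 0 \<rho>"
    have Gp: "G p (U (norm p)) = - h (norm p) / 3" using G * by simp
    show "G p (U (norm p)) \<le> inf_laplacian \<psi> p"
      if "\<forall>\<^sub>F x in nhds p. U (norm x) - \<psi> x \<le> U (norm p) - \<psi> p"
      using away(1)[OF *] center[OF *(1)] that h0 unfolding Gp by (cases "p = 0") auto
    show "inf_laplacian \<psi> p \<le> G p (U (norm p))"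
      if "\<forall>\<^sub>F x in nhds p. U (norm p) - \<psi> p \<le> U (norm x) - \<psi> x"
      using away(2)[OF *] vacuous[OF *(1)] that unfolding Gp by (cases "p = 0") auto
  qed
qed

section \<open>Comparison of radial profiles with viscosity sub- and supersolutions\<close>

lemma radial_profile_affine:
  assumes "radial_profile \<rho> U Z h" "\<theta> > 0"
  shows "radial_profile \<rho> (\<lambda>r. \<theta> * (U r + c)) (\<lambda>r. \<theta> ^ 3 * Z r) (\<lambda>r. \<theta> ^ 3 * h r)"
proof -
  have r: "root 3 (\<theta> ^ 3 * z) = \<theta> * root 3 z" for z
    using assms(2) by (simp add: real_root_mult real_root_power_cancel)
  show ?thesis
    using assms unfolding radial_profile_def r
    by (auto intro!: continuous_intros derivative_eq_intros)
qed

lemma radial_profile_continuous_on_cball: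
  assumes "radial_profile \<rho> U Z h"
  shows "continuous_on (cball 0 \<rho>) (\<lambda>x::real^'n. U (norm x))"
  by (rule continuous_on_compose2[of "{0..\<rho>}" U])
     (use assms in \<open>auto intro!: continuous_intros simp: radial_profile_def\<close>)

text \<open>Both sides of the equation are homogeneous of degree three.  If the quotient \<open>U / w\<close> exceeded \<open>K\<close>, its
maximum would be attained inside, and the correspondingly scaled profile would touch \<open>w\<close> from below
there; this contradicts the strict inequality for \<open>h\<close>.\<close>

lemma strict_radial_subsolution_le:
  fixes a w :: "real ^ 'n \<Rightarrow> real"
  assumes w: "viscosity_supersolution (ball 0 R) (\<lambda>x s. - lam * a x * s ^ 3) w"
    and a: "continuous_on (ball 0 R) a"
    and \<rho>: "\<rho> \<le> R" and contw: "continuous_on (cball 0 \<rho>) w"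
    and pos: "\<And>x. norm x \<le> \<rho> \<Longrightarrow> w x > 0"
    and prof: "radial_profile \<rho> U Z h"
    and strict: "\<And>x. norm x < \<rho> \<Longrightarrow> U (norm x) > 0 \<Longrightarrow> h (norm x) < 3 * lam * a x * U (norm x) ^ 3"
    and K: "K \<ge> 0" "\<And>x. norm x = \<rho> \<Longrightarrow> U \<rho> \<le> K * w x"
    and x: "norm x \<le> \<rho>"
  shows "U (norm x) \<le> K * w x"
proof -
  have "\<rho> > 0" using prof by (simp add: radial_profile_def)
  let ?q = "\<lambda>x. U (norm x) / w x"
  have "continuous_on (cball 0 \<rho>) ?q"
    using pos by (intro continuous_on_divide contw radial_profile_continuous_on_cball[OF prof]) force
  then obtain p where p: "p \<in> cball 0 \<rho>" "\<And>x. x \<in> cball 0 \<rho> \<Longrightarrow> ?q x \<le> ?q p"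
    using continuous_attains_sup[OF compact_cball, of 0 \<rho> ?q] \<open>\<rho> > 0\<close> by auto
  have "?q p \<le> K"
  proof (rule ccontr)
    assume "\<not> ?q p \<le> K"
    then have M: "?q p > K" by simp
    define \<theta> where "\<theta> = w p / U (norm p)"
    have wp: "w p > 0" using pos p by simp
    have "?q p > 0" using M K by simp
    then have Up: "U (norm p) > 0" using wp by (simp add: zero_less_divide_iff)
    then have \<theta>: "\<theta> > 0" using wp by (simp add: \<theta>_def)
    have "norm p \<noteq> \<rho>"
      using M K(2)[of p] wp by (auto simp: field_simps)
    then have pn: "norm p < \<rho>" using p(1) by simp
    have ge: "w x \<ge> \<theta> * U (norm x)" if "norm x < \<rho>" for x
    proof -
      have "w x > 0" using pos that by simp
      then show ?thesis
        using p(2)[of x] that wp Up by (simp add: \<theta>_def field_simps)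
    qed
    have eq: "w p = \<theta> * U (norm p)" using Up by (simp add: \<theta>_def)
    have "\<forall>\<^sub>F x in nhds p. norm x < \<rho>"
      using eventually_nhds_in_open[OF open_ball, of p 0 \<rho>] pn by (auto elim: eventually_mono)
    then have "\<forall>\<^sub>F x in nhds p. w x - \<theta> * (U (norm x) + 0) \<ge> w p - \<theta> * (U (norm p) + 0)"
      by eventually_elim (use ge eq in simp)
    moreover have "continuous_on (ball 0 \<rho>) (\<lambda>x. - lam * a x * w x ^ 3)"
      using \<rho> by (intro continuous_intros continuous_on_subset[OF a] continuous_on_subset[OF contw]) auto
    moreover have "ball 0 \<rho> \<subseteq> ball (0::real^'n) R" using \<rho> by auto
    ultimately have "- (\<theta> ^ 3 * h (norm p)) / 3 \<le> - lam * a p * w p ^ 3"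
      using supersolution_touched_by_profile[OF w radial_profile_affine[OF prof \<theta>, of 0]] pn by blast
    also have "\<dots> = - (\<theta> ^ 3) * (lam * a p * U (norm p) ^ 3)"
      by (simp add: eq power_mult_distrib)
    finally have "\<theta> ^ 3 * (3 * lam * a p * U (norm p) ^ 3) \<le> \<theta> ^ 3 * h (norm p)" by simp
    then show False
      using strict[OF pn Up] \<theta> by (simp add: mult_less_le_imp_less)
  qed
  then have "?q x \<le> K" using p(2)[of x] x by simp
  then show ?thesis using pos[OF x] by (simp add: field_simps)
qed

lemma subsolution_le_strict_radial_supersolution:
  fixes a w :: "real ^ 'n \<Rightarrow> real"
  assumes w: "viscosity_subsolution (ball 0 R) (\<lambda>x s. - lam * a x * s ^ 3) w"
    and a: "continuous_on (ball 0 R) a"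
    and \<rho>: "\<rho> \<le> R" and contw: "continuous_on (cball 0 \<rho>) w"
    and prof: "radial_profile \<rho> V Z h"
    and pos: "\<And>r. 0 \<le> r \<Longrightarrow> r \<le> \<rho> \<Longrightarrow> V r > 0"
    and strict: "\<And>x. norm x < \<rho> \<Longrightarrow> 3 * lam * a x * V (norm x) ^ 3 < h (norm x)"
    and K: "K \<ge> 0" "\<And>x. norm x = \<rho> \<Longrightarrow> w x \<le> K * V \<rho>"
    and x: "norm x \<le> \<rho>"
  shows "w x \<le> K * V (norm x)"
proof -
  have "\<rho> > 0" using prof by (simp add: radial_profile_def)
  have pos': "V (norm x) > 0" if "norm x \<le> \<rho>" for x :: "real ^ 'n"
    using pos[of "norm x"] that by simp
  let ?q = "\<lambda>x. w x / V (norm x)"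
  have "continuous_on (cball 0 \<rho>) ?q"
    using pos' by (intro continuous_on_divide contw radial_profile_continuous_on_cball[OF prof]) force
  then obtain p where p: "p \<in> cball 0 \<rho>" "\<And>x. x \<in> cball 0 \<rho> \<Longrightarrow> ?q x \<le> ?q p"
    using continuous_attains_sup[OF compact_cball, of 0 \<rho> ?q] \<open>\<rho> > 0\<close> by auto
  have "?q p \<le> K"
  proof (rule ccontr)
    assume "\<not> ?q p \<le> K"
    then have M: "?q p > K" by simp
    define \<theta> where "\<theta> = w p / V (norm p)"
    have Vp: "V (norm p) > 0" using pos' p by simp
    have \<theta>: "\<theta> > 0" using M K by (simp add: \<theta>_def)
    have "norm p \<noteq> \<rho>"
      using M K(2)[of p] Vp by (auto simp: field_simps)
    then have pn: "norm p < \<rho>" using p(1) by simp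
    have le: "w x \<le> \<theta> * V (norm x)" if "norm x < \<rho>" for x
      using p(2)[of x] pos'[of x] that unfolding \<theta>_def[symmetric] by (simp add: field_simps)
    have eq: "w p = \<theta> * V (norm p)" using Vp by (simp add: \<theta>_def)
    have "\<forall>\<^sub>F x in nhds p. norm x < \<rho>"
      using eventually_nhds_in_open[OF open_ball, of p 0 \<rho>] pn by (auto elim: eventually_mono)
    then have "\<forall>\<^sub>F x in nhds p. w x - \<theta> * (V (norm x) + 0) \<le> w p - \<theta> * (V (norm p) + 0)"
      by eventually_elim (use le eq in simp)
    moreover have "continuous_on (ball 0 \<rho>) (\<lambda>x. - lam * a x * w x ^ 3)"
      using \<rho> by (intro continuous_intros continuous_on_subset[OF a] continuous_on_subset[OF contw]) auto
    moreover have "ball 0 \<rho> \<subseteq> ball (0::real^'n) R" using \<rho> by auto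
    ultimately have "- (\<theta> ^ 3 * h (norm p)) / 3 \<ge> - lam * a p * w p ^ 3"
      using subsolution_touched_by_profile[OF w radial_profile_affine[OF prof \<theta>, of 0]] pn by blast
    moreover have "- lam * a p * w p ^ 3 = - (\<theta> ^ 3) * (lam * a p * V (norm p) ^ 3)"
      by (simp add: eq power_mult_distrib)
    ultimately have "\<theta> ^ 3 * h (norm p) \<le> \<theta> ^ 3 * (3 * lam * a p * V (norm p) ^ 3)" by linarith
    then show False
      using strict[OF pn] \<theta> by (simp add: mult_less_le_imp_less)
  qed
  then have "?q x \<le> K" using p(2)[of x] x by simp
  then show ?thesis using pos'[OF x] by (simp add: field_simps)
qed

lemma integral_has_derivative_interior:
  fixes g :: "real \<Rightarrow> real"
  assumes "continuous_on {0..<\<rho>} g" "0 < r" "r < \<rho>"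
  shows "((\<lambda>x. integral {0..x} g) has_real_derivative g r) (at r)"
proof -
  obtain b where b: "r < b" "b < \<rho>" using dense assms(3) by blast
  have "((\<lambda>x. integral {0..x} g) has_real_derivative g r) (at r within {0..b})"
    using assms b by (intro integral_has_real_derivative continuous_on_subset[OF assms(1)]) auto
  then show ?thesis
    using assms b by (simp add: at_within_Icc_at)
qed

lemma integral_pos_if_pos_at_zero:
  fixes f :: "real \<Rightarrow> real"
  assumes f: "continuous_on {0..<\<rho>} f" "f 0 > 0" "\<And>s. 0 \<le> s \<Longrightarrow> s < \<rho> \<Longrightarrow> f s \<ge> 0"
    and r: "0 < r" "r < \<rho>"
  shows "integral {0..r} f > 0"
proof -
  let ?I = "\<lambda>r. integral {0..r} f"
  have "\<rho> > 0" using r by simp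
  then obtain d where d: "d > 0" "d < \<rho>" "\<forall>s\<in>{0..d}. 0 < f s"
    using eventually_near_zero(1)[OF f(1)] f(2) by blast
  define e where "e = min d r"
  have e: "0 < e" "e \<le> r" "e \<le> d" using d r by (auto simp: e_def)
  have int: "f integrable_on {0..r}"
    using r by (intro integrable_continuous_real continuous_on_subset[OF f(1)]) auto
  have cont: "continuous_on {0..r} ?I"
    by (rule indefinite_integral_continuous_1[OF int])
  have der: "(?I has_real_derivative f s) (at s)" if "0 < s" "s < \<rho>" for s
    by (rule integral_has_derivative_interior[OF f(1) that])
  have "?I 0 < ?I e"
  proof (rule DERIV_pos_imp_increasing_open[OF e(1)])
    show "\<exists>y. (?I has_real_derivative y) (at x) \<and> 0 < y" if "0 < x" "x < e" for x
      using der[of x] d e that by (intro exI[of _ "f x"]) auto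
  qed (use e in \<open>auto intro: continuous_on_subset[OF cont]\<close>)
  also have "?I e \<le> ?I r"
  proof (rule DERIV_nonneg_imp_increasing_open[OF e(2)])
    show "\<exists>y. (?I has_real_derivative y) (at x) \<and> 0 \<le> y" if "e < x" "x < r" for x
      using der[of x] f(3)[of x] e r that by (intro exI[of _ "f x"]) auto
  qed (use e in \<open>auto intro: continuous_on_subset[OF cont]\<close>)
  finally show ?thesis by simp
qed

lemma continuous_if_integral_eq:
  fixes u :: "real \<Rightarrow> real"
  assumes "g integrable_on {0..R}" "\<And>r. r \<in> {0..R} \<Longrightarrow> u r = m - c * integral {0..r} g"
  shows "continuous_on {0..R} u"
proof -
  have "continuous_on {0..R} (\<lambda>r. m - c * integral {0..r} g)"
    by (intro continuous_intros indefinite_integral_continuous_1 assms)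
  then show ?thesis
    by (rule continuous_on_eq) (simp add: assms)
qed

lemma continuous_on_Ico_if_Icc:
  fixes g :: "real \<Rightarrow> 'a::topological_space"
  assumes "\<And>b. b < \<rho> \<Longrightarrow> continuous_on {0..b} g"
  shows "continuous_on {0..<\<rho>} g"
  unfolding continuous_on_eq_continuous_within
proof
  fix x assume x: "x \<in> {0..<\<rho>}"
  then obtain b where b: "x < b" "b < \<rho>" using dense by auto
  have "at x within {0..<\<rho>} = at x within {0..b}"
    by (rule at_within_nhd[of x "{..<b}"]) (use b in auto)
  then show "continuous (at x within {0..<\<rho>}) g"
    using assms[OF b(2)] x b by (auto simp: continuous_on_eq_continuous_within)
qed

text \<open>The source \<open>f\<close> may vanish away from the origin, as it does for the truncated equation below; its value at
the origin makes \<open>Z\<close> positive.\<close>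

lemma radial_profile_if_integral_eq:
  fixes u f :: "real \<Rightarrow> real"
  assumes int: "(\<lambda>t. root 3 (integral {0..t} f)) integrable_on {0..R}"
    and eq: "\<And>r. r \<in> {0..R} \<Longrightarrow>
      u r = m - root 3 (3 * lam) * integral {0..r} (\<lambda>t. root 3 (integral {0..t} f))"
    and \<rho>: "0 < \<rho>" "\<rho> \<le> R" and lam: "lam > 0"
    and f: "continuous_on {0..<\<rho>} f" "f 0 > 0" "\<And>s. 0 \<le> s \<Longrightarrow> s < \<rho> \<Longrightarrow> f s \<ge> 0"
  shows "radial_profile \<rho> u (\<lambda>r. 3 * lam * integral {0..r} f) (\<lambda>r. 3 * lam * f r)"
proof -
  let ?g = "\<lambda>t. root 3 (integral {0..t} f)"
  have contI: "continuous_on {0..<\<rho>} (\<lambda>r. integral {0..r} f)"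
    by (rule continuous_on_Ico_if_Icc)
       (auto intro!: indefinite_integral_continuous_1 integrable_continuous_real
          continuous_on_subset[OF f(1)])
  have "continuous_on {0..<\<rho>} ?g" by (intro continuous_intros contI) 
  then have der: "((\<lambda>r. integral {0..r} ?g) has_real_derivative ?g r) (at r)" if "0 < r" "r < \<rho>" for r
    by (rule integral_has_derivative_interior[OF _ that])
  have "(u has_real_derivative - root 3 (3 * lam * integral {0..r} f)) (at r)" if r: "0 < r" "r < \<rho>" for r
  proof -
    have "((\<lambda>r. m - root 3 (3 * lam) * integral {0..r} ?g) has_real_derivative - (root 3 (3 * lam) * ?g r)) (at r)"
      using der[OF r] by (auto intro!: derivative_eq_intros)
    moreover have "\<forall>\<^sub>F x in nhds r. x \<in> {0<..<\<rho>}"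
      using r by (intro eventually_nhds_in_open) auto
    then have "\<forall>\<^sub>F x in nhds r. u x = m - root 3 (3 * lam) * integral {0..x} ?g"
      by eventually_elim (use eq \<rho> in auto)
    ultimately show ?thesis
      by (simp add: DERIV_cong_ev[OF refl _ refl] real_root_mult)
  qed
  moreover have "integral {0..r} f > 0" if "0 < r" "r < \<rho>" for r
    by (rule integral_pos_if_pos_at_zero[OF f that])
  moreover have "((\<lambda>r. 3 * lam * integral {0..r} f) has_real_derivative 3 * lam * f r) (at r)"
    if "0 < r" "r < \<rho>" for r
    by (intro DERIV_cmult integral_has_derivative_interior[OF f(1) that])
  moreover have "continuous_on {0..\<rho>} u"
    using continuous_if_integral_eq[OF int eq] \<rho> by (auto elim: continuous_on_subset)
  ultimately show ?thesis
    unfolding radial_profile_def using \<rho> lam f by (auto intro!: continuous_intros contI)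
qed

lemma integrable_bounded_continuous_Ico:
  fixes f :: "real \<Rightarrow> real"
  assumes "continuous_on {0..<R} f" "\<And>s. 0 \<le> s \<Longrightarrow> s < R \<Longrightarrow> \<bar>f s\<bar> \<le> B" "t \<le> R"
  shows "f integrable_on {0..t}"
proof -
  have "continuous_on {0..<t} f" by (rule continuous_on_subset[OF assms(1)]) (use assms(3) in auto)
  then have "f \<in> borel_measurable (lebesgue_on {0..<t})"
    by (rule continuous_imp_measurable_on_sets_lebesgue) auto
  moreover have "(\<lambda>_. B) integrable_on {0..<t}"
    by (rule integrable_spike_set[of _ "{0..t}"]) (auto intro: negligible_subset[of "{t}"])
  ultimately have "f integrable_on {0..<t}"
    by (rule measurable_bounded_by_integrable_imp_integrable) (use assms(2,3) in auto)
  then show ?thesis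
    by (rule integrable_spike_set) (auto intro: negligible_subset[of "{t}"])
qed

section \<open>Existence for a truncated radial equation\<close>

text \<open>Solutions starting at the value \<open>1\<close> decrease.  Clipping their values to the unit interval changes
nothing as long as they are positive, keeps the source nonnegative afterwards, and makes it globally
Lipschitz.\<close>

definition clip01 :: "real \<Rightarrow> real" where
  "clip01 x = max 0 (min 1 x)"

lemma clip01_bounds: "0 \<le> clip01 x" "clip01 x \<le> 1"
  by (auto simp: clip01_def)

lemma clip01_cube_Lipschitz: "\<bar>clip01 x ^ 3 - clip01 y ^ 3\<bar> \<le> 3 * \<bar>x - y\<bar>"
proof -
  let ?p = "clip01 x" and ?q = "clip01 y"
  have "?p ^ 3 - ?q ^ 3 = (?p - ?q) * (?p\<^sup>2 + ?p * ?q + ?q\<^sup>2)"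
    by (simp add: power2_eq_square power3_eq_cube algebra_simps)
  moreover have "0 \<le> ?p\<^sup>2 + ?p * ?q + ?q\<^sup>2" "?p\<^sup>2 + ?p * ?q + ?q\<^sup>2 \<le> 1 + 1 + 1"
    using clip01_bounds[of x] clip01_bounds[of y]
    by (simp, intro add_mono power_le_one mult_le_one) auto
  moreover have "\<bar>?p - ?q\<bar> \<le> \<bar>x - y\<bar>" by (auto simp: clip01_def)
  ultimately show ?thesis
    by (simp add: abs_mult mult.commute[of "\<bar>?p - ?q\<bar>"] mult_mono)
qed

lemma root3_Lipschitz:
  assumes "b > 0" "x \<ge> b" "y \<ge> b"
  shows "\<bar>root 3 x - root 3 y\<bar> \<le> \<bar>x - y\<bar> / (root 3 b)\<^sup>2"
proof -
  let ?p = "root 3 x" and ?q = "root 3 y" and ?\<beta> = "root 3 b"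
  have \<beta>: "?\<beta> > 0" "?p \<ge> ?\<beta>" "?q \<ge> ?\<beta>" using assms by auto
  have "x = ?p ^ 3" "y = ?q ^ 3" using assms by auto
  then have "x - y = (?p - ?q) * (?p\<^sup>2 + ?p * ?q + ?q\<^sup>2)"
    by (simp add: power2_eq_square power3_eq_cube algebra_simps)
  moreover have "?p\<^sup>2 \<ge> ?\<beta>\<^sup>2" "?p * ?q \<ge> 0" "?q\<^sup>2 \<ge> 0" using \<beta> by (auto intro: power_mono)
  then have "?\<beta>\<^sup>2 \<le> \<bar>?p\<^sup>2 + ?p * ?q + ?q\<^sup>2\<bar>" by linarith
  ultimately have "\<bar>?p - ?q\<bar> * ?\<beta>\<^sup>2 \<le> \<bar>x - y\<bar>"
    by (simp add: abs_mult mult_left_mono)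
  then show ?thesis using \<beta> by (simp add: field_simps)
qed

lemma integral_abs_bound_const:
  fixes f :: "real \<Rightarrow> real"
  assumes "f integrable_on {0..t}" "0 \<le> t" "\<And>s. 0 \<le> s \<Longrightarrow> s \<le> t \<Longrightarrow> \<bar>f s\<bar> \<le> B"
  shows "\<bar>integral {0..t} f\<bar> \<le> B * t"
proof -
  have "norm (integral {0..t} f) \<le> integral {0..t} (\<lambda>_. B)"
    by (rule integral_norm_bound_integral) (use assms in auto)
  then show ?thesis using assms(2) by (simp add: mult.commute)
qed

text \<open>The right-hand side is a contraction for the maximum norm weighted with \<open>exp (- L r)\<close>, and its
iterates converge.  The only obstacle is the cube root, which is not Lipschitz at zero.  However, all
iterates stay above \<open>1/2\<close> on a fixed interval \<open>{0..\<tau>}\<close>, so the inner integral is at least \<open>b * t\<close>;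
there the cube root has Lipschitz constant of order \<open>t powr - (2/3)\<close>, and the inner integrals of
two functions differ by at most a multiple of \<open>t\<close> times the distance of these functions.\<close>

lemma truncated_radial_equation_has_solution:
  fixes \<alpha> :: "real \<Rightarrow> real"
  assumes R: "R > 0" and lam: "lam > 0"
    and cont_weight: "continuous_on {0..<R} \<alpha>"
    and \<alpha>: "\<And>s. 0 \<le> s \<Longrightarrow> s < R \<Longrightarrow> 0 < \<alpha> s" "\<And>s. 0 \<le> s \<Longrightarrow> s < R \<Longrightarrow> \<alpha> s \<le> M"
  obtains v where "continuous_on {0..R} v"
    "\<And>t. t \<le> R \<Longrightarrow> (\<lambda>s. \<alpha> s * clip01 (v s) ^ 3) integrable_on {0..t}"
    "(\<lambda>t. root 3 (integral {0..t} (\<lambda>s. \<alpha> s * clip01 (v s) ^ 3))) integrable_on {0..R}"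
    "\<And>r. r \<in> {0..R} \<Longrightarrow> v r = 1 - root 3 (3 * lam) *
       integral {0..r} (\<lambda>t. root 3 (integral {0..t} (\<lambda>s. \<alpha> s * clip01 (v s) ^ 3)))"
proof -
  define f where "f = (\<lambda>u s. \<alpha> s * clip01 (u s) ^ 3)"
  define I where "I = (\<lambda>u t. integral {0..t} (f u))"
  define c where "c = root 3 (3 * lam)"
  define T where "T = (\<lambda>u r. 1 - c * integral {0..r} (\<lambda>t. root 3 (I u t)))"
  have c: "c > 0" using lam by (simp add: c_def)
  have M: "M > 0" using \<alpha>[of 0] R by simp
  have contf: "continuous_on {0..<R} (f u)" if "continuous_on {0..R} u" for u
    unfolding f_def clip01_def
    by (intro continuous_intros cont_weight continuous_on_subset[OF that]) auto
  have f01: "0 \<le> f u s \<and> f u s \<le> M" if "0 \<le> s" "s < R" for u s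
  proof -
    have "0 \<le> clip01 (u s) ^ 3" "clip01 (u s) ^ 3 \<le> 1"
      using clip01_bounds[of "u s"] by (auto intro: power_le_one)
    then show ?thesis
      using \<alpha>[OF that] mult_mono[of "\<alpha> s" M "clip01 (u s) ^ 3" 1] by (auto simp: f_def less_imp_le)
  qed
  have intf: "f u integrable_on {0..t}" if "continuous_on {0..R} u" "t \<le> R" for u t
    by (rule integrable_bounded_continuous_Ico[OF contf[OF that(1)], of M]) (use f01 that in auto)
  have contI: "continuous_on {0..R} (I u)" if "continuous_on {0..R} u" for u
    unfolding I_def by (intro indefinite_integral_continuous_1 intf that order_refl)
  \<comment> \<open>the half-open interval avoids the arbitrary value \<open>\<alpha> R\<close>\<close>
  have I_eq: "I u t = integral {0..<t} (f u)" for u t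
    unfolding I_def by (rule integral_spike_set) (auto intro: negligible_subset[of "{t}"])
  have intf': "f u integrable_on {0..<t}" if "continuous_on {0..R} u" "t \<le> R" for u t
    by (rule integrable_spike_set[OF intf[OF that]]) (auto intro: negligible_subset[of "{t}"])
  have int_const: "integral {0..<t} (\<lambda>_. B) = B * t" "(\<lambda>_. B) integrable_on {0..<t}"
    if "0 \<le> t" for t B :: real
  proof -
    have "((\<lambda>_. B) has_integral B * t) {0..t}"
      using has_integral_const_real[of B 0 t] that by (simp add: mult.commute)
    then have "((\<lambda>_. B) has_integral B * t) {0..<t}"
      by (rule has_integral_spike_set_eq[THEN iffD1, rotated 2]) (auto intro: negligible_subset[of "{t}"])
    then show "integral {0..<t} (\<lambda>_. B) = B * t" "(\<lambda>_. B) integrable_on {0..<t}" by auto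
  qed
  have I_le: "I u t \<le> M * t" and I_ge: "0 \<le> I u t"
    if "continuous_on {0..R} u" "0 \<le> t" "t \<le> R" for u t
  proof -
    have "integral {0..<t} (f u) \<le> integral {0..<t} (\<lambda>_. M)"
      by (rule integral_le) (use intf' int_const f01 that in auto)
    then show "I u t \<le> M * t" using int_const that by (simp add: I_eq)
    show "0 \<le> I u t"
      unfolding I_eq by (rule integral_nonneg) (use intf' f01 that in auto)
  qed
  have introot: "(\<lambda>t. root 3 (I u t)) integrable_on {0..r}" if "continuous_on {0..R} u" "r \<le> R" for u r
    by (intro integrable_continuous_real continuous_intros continuous_on_subset[OF contI[OF that(1)]])
       (use that in auto)
  have contT: "continuous_on {0..R} (T u)" if "continuous_on {0..R} u" for u
    unfolding T_def by (intro continuous_intros indefinite_integral_continuous_1 introot that order_refl)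
  define B where "B = c * root 3 (M * R)"
  have B: "B > 0" using c M R by (simp add: B_def)
  have T_bounds: "T u r \<ge> 1 - B * r" "\<bar>T u r - 1\<bar> \<le> B * R"
    if "continuous_on {0..R} u" "0 \<le> r" "r \<le> R" for u r
  proof -
    have "\<bar>integral {0..r} (\<lambda>t. root 3 (I u t))\<bar> \<le> root 3 (M * R) * r"
    proof (rule integral_abs_bound_const[OF introot])
      fix s assume s: "0 \<le> s" "s \<le> r"
      have "M * s \<le> M * R" using s M that by (intro mult_left_mono) auto
      then have "I u s \<le> M * R" "0 \<le> I u s"
        using I_le[of u s] I_ge[of u s] that s by auto
      then show "\<bar>root 3 (I u s)\<bar> \<le> root 3 (M * R)" by simp
    qed (use that in auto)
    then have "c * \<bar>integral {0..r} (\<lambda>t. root 3 (I u t))\<bar> \<le> B * r"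
      using c by (simp add: B_def mult.assoc)
    then have *: "\<bar>T u r - 1\<bar> \<le> B * r" using c by (simp add: T_def abs_mult)
    then show "T u r \<ge> 1 - B * r" by simp
    show "\<bar>T u r - 1\<bar> \<le> B * R"
      using order_trans[OF * mult_left_mono[of r R B]] B that by simp
  qed
  have "\<alpha> 0 / 2 < \<alpha> 0" using \<alpha>(1)[of 0] R by simp
  then obtain t2 where t2: "t2 > 0" "t2 < R" "\<And>s. s \<in> {0..t2} \<Longrightarrow> \<alpha> 0 / 2 < \<alpha> s"
    using eventually_near_zero(1)[OF cont_weight R] by blast
  \<comment> \<open>chosen such that \<open>1 - B * r \<ge> 1/2\<close> on \<open>{0..\<tau>}\<close>\<close>
  define \<tau> where "\<tau> = min t2 (1 / (2 * B))"
  have \<tau>: "0 < \<tau>" "\<tau> < R" "\<tau> \<le> t2" "B * \<tau> \<le> 1/2"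
  proof -
    show "0 < \<tau>" "\<tau> \<le> t2" using t2 B by (auto simp: \<tau>_def)
    then show "\<tau> < R" using t2 by simp
    have "B * \<tau> \<le> B * (1 / (2 * B))" using B by (intro mult_left_mono) (auto simp: \<tau>_def)
    then show "B * \<tau> \<le> 1/2" using B by simp
  qed
  define X :: "(real \<Rightarrow> real) set" where "X = {u. continuous_on {0..R} u \<and> (\<forall>r\<in>{0..\<tau>}. u r \<ge> 1/2)}"
  have TX: "T u \<in> X" if "u \<in> X" for u
  proof -
    have "T u r \<ge> 1/2" if r: "r \<in> {0..\<tau>}" for r
    proof -
      have "B * r \<le> B * \<tau>" using r B by simp
      then show ?thesis using T_bounds(1)[of u r] \<open>u \<in> X\<close> r \<tau> by (auto simp: X_def)
    qed
    then show ?thesis using contT that by (auto simp: X_def)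
  qed
  \<comment> \<open>the source is bounded below near the origin, so \<open>I u t\<close> grows at least linearly\<close>
  define b where "b = \<alpha> 0 / 16 * \<tau> / R"
  have b: "b > 0" using \<alpha>(1)[of 0] R \<tau> by (simp add: b_def)
  have I_lower: "I u t \<ge> b * t" if u: "u \<in> X" and t: "0 \<le> t" "t \<le> R" for u t
  proof -
    have cu: "continuous_on {0..R} u" using u by (simp add: X_def)
    define s where "s = min t \<tau>"
    have s: "0 \<le> s" "s \<le> t" "s \<le> \<tau>" "s \<le> R" using t \<tau> by (auto simp: s_def)
    have "\<alpha> 0 / 16 * s = integral {0..<s} (\<lambda>_. \<alpha> 0 / 16)"
      using int_const s by simp
    also have "\<dots> \<le> integral {0..<s} (f u)"
    proof (rule integral_le)
      fix x assume x: "x \<in> {0..<s}"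
      then have "u x \<ge> 1/2" using u s by (auto simp: X_def)
      then have "clip01 (u x) \<ge> 1/2" unfolding clip01_def by linarith
      moreover have "\<alpha> x \<ge> \<alpha> 0 / 2" using t2(3)[of x] x s \<tau> by simp
      ultimately have "\<alpha> x * clip01 (u x) ^ 3 \<ge> \<alpha> 0 / 2 * (1/2) ^ 3"
        using \<alpha>(1)[of 0] R by (intro mult_mono power_mono) auto
      then show "\<alpha> 0 / 16 \<le> f u x" by (simp add: f_def power3_eq_cube)
    qed (use int_const s intf'[OF cu] in auto)
    also have "\<dots> \<le> integral {0..<t} (f u)"
      by (rule integral_subset_le) (use s t intf'[OF cu] f01 in auto)
    finally have "\<alpha> 0 / 16 * s \<le> I u t" by (simp add: I_eq)
    moreover have "\<tau> / R * t \<le> s"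
    proof -
      have "\<tau> / R * t \<le> \<tau> / R * R" using t \<tau> R by (intro mult_left_mono) auto
      moreover have "\<tau> / R * t \<le> 1 * t" using t \<tau> R by (intro mult_right_mono) auto
      ultimately show ?thesis using R by (simp add: s_def)
    qed
    then have "\<alpha> 0 / 16 * (\<tau> / R * t) \<le> \<alpha> 0 / 16 * s"
      using \<alpha>(1)[of 0] R by (intro mult_left_mono) auto
    moreover have "b * t = \<alpha> 0 / 16 * (\<tau> / R * t)" by (simp add: b_def)
    ultimately show ?thesis by linarith
  qed
  define \<kappa> where "\<kappa> = 3 * M * (root 3 R / (root 3 b)\<^sup>2)"
  have \<kappa>: "\<kappa> > 0" using M R b by (simp add: \<kappa>_def)
  \<comment> \<open>this exponent makes the contraction factor equal to \<open>1/2\<close>\<close>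
  define L where "L = 2 * c * \<kappa>"
  have L: "L > 0" using c \<kappa> by (simp add: L_def)
  have contraction: "\<bar>T u r - T v r\<bar> \<le> D / 2 * exp (L * r)"
    if u: "u \<in> X" and v: "v \<in> X" and D: "D \<ge> 0"
      and close: "\<And>s. 0 \<le> s \<Longrightarrow> s \<le> R \<Longrightarrow> \<bar>u s - v s\<bar> \<le> D * exp (L * s)"
      and r: "0 \<le> r" "r \<le> R" for u v D r
  proof -
    have cu: "continuous_on {0..R} u" "continuous_on {0..R} v" using u v by (auto simp: X_def)
    have roots: "\<bar>root 3 (I u t) - root 3 (I v t)\<bar> \<le> \<kappa> * D * exp (L * t)" if t: "0 \<le> t" "t \<le> R" for t
    proof (cases "t = 0")
      case True
      then show ?thesis using \<kappa> D by (simp add: I_def)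
    next
      case False
      then have t0: "t > 0" using t by simp
      have "I u t - I v t = integral {0..<t} (\<lambda>s. f u s - f v s)"
        unfolding I_eq using intf' cu t by (simp add: integral_diff)
      also have "norm \<dots> \<le> integral {0..<t} (\<lambda>_. 3 * M * D * exp (L * t))"
      proof (rule integral_norm_bound_integral)
        fix s assume s: "s \<in> {0..<t}"
        then have s': "0 \<le> s" "s < R" using t by auto
        have "\<bar>f u s - f v s\<bar> = \<alpha> s * \<bar>clip01 (u s) ^ 3 - clip01 (v s) ^ 3\<bar>"
          using \<alpha>(1)[OF s'] by (simp add: f_def abs_mult flip: right_diff_distrib)
        also have "\<dots> \<le> M * (3 * \<bar>u s - v s\<bar>)"
          using \<alpha>[OF s'] M clip01_cube_Lipschitz by (intro mult_mono) auto
        also have "\<dots> \<le> M * (3 * (D * exp (L * t)))"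
        proof -
          have "D * exp (L * s) \<le> D * exp (L * t)"
            using D L s by (intro mult_left_mono) auto
          then show ?thesis using close[of s] s' M by (intro mult_left_mono) auto
        qed
        finally show "norm (f u s - f v s) \<le> 3 * M * D * exp (L * t)" by (simp add: mult_ac)
      qed (use int_const t intf' cu in \<open>auto intro!: integrable_diff\<close>)
      finally have "\<bar>I u t - I v t\<bar> \<le> 3 * M * D * exp (L * t) * t"
        unfolding int_const(1)[OF t(1)] real_norm_def .
      moreover have "\<bar>root 3 (I u t) - root 3 (I v t)\<bar> \<le> \<bar>I u t - I v t\<bar> / (root 3 (b * t))\<^sup>2"
        using b t0 I_lower u v t by (intro root3_Lipschitz) auto
      moreover have rt: "root 3 t > 0" "t = root 3 t ^ 3" "root 3 b > 0" using t0 b by auto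
      ultimately have "\<bar>root 3 (I u t) - root 3 (I v t)\<bar> \<le> 3 * M * D * exp (L * t) * t / (root 3 (b * t))\<^sup>2"
        by (meson divide_right_mono order_trans zero_le_power2)
      also have "\<dots> = 3 * M * D * exp (L * t) * (t / (root 3 (b * t))\<^sup>2)" by simp
      also have "t / (root 3 (b * t))\<^sup>2 = root 3 t / (root 3 b)\<^sup>2"
      proof -
        have "t / (root 3 (b * t))\<^sup>2 = root 3 t ^ 3 / ((root 3 b)\<^sup>2 * (root 3 t)\<^sup>2)"
          using rt(2) by (simp add: real_root_mult power_mult_distrib)
        then show ?thesis using rt by (simp add: power2_eq_square power3_eq_cube)
      qed
      also have "3 * M * D * exp (L * t) * (root 3 t / (root 3 b)\<^sup>2)
          \<le> 3 * M * D * exp (L * t) * (root 3 R / (root 3 b)\<^sup>2)"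
        using M D t by (intro mult_left_mono divide_right_mono) auto
      finally show ?thesis by (simp add: \<kappa>_def mult_ac)
    qed
    have exp_int: "((\<lambda>t. \<kappa> * D * exp (L * t)) has_integral
        \<kappa> * D / L * exp (L * r) - \<kappa> * D / L * exp (L * 0)) {0..r}"
      by (rule fundamental_theorem_of_calculus)
         (use r L in \<open>auto intro!: derivative_eq_intros
            simp: has_real_derivative_iff_has_vector_derivative[symmetric]\<close>)
    have "T u r - T v r = - c * integral {0..r} (\<lambda>t. root 3 (I u t) - root 3 (I v t))"
      using introot cu r by (simp add: T_def integral_diff algebra_simps)
    also have "\<bar>\<dots>\<bar> \<le> c * integral {0..r} (\<lambda>t. \<kappa> * D * exp (L * t))"
    proof -
      have "norm (integral {0..r} (\<lambda>t. root 3 (I u t) - root 3 (I v t)))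
          \<le> integral {0..r} (\<lambda>t. \<kappa> * D * exp (L * t))"
        by (rule integral_norm_bound_integral)
           (use roots exp_int introot cu r in \<open>auto intro!: integrable_diff\<close>)
      then show ?thesis using c by (simp add: abs_mult)
    qed
    also have "\<dots> \<le> c * (\<kappa> * D / L * exp (L * r))"
      using c \<kappa> D L integral_unique[OF exp_int] by (intro mult_left_mono) auto
    also have "\<dots> = D / 2 * exp (L * r)"
      using c \<kappa> by (simp add: L_def)
    finally show ?thesis .
  qed
  define u where "u = (\<lambda>n. (T ^^ n) (\<lambda>_. 1))"
  have uS: "u (Suc n) = T (u n)" for n by (simp add: u_def)
  have uX: "u n \<in> X" for n
  proof (induction n)
    case 0
    show ?case by (simp add: u_def X_def)
  next
    case (Suc n)
    then show ?case unfolding uS by (rule TX)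
  qed
  have step: "\<bar>u (Suc n) s - u n s\<bar> \<le> B * R * (1/2) ^ n * exp (L * s)" if "0 \<le> s" "s \<le> R" for n s
    using that
  proof (induction n arbitrary: s)
    case 0
    have "\<bar>T (\<lambda>_. 1) s - 1\<bar> \<le> B * R * 1"
      using T_bounds(2)[of "\<lambda>_. 1" s] 0 by simp
    also have "\<dots> \<le> B * R * exp (L * s)"
      using B R L 0 by (intro mult_left_mono) auto
    finally show ?case by (simp add: u_def)
  next
    case (Suc n)
    have "\<bar>T (u (Suc n)) s - T (u n) s\<bar> \<le> B * R * (1/2) ^ n / 2 * exp (L * s)"
      using B R Suc by (intro contraction uX) auto
    then show ?case by (simp add: uS)
  qed
  have "uniform_limit {0..R} (\<lambda>n s. \<Sum>i<n. u (Suc i) s - u i s)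
      (\<lambda>s. \<Sum>i. u (Suc i) s - u i s) sequentially"
  proof (rule Weierstrass_m_test)
    fix n s assume "s \<in> {0..R}"
    then have "\<bar>u (Suc n) s - u n s\<bar> \<le> B * R * (1/2) ^ n * exp (L * s)"
      using step by auto
    also have "\<dots> \<le> B * R * (1/2) ^ n * exp (L * R)"
      using B R L \<open>s \<in> {0..R}\<close> by (intro mult_left_mono) auto
    finally show "norm (u (Suc n) s - u n s) \<le> B * R * (1/2) ^ n * exp (L * R)" by simp
  next
    show "summable (\<lambda>n. B * R * (1/2) ^ n * exp (L * R))"
      by (intro summable_mult summable_mult2 summable_geometric) auto
  qed
  then have "uniform_limit {0..R} (\<lambda>n s. u 0 s + (\<Sum>i<n. u (Suc i) s - u i s))
      (\<lambda>s. u 0 s + (\<Sum>i. u (Suc i) s - u i s)) sequentially"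
    by (intro uniform_limit_intros)
  then obtain v where lim: "uniform_limit {0..R} u v sequentially"
    by (auto simp: sum_lessThan_telescope[of "\<lambda>i. u i _"])
  have cv: "continuous_on {0..R} v"
    by (rule uniform_limit_theorem[OF _ lim]) (use uX in \<open>auto simp: X_def\<close>)
  have lim_pt: "(\<lambda>n. u n r) \<longlonglongrightarrow> v r" if "r \<in> {0..R}" for r
    by (rule tendsto_uniform_limitI[OF lim that])
  have "v r \<ge> 1/2" if "r \<in> {0..\<tau>}" for r
    by (rule LIMSEQ_le_const[OF lim_pt]) (use that uX \<tau> in \<open>auto simp: X_def\<close>)
  then have vX: "v \<in> X" using cv by (simp add: X_def)
  have fix_v: "T v r = v r" if r: "r \<in> {0..R}" for r
  proof (rule LIMSEQ_unique)
    show "(\<lambda>n. u (Suc n) r) \<longlonglongrightarrow> v r" using lim_pt[OF r] by (rule LIMSEQ_Suc)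
    show "(\<lambda>n. u (Suc n) r) \<longlonglongrightarrow> T v r"
    proof (rule metric_LIMSEQ_I)
      fix e :: real assume e: "e > 0"
      define D where "D = e * exp (- (L * R))"
      have D: "D > 0" using e by (simp add: D_def)
      have "\<forall>\<^sub>F n in sequentially. \<forall>s\<in>{0..R}. dist (u n s) (v s) < D"
        using lim D by (auto simp: uniform_limit_iff)
      then obtain N where N: "\<And>n s. n \<ge> N \<Longrightarrow> s \<in> {0..R} \<Longrightarrow> dist (u n s) (v s) < D"
        unfolding eventually_sequentially by blast
      have "dist (u (Suc n) r) (T v r) < e" if n: "n \<ge> N" for n
      proof -
        have "\<bar>T (u n) r - T v r\<bar> \<le> D / 2 * exp (L * r)"
        proof (rule contraction[OF uX vX])
          fix s assume s: "0 \<le> s" "s \<le> R"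
          have "D * 1 \<le> D * exp (L * s)" using D L s by (intro mult_left_mono) auto
          then show "\<bar>u n s - v s\<bar> \<le> D * exp (L * s)"
            using N[OF n, of s] s by (simp add: dist_real_def)
        qed (use D r in auto)
        also have "\<dots> \<le> D / 2 * exp (L * R)"
          using D L r by (intro mult_left_mono) auto
        also have "\<dots> < e" using e by (simp add: D_def exp_minus)
        finally show ?thesis by (simp add: uS dist_real_def)
      qed
      then show "\<exists>no. \<forall>n\<ge>no. dist (u (Suc n) r) (T v r) < e" by blast
    qed
  qed
  show thesis
  proof (rule that[OF cv])
    show "(\<lambda>s. \<alpha> s * clip01 (v s) ^ 3) integrable_on {0..t}" if "t \<le> R" for t
      using intf[OF cv that] by (simp add: f_def)
    show "(\<lambda>t. root 3 (integral {0..t} (\<lambda>s. \<alpha> s * clip01 (v s) ^ 3))) integrable_on {0..R}"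
      using introot[OF cv order_refl] by (simp add: I_def f_def)
    show "v r = 1 - root 3 (3 * lam) *
       integral {0..r} (\<lambda>t. root 3 (integral {0..t} (\<lambda>s. \<alpha> s * clip01 (v s) ^ 3)))"
      if "r \<in> {0..R}" for r
      using fix_v[OF that] by (simp add: T_def I_def f_def c_def)
  qed
qed

section \<open>Positivity, uniqueness and the first eigenfunction\<close>

lemma radial_profile_strictly_decreasing:
  assumes "radial_profile \<rho> U Z h" "0 \<le> r" "r < s" "s \<le> \<rho>"
  shows "U s < U r"
proof (rule DERIV_neg_imp_decreasing_open[OF assms(3)])
  show "continuous_on {r..s} U"
    using assms by (auto simp: radial_profile_def elim: continuous_on_subset)
  fix x assume "r < x" "x < s"
  then show "\<exists>y. (U has_real_derivative y) (at x) \<and> y < 0"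
    using assms unfolding radial_profile_def
    by (intro exI[of _ "- root 3 (Z x)"]) auto
qed

lemma radial_profile_ge_boundary:
  assumes prof: "radial_profile \<rho> U Z h" and r: "0 \<le> r" "r \<le> \<rho>"
  shows "U \<rho> \<le> U r"
proof (cases "r = \<rho>")
  case False
  then have "r < \<rho>" using r by simp
  then show ?thesis
    using radial_profile_strictly_decreasing[OF prof r(1) _ order_refl] by (simp add: less_imp_le)
qed simp

text \<open>Used below to reduce positivity on the whole interval to a comparison on a smaller ball, at whose boundary
the function vanishes.\<close>

lemma first_zero_exists:
  fixes u :: "real \<Rightarrow> real"
  assumes cont: "continuous_on {0..R} u" and u0: "u 0 > 0" and r: "r \<in> {0..R}" "u r \<le> 0"
  obtains \<rho> where "0 < \<rho>" "\<rho> \<le> R" "u \<rho> = 0" "\<And>s. 0 \<le> s \<Longrightarrow> s < \<rho> \<Longrightarrow> u s > 0"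
proof -
  let ?S = "{0..R} \<inter> u -` {..0}"
  have "closed ?S"
    by (rule continuous_closed_preimage[OF cont closed_atLeastAtMost closed_atMost])
  from compact_Int_closed[OF compact_Icc this, of 0 R] have "compact ?S"
    by (simp add: Int_assoc[symmetric])
  moreover have "?S \<noteq> {}" using r by auto
  ultimately obtain \<rho> where \<rho>: "\<rho> \<in> ?S" "\<And>s. s \<in> ?S \<Longrightarrow> \<rho> \<le> s"
    using compact_attains_inf[of ?S] by blast
  have "0 \<le> \<rho>" "\<rho> \<le> R" "u \<rho> \<le> 0" using \<rho>(1) by auto
  have "\<rho> \<noteq> 0" using \<open>u \<rho> \<le> 0\<close> u0 by auto
  then have "\<rho> > 0" using \<open>0 \<le> \<rho>\<close> by simp
  obtain x where x: "0 \<le> x" "x \<le> \<rho>" "u x = 0"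
  proof -
    have "continuous_on {0..\<rho>} u" using \<open>\<rho> \<le> R\<close> by (auto intro: continuous_on_subset[OF cont])
    then show thesis
      using IVT2'[of u \<rho> 0 0] \<open>u \<rho> \<le> 0\<close> u0 \<open>0 < \<rho>\<close> that by auto
  qed
  then have "\<rho> \<le> x" using \<rho>(2)[of x] \<open>\<rho> \<le> R\<close> by simp
  then have "u \<rho> = 0" using x by simp
  moreover have "u s > 0" if "0 \<le> s" "s < \<rho>" for s
  proof (rule ccontr)
    assume "\<not> u s > 0"
    then show False using \<rho>(2)[of s] that \<open>\<rho> \<le> R\<close> by simp
  qed
  ultimately show thesis by (rule that[OF \<open>\<rho> > 0\<close> \<open>\<rho> \<le> R\<close>])
qed

lemma viscosity_supersolution_mono:
  assumes "viscosity_supersolution \<Omega> G w" "\<And>x. x \<in> \<Omega> \<Longrightarrow> G x (w x) \<le> G' x (w x)"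
  shows "viscosity_supersolution \<Omega> G' w"
  using assms unfolding viscosity_supersolution_def by (meson order_trans)

lemma le_if_linear_perturbation_le:
  fixes x y k :: real
  assumes "\<delta> > 0" "\<And>c. 0 < c \<Longrightarrow> c < \<delta> \<Longrightarrow> x - y \<le> c * k"
  shows "x \<le> y"
proof -
  have "\<forall>\<^sub>F c in at_right 0. x - y \<le> c * k"
    unfolding eventually_at_right_field using assms by blast
  moreover have "((\<lambda>c. c * k) \<longlongrightarrow> 0 * k) (at_right 0)"
    by (intro tendsto_intros)
  ultimately have "x - y \<le> 0 * k"
    using tendsto_lowerbound[of _ _ "at_right (0::real)"] by fastforce
  then show ?thesis by simp
qed

lemma positive_dirichlet_solutionD:
  assumes "positive_dirichlet_solution R a lam \<delta> w"
  shows "viscosity_supersolution (ball 0 R) (\<lambda>x s. - lam * a x * s ^ 3) w"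
    and "viscosity_subsolution (ball 0 R) (\<lambda>x s. - lam * a x * s ^ 3) w"
    and "continuous_on (cball 0 R) w"
    and "norm x = R \<Longrightarrow> w x = \<delta>"
    and "\<delta> > 0 \<Longrightarrow> norm x \<le> R \<Longrightarrow> w x > 0"
proof -
  note * = assms[unfolded positive_dirichlet_solution_def dirichlet_solution_def viscosity_solution_def]
  show "viscosity_supersolution (ball 0 R) (\<lambda>x s. - lam * a x * s ^ 3) w"
    "viscosity_subsolution (ball 0 R) (\<lambda>x s. - lam * a x * s ^ 3) w"
    "continuous_on (cball 0 R) w"
    using * by blast+
  have bdry: "w x = \<delta>" if "norm x = R" for x using * that by simp
  then show "norm x = R \<Longrightarrow> w x = \<delta>" .
  have "w x > 0" if "norm x < R" for x using * that by simp
  then show "\<delta> > 0 \<Longrightarrow> norm x \<le> R \<Longrightarrow> w x > 0"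
    using bdry[of x] by (cases "norm x = R") simp_all
qed

locale radial_weight =
  fixes a :: "real ^ 'n \<Rightarrow> real" and \<alpha> :: "real \<Rightarrow> real" and R :: real
  assumes R_pos: "R > 0"
    and cont_a: "continuous_on (ball 0 R) a"
    and bounded_a: "bounded (a ` ball 0 R)"
    and a_pos: "\<And>x. norm x < R \<Longrightarrow> a x > 0"
    and a_eq: "\<And>x. norm x < R \<Longrightarrow> a x = \<alpha> (norm x)"
begin

lemma weight_on_axis:
  assumes "0 \<le> r" "r < R"
  shows "norm (r *\<^sub>R axis undefined 1 :: real ^ 'n) = r" "\<alpha> r = a (r *\<^sub>R axis undefined 1)"
  using assms a_eq[of "r *\<^sub>R axis undefined 1"] by auto

lemma cont_profile: "continuous_on {0..<R} \<alpha>"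
proof (rule continuous_on_eq)
  show "continuous_on {0..<R} (\<lambda>r. a (r *\<^sub>R axis undefined 1))"
    by (rule continuous_on_compose2[OF cont_a]) (auto intro!: continuous_intros)
qed (simp add: weight_on_axis)

lemma profile_pos: "0 \<le> r \<Longrightarrow> r < R \<Longrightarrow> \<alpha> r > 0"
  using weight_on_axis[of r] a_pos[of "r *\<^sub>R axis undefined 1"] by simp

lemma profile_bounded: obtains M where "\<And>r. 0 \<le> r \<Longrightarrow> r < R \<Longrightarrow> \<alpha> r \<le> M"
proof -
  obtain M where M: "\<forall>y\<in>a ` ball 0 R. norm y \<le> M"
    using bounded_a unfolding bounded_iff by blast
  have "\<alpha> r \<le> M" if "0 \<le> r" "r < R" for r
    using bspec[OF M imageI, of "r *\<^sub>R axis undefined 1"] weight_on_axis[OF that] that by simp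
  then show thesis using that by blast
qed

lemma solution_continuous:
  assumes "solves_radial_integral_eq R \<alpha> lam m u"
  shows "continuous_on {0..R} u" "u 0 = m"
  using assms R_pos unfolding solves_radial_integral_eq_def
  by (auto intro: continuous_if_integral_eq)

lemma solution_profile:
  assumes "solves_radial_integral_eq R \<alpha> lam m u" "lam > 0"
    and "0 < \<rho>" "\<rho> \<le> R" "\<And>r. 0 \<le> r \<Longrightarrow> r < \<rho> \<Longrightarrow> u r > 0"
  shows "radial_profile \<rho> u (\<lambda>r. 3 * lam * integral {0..r} (\<lambda>s. \<alpha> s * u s ^ 3))
    (\<lambda>r. 3 * lam * (\<alpha> r * u r ^ 3))"
proof (rule radial_profile_if_integral_eq)
  show "continuous_on {0..<\<rho>} (\<lambda>s. \<alpha> s * u s ^ 3)"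
    using assms(4) by (intro continuous_intros continuous_on_subset[OF cont_profile]
        continuous_on_subset[OF solution_continuous(1)[OF assms(1)]]) auto
  show "0 < \<alpha> 0 * u 0 ^ 3" using profile_pos assms by simp
  show "0 \<le> \<alpha> s * u s ^ 3" if "0 \<le> s" "s < \<rho>" for s
    using profile_pos[of s] assms(4) assms(5)[of s] that by simp
qed (use assms in \<open>auto simp: solves_radial_integral_eq_def\<close>)

lemma positive_profile_is_dirichlet_solution:
  assumes prof: "radial_profile R u Z h"
    and h: "\<And>r. 0 \<le> r \<Longrightarrow> r < R \<Longrightarrow> h r = 3 * lam * (\<alpha> r * u r ^ 3)"
    and pos: "\<And>r. 0 \<le> r \<Longrightarrow> r < R \<Longrightarrow> u r > 0"
  shows "positive_dirichlet_solution R a lam (u R) (\<lambda>x. u (norm x))"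
  unfolding positive_dirichlet_solution_def dirichlet_solution_def
proof (intro conjI ballI)
  show "viscosity_solution (ball 0 R) (\<lambda>x s. - lam * a x * s ^ 3) (\<lambda>x. u (norm x))"
    by (rule radial_profile_viscosity_solution[OF prof]) (simp add: h a_eq)
qed (use pos radial_profile_continuous_on_cball[OF prof] in auto)

text \<open>On the ball up to its first zero, \<open>u\<close> would be a strict subsolution for the parameter \<open>lam'\<close> with zero
boundary values.  The comparison with the positive supersolution \<open>w\<close>, with constant \<open>K = 0\<close>, gives
\<open>u \<le> 0\<close> there.\<close>

lemma radial_solution_positive:
  assumes w: "viscosity_supersolution (ball 0 R) (\<lambda>x s. - lam' * a x * s ^ 3) w"
    and contw: "continuous_on (cball 0 R) w" and posw: "\<And>x. norm x \<le> R \<Longrightarrow> w x > 0"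
    and less: "lam < lam'"
    and u: "continuous_on {0..R} u" "u 0 > 0"
    and prof: "\<And>\<rho>. 0 < \<rho> \<Longrightarrow> \<rho> \<le> R \<Longrightarrow> (\<And>r. 0 \<le> r \<Longrightarrow> r < \<rho> \<Longrightarrow> u r > 0) \<Longrightarrow>
      \<exists>Z h. radial_profile \<rho> u Z h \<and> (\<forall>r\<in>{0..<\<rho>}. h r = 3 * lam * (\<alpha> r * u r ^ 3))"
    and r: "0 \<le> r" "r \<le> R"
  shows "u r > 0"
proof (rule ccontr)
  assume "\<not> u r > 0"
  then obtain \<rho> where \<rho>: "0 < \<rho>" "\<rho> \<le> R" "u \<rho> = 0" "\<And>s. 0 \<le> s \<Longrightarrow> s < \<rho> \<Longrightarrow> u s > 0"
    using first_zero_exists[OF u, of r] r by auto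
  obtain Z h where h: "radial_profile \<rho> u Z h" "\<And>r. r \<in> {0..<\<rho>} \<Longrightarrow> h r = 3 * lam * (\<alpha> r * u r ^ 3)"
    using prof[OF \<rho>(1,2,4)] by blast
  have "u (norm (0 :: real ^ 'n)) \<le> 0 * w 0"
  proof (rule strict_radial_subsolution_le[OF w cont_a \<rho>(2) _ _ h(1)])
    show "continuous_on (cball 0 \<rho>) w"
      using \<rho> by (auto intro: continuous_on_subset[OF contw])
    fix x :: "real ^ 'n" assume x: "norm x < \<rho>"
    then have "\<alpha> (norm x) * u (norm x) ^ 3 > 0" using profile_pos[of "norm x"] \<rho> by simp
    then have "lam * (\<alpha> (norm x) * u (norm x) ^ 3) < lam' * (\<alpha> (norm x) * u (norm x) ^ 3)"
      using less by (intro mult_strict_right_mono)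
    then show "h (norm x) < 3 * lam' * a x * u (norm x) ^ 3"
      using h(2)[of "norm x"] a_eq[of x] x \<rho> by simp
  qed (use posw \<rho> in auto)
  then show False using u by simp
qed

text \<open>Adding a constant \<open>c > 0\<close> to \<open>u\<close> leaves the left-hand side of the equation unchanged and makes it a strict
subsolution; subtracting \<open>c\<close> makes it a strict supersolution.  Comparison with \<open>w\<close> bounds \<open>w\<close> from
both sides by functions that tend to \<open>u\<close> as \<open>c\<close> tends to zero.\<close>

lemma dirichlet_solution_unique:
  assumes prof: "radial_profile R u Z h"
    and h: "\<And>r. 0 \<le> r \<Longrightarrow> r < R \<Longrightarrow> h r = 3 * lam * (\<alpha> r * u r ^ 3)"
    and lam: "lam > 0" and \<delta>: "u R > 0"
    and w: "positive_dirichlet_solution R a lam (u R) w"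
    and x: "norm x \<le> R"
  shows "w x = u (norm x)"
proof -
  let ?\<delta> = "u R"
  note super = positive_dirichlet_solutionD(1)[OF w] and sub = positive_dirichlet_solutionD(2)[OF w]
    and contw = positive_dirichlet_solutionD(3)[OF w] and bdry = positive_dirichlet_solutionD(4)[OF w]
    and posw = positive_dirichlet_solutionD(5)[OF w \<delta>]
  have u_ge: "u r \<ge> ?\<delta>" if "0 \<le> r" "r \<le> R" for r
    by (rule radial_profile_ge_boundary[OF prof that])
  have shifted: "radial_profile R (\<lambda>r. u r + c) Z h" for c
    using radial_profile_affine[OF prof, of 1 c] by simp
  have weight: "3 * lam * \<alpha> (norm x) > 0" if "norm x < R" for x :: "real ^ 'n"
    using profile_pos[of "norm x"] that lam by simp
  have "?\<delta> * u (norm x) \<le> ?\<delta> * w x"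
  proof (rule le_if_linear_perturbation_le[OF \<delta>, where k = "w x - ?\<delta>"])
    fix c assume c: "0 < c" "c < ?\<delta>"
    have "u (norm x) + c \<le> (?\<delta> + c) / ?\<delta> * w x"
    proof (rule strict_radial_subsolution_le[OF super cont_a order_refl contw posw shifted])
      fix y :: "real ^ 'n" assume y: "norm y < R"
      have "u (norm y) ^ 3 < (u (norm y) + c) ^ 3"
        using u_ge[of "norm y"] y c \<delta> by (intro power_strict_mono) auto
      then have "3 * lam * \<alpha> (norm y) * u (norm y) ^ 3 < 3 * lam * \<alpha> (norm y) * (u (norm y) + c) ^ 3"
        using weight[OF y] by (rule mult_strict_left_mono)
      then show "h (norm y) < 3 * lam * a y * (u (norm y) + c) ^ 3"
        using h[of "norm y"] a_eq[OF y] y by simp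
    qed (use c \<delta> bdry x in auto)
    then show "?\<delta> * u (norm x) - ?\<delta> * w x \<le> c * (w x - ?\<delta>)"
      using \<delta> by (simp add: field_simps)
  qed
  moreover have "?\<delta> * w x \<le> ?\<delta> * u (norm x)"
  proof (rule le_if_linear_perturbation_le[OF \<delta>, where k = "w x - ?\<delta>"])
    fix c assume c: "0 < c" "c < ?\<delta>"
    have "w x \<le> ?\<delta> / (?\<delta> - c) * (u (norm x) + - c)"
    proof (rule subsolution_le_strict_radial_supersolution[OF sub cont_a order_refl contw shifted])
      show "u r + - c > 0" if "0 \<le> r" "r \<le> R" for r
        using u_ge[OF that] c by simp
      fix y :: "real ^ 'n" assume y: "norm y < R"
      have "(u (norm y) + - c) ^ 3 < u (norm y) ^ 3"
        using u_ge[of "norm y"] y c \<delta> by (intro power_strict_mono) auto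
      then have "3 * lam * \<alpha> (norm y) * (u (norm y) + - c) ^ 3 < 3 * lam * \<alpha> (norm y) * u (norm y) ^ 3"
        using weight[OF y] by (rule mult_strict_left_mono)
      then show "3 * lam * a y * (u (norm y) + - c) ^ 3 < h (norm y)"
        using h[of "norm y"] a_eq[OF y] y by simp
    qed (use c \<delta> bdry x in auto)
    then show "?\<delta> * w x - ?\<delta> * u (norm x) \<le> c * (w x - ?\<delta>)"
      using c by (simp add: field_simps)
  qed
  ultimately show ?thesis using \<delta> by simp
qed

lemma truncated_solution:
  assumes lam: "lam > 0"
  obtains v Z h where "radial_profile R v Z h" "v 0 = 1"
    "\<And>r. h r = 3 * lam * (\<alpha> r * clip01 (v r) ^ 3)"
    "(\<And>r. 0 \<le> r \<Longrightarrow> r \<le> R \<Longrightarrow> 0 \<le> v r) \<Longrightarrow> solves_radial_integral_eq R \<alpha> lam 1 v"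
proof -
  obtain M where "\<And>r. 0 \<le> r \<Longrightarrow> r < R \<Longrightarrow> \<alpha> r \<le> M" using profile_bounded by blast
  then obtain v where v: "continuous_on {0..R} v"
    "\<And>t. t \<le> R \<Longrightarrow> (\<lambda>s. \<alpha> s * clip01 (v s) ^ 3) integrable_on {0..t}"
    "(\<lambda>t. root 3 (integral {0..t} (\<lambda>s. \<alpha> s * clip01 (v s) ^ 3))) integrable_on {0..R}"
    "\<And>r. r \<in> {0..R} \<Longrightarrow> v r = 1 - root 3 (3 * lam) *
       integral {0..r} (\<lambda>t. root 3 (integral {0..t} (\<lambda>s. \<alpha> s * clip01 (v s) ^ 3)))"
    using truncated_radial_equation_has_solution[OF R_pos lam cont_profile profile_pos] by blast
  let ?f = "\<lambda>s. \<alpha> s * clip01 (v s) ^ 3"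
  have v0: "v 0 = 1" using v(4)[of 0] R_pos by simp
  have prof: "radial_profile R v (\<lambda>r. 3 * lam * integral {0..r} ?f) (\<lambda>r. 3 * lam * ?f r)"
  proof (rule radial_profile_if_integral_eq[OF v(3,4) R_pos order_refl lam])
    show "continuous_on {0..<R} ?f"
      unfolding clip01_def
      by (intro continuous_intros cont_profile continuous_on_subset[OF v(1)]) auto
    show "0 < ?f 0" using profile_pos[of 0] R_pos by (simp add: v0 clip01_def)
    show "0 \<le> ?f s" if "0 \<le> s" "s < R" for s
      using profile_pos[OF that] clip01_bounds[of "v s"] by simp
  qed
  have "solves_radial_integral_eq R \<alpha> lam 1 v" if nonneg: "\<And>r. 0 \<le> r \<Longrightarrow> r \<le> R \<Longrightarrow> 0 \<le> v r"
  proof -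
    have clip: "clip01 (v r) = v r" if "r \<in> {0..R}" for r
      using radial_profile_le_center[OF prof, of r] nonneg[of r] that v0 by (simp add: clip01_def)
    have inner: "(\<lambda>s. \<alpha> s * v s ^ 3) integrable_on {0..t}" 
      "integral {0..t} ?f = integral {0..t} (\<lambda>s. \<alpha> s * v s ^ 3)" if "t \<in> {0..R}" for t
      using integrable_eq[OF v(2)[of t], of "\<lambda>s. \<alpha> s * v s ^ 3"] that
      by (auto intro!: integral_cong simp: clip)
    have "(\<lambda>t. root 3 (integral {0..t} (\<lambda>s. \<alpha> s * v s ^ 3))) integrable_on {0..R}"
      by (rule integrable_eq[OF v(3)]) (simp add: inner)
    moreover have "v r = 1 - root 3 (3 * lam) *
        integral {0..r} (\<lambda>t. root 3 (integral {0..t} (\<lambda>s. \<alpha> s * v s ^ 3)))" if r: "r \<in> {0..R}" for r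
    proof -
      have "integral {0..r} (\<lambda>t. root 3 (integral {0..t} ?f))
          = integral {0..r} (\<lambda>t. root 3 (integral {0..t} (\<lambda>s. \<alpha> s * v s ^ 3)))"
        by (rule integral_cong) (use inner(2) r in auto)
      then show ?thesis using v(4)[OF r] by simp
    qed
    ultimately show ?thesis
      using inner(1) unfolding solves_radial_integral_eq_def by blast
  qed
  then show thesis using that[OF prof v0] by blast
qed

text \<open>The same device of adding constants changes the parameter.  If \<open>v R < 0\<close>, then \<open>v - v R\<close> is a strict
subsolution with zero boundary values for some parameter below the eigenvalue, which is incompatible
with positive solutions for parameters close to the eigenvalue.  If \<open>v R > 0\<close>, then
\<open>v - v R / 2\<close> is a positive supersolution for some parameter above the eigenvalue, so the
truncated solution is positive up to the boundary for a parameter that is still too large.\<close>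

lemma eigenvalue_solution_vanishes_on_boundary:
  assumes lam: "lam > 0" and eig: "ereal lam = first_eigenvalue \<delta>\<^sub>0 R a" and \<delta>0: "\<delta>\<^sub>0 > 0"
    and prof: "radial_profile R v Z h" and v0: "v 0 = 1"
    and h: "\<And>r. h r = 3 * lam * (\<alpha> r * clip01 (v r) ^ 3)"
  shows "v R = 0"
proof (rule ccontr)
  let ?S = "{lam. lam \<ge> 0 \<and> (\<exists>w. positive_dirichlet_solution R a lam \<delta>\<^sub>0 w)}"
  have v_le: "v r \<le> 1" if "0 \<le> r" "r \<le> R" for r
    using radial_profile_le_center[OF prof that] v0 by simp
  assume "v R \<noteq> 0"
  then consider "v R < 0" | "v R > 0" by linarith
  then show False
  proof cases
    case 1
    define c where "c = - v R"
    have c: "c > 0" using 1 by (simp add: c_def)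
    have "1 < (1 + c) ^ 3" using c by (intro one_less_power) auto
    then have "lam * 1 < lam * (1 + c) ^ 3" using lam by (intro mult_strict_left_mono)
    then have "lam / (1 + c) ^ 3 < lam" using c by (subst divide_less_eq) auto
    then have "ereal (lam / (1 + c) ^ 3) < ereal lam" by simp
    then have "ereal (lam / (1 + c) ^ 3) < (SUP lam\<in>?S. ereal lam)"
      unfolding eig first_eigenvalue_def .
    then obtain lam' w where lam': "lam / (1 + c) ^ 3 < lam'"
      and w: "positive_dirichlet_solution R a lam' \<delta>\<^sub>0 w"
      unfolding less_SUP_iff by auto
    note super = positive_dirichlet_solutionD(1)[OF w] and contw = positive_dirichlet_solutionD(3)[OF w]
      and posw = positive_dirichlet_solutionD(5)[OF w \<delta>0]
    have "radial_profile R (\<lambda>r. v r + c) Z h"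
      using radial_profile_affine[OF prof, of 1 c] by simp
    have "v 0 + c \<le> 0"
    proof -
      have strict: "h (norm x) < 3 * lam' * a x * (v (norm x) + c) ^ 3"
        if x: "norm x < R" and p: "v (norm x) + c > 0" for x :: "real ^ 'n"
      proof -
        let ?v = "v (norm x)"
        \<comment> \<open>since \<open>v \<le> 1\<close>, adding \<open>c\<close> enlarges \<open>v\<close> at least by the factor \<open>1 + c\<close>\<close>
        have "clip01 ?v * (1 + c) \<le> ?v + c"
        proof (cases "?v \<ge> 0")
          case True
          then have "clip01 ?v = ?v" "?v * c \<le> 1 * c"
            using v_le[of "norm x"] x c by (auto simp: clip01_def intro: mult_right_mono)
          then show ?thesis by (simp add: algebra_simps)
        qed (use p in \<open>simp add: clip01_def\<close>)
        then have "(clip01 ?v * (1 + c)) ^ 3 \<le> (?v + c) ^ 3"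
          using clip01_bounds c by (intro power_mono) auto
        then have "lam / (1 + c) ^ 3 * (clip01 ?v * (1 + c)) ^ 3 \<le> lam / (1 + c) ^ 3 * (?v + c) ^ 3"
          using lam c by (intro mult_left_mono) auto
        also have "\<dots> < lam' * (?v + c) ^ 3"
          using lam' p by (intro mult_strict_right_mono) auto
        finally have "lam * clip01 ?v ^ 3 < lam' * (?v + c) ^ 3"
          using c by (simp add: power_mult_distrib)
        then have "\<alpha> (norm x) * (lam * clip01 ?v ^ 3) < \<alpha> (norm x) * (lam' * (?v + c) ^ 3)"
          using profile_pos[of "norm x"] x by simp
        then show ?thesis using a_eq[OF x] by (simp add: h mult_ac)
      qed
      show ?thesis
        using strict_radial_subsolution_le[OF super cont_a order_refl contw posw
            \<open>radial_profile R (\<lambda>r. v r + c) Z h\<close> strict, where K = 0 and x = 0] R_pos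
        by (simp add: c_def)
    qed
    then show False using v0 c by simp
  next
    case 2
    define c where "c = v R / 2"
    have c: "0 < c" "c < 1" "c < v R" using 2 v_le[of R] R_pos by (auto simp: c_def)
    have v_ge: "v r \<ge> v R" if "0 \<le> r" "r \<le> R" for r
      by (rule radial_profile_ge_boundary[OF prof that])
    define lam' where "lam' = lam / (1 - c) ^ 3"
    have "(1 - c) ^ 3 < 1" using c by (simp add: power_less_one_iff)
    then have "lam < lam'" using lam c by (simp add: lam'_def field_simps)
    \<comment> \<open>a parameter strictly in between makes the comparison strict\<close>
    then obtain lam'' where lam'': "lam < lam''" "lam'' < lam'" using dense by blast
    have prof': "radial_profile R (\<lambda>r. v r + - c) Z h"
      using radial_profile_affine[OF prof, of 1 "- c"] by simp
    have "viscosity_solution (ball 0 R) (\<lambda>x s. - h (norm x) / 3) (\<lambda>x::real^'n. v (norm x) + - c)"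
      by (rule radial_profile_viscosity_solution[OF prof']) simp
    then have "viscosity_supersolution (ball 0 R) (\<lambda>x s. - h (norm x) / 3) (\<lambda>x::real^'n. v (norm x) + - c)"
      by (simp add: viscosity_solution_def)
    then have super: "viscosity_supersolution (ball 0 R) (\<lambda>x s. - lam' * a x * s ^ 3) (\<lambda>x. v (norm x) + - c)"
    proof (rule viscosity_supersolution_mono)
      fix x :: "real ^ 'n" assume "x \<in> ball 0 R"
      then have x: "norm x < R" by simp
      let ?v = "v (norm x)"
      have v: "c < ?v" "?v \<le> 1" using v_ge[of "norm x"] v_le[of "norm x"] x c by auto
      \<comment> \<open>since \<open>v \<le> 1\<close>, subtracting \<open>c\<close> shrinks \<open>v\<close> at least by the factor \<open>1 - c\<close>\<close>
      then have "?v * c \<le> 1 * c" using c by (intro mult_right_mono) auto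
      then have "?v - c \<le> ?v * (1 - c)" by (simp add: algebra_simps)
      then have "(?v - c) ^ 3 \<le> (?v * (1 - c)) ^ 3" using v by (intro power_mono) auto
      then have "lam' * (?v - c) ^ 3 \<le> lam' * (?v * (1 - c)) ^ 3"
        using \<open>lam < lam'\<close> lam by (intro mult_left_mono) auto
      also have "\<dots> = lam * ?v ^ 3" using c by (simp add: lam'_def power_mult_distrib)
      finally have "\<alpha> (norm x) * (lam' * (?v - c) ^ 3) \<le> \<alpha> (norm x) * (lam * ?v ^ 3)"
        using profile_pos[of "norm x"] x by (intro mult_left_mono) auto
      moreover have "clip01 ?v = ?v" using v c by (simp add: clip01_def)
      ultimately show "- h (norm x) / 3 \<le> - lam' * a x * (?v + - c) ^ 3"
        using a_eq[OF x] by (simp add: h mult_ac)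
    qed
    obtain v2 Z2 h2 where v2: "radial_profile R v2 Z2 h2" "v2 0 = 1"
      "\<And>r. h2 r = 3 * lam'' * (\<alpha> r * clip01 (v2 r) ^ 3)"
      "(\<And>r. 0 \<le> r \<Longrightarrow> r \<le> R \<Longrightarrow> 0 \<le> v2 r) \<Longrightarrow> solves_radial_integral_eq R \<alpha> lam'' 1 v2"
      using truncated_solution[OF less_trans[OF lam lam''(1)]] by blast
    have pos: "v2 r > 0" if "0 \<le> r" "r \<le> R" for r
    proof (rule radial_solution_positive[OF super _ _ lam''(2) _ _ _ that])
      show "continuous_on {0..R} v2" "v2 0 > 0" using v2 by (auto simp: radial_profile_def)
      show "continuous_on (cball 0 R) (\<lambda>x::real^'n. v (norm x) + - c)"
        by (rule radial_profile_continuous_on_cball[OF prof'])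
      show "v (norm x) + - c > 0" if "norm x \<le> R" for x :: "real ^ 'n"
        using v_ge[of "norm x"] c that by simp
      fix \<rho> assume \<rho>: "0 < \<rho>" "\<rho> \<le> R" "\<And>r. 0 \<le> r \<Longrightarrow> r < \<rho> \<Longrightarrow> v2 r > 0"
      have "radial_profile \<rho> v2 Z2 h2"
        using v2(1) \<rho>(1,2) unfolding radial_profile_def
        by (auto elim: continuous_on_subset)
      moreover have "clip01 (v2 r) = v2 r" if "0 \<le> r" "r < \<rho>" for r
        using radial_profile_le_center[OF v2(1), of r] \<rho>(2) \<rho>(3)[OF that] that v2(2)
        by (simp add: clip01_def)
      ultimately show "\<exists>Z h. radial_profile \<rho> v2 Z h \<and> (\<forall>r\<in>{0..<\<rho>}. h r = 3 * lam'' * (\<alpha> r * v2 r ^ 3))"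
        by (intro exI[of _ Z2] exI[of _ h2]) (simp add: v2(3))
    qed
    define \<theta> where "\<theta> = \<delta>\<^sub>0 / v2 R"
    have \<theta>: "\<theta> > 0" using \<delta>0 pos[of R] R_pos by (simp add: \<theta>_def)
    have "positive_dirichlet_solution R a lam'' (\<theta> * (v2 R + 0)) (\<lambda>x. \<theta> * (v2 (norm x) + 0))"
    proof (rule positive_profile_is_dirichlet_solution[OF radial_profile_affine[OF v2(1) \<theta>]])
      fix r assume r: "0 \<le> r" "r < R"
      then have "clip01 (v2 r) = v2 r"
        using radial_profile_le_center[OF v2(1), of r] pos[of r] v2(2) by (simp add: clip01_def)
      then show "\<theta> ^ 3 * h2 r = 3 * lam'' * (\<alpha> r * (\<theta> * (v2 r + 0)) ^ 3)"
        by (simp add: v2(3) power_mult_distrib)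
      show "\<theta> * (v2 r + 0) > 0" using \<theta> pos[of r] r by simp
    qed
    moreover have "\<theta> * (v2 R + 0) = \<delta>\<^sub>0" using pos[of R] R_pos by (simp add: \<theta>_def)
    ultimately have "lam'' \<in> ?S" using lam lam'' by auto
    then have "ereal lam'' \<le> ereal lam"
      unfolding eig first_eigenvalue_def by (rule SUP_upper)
    then show False using lam'' by simp
  qed
qed

lemma first_eigenfunction_exists:
  assumes lam: "lam > 0" and eig: "ereal lam = first_eigenvalue \<delta>\<^sub>0 R a" and \<delta>0: "\<delta>\<^sub>0 > 0"
  shows "\<exists>v. solves_radial_integral_eq R \<alpha> lam 1 v \<and> v R = 0 \<and> (\<forall>r\<in>{0..<R}. v r > 0) \<and>
    positive_dirichlet_solution R a lam 0 (\<lambda>x. v (norm x))"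
proof -
  obtain v Z h where v: "radial_profile R v Z h" "v 0 = 1"
    "\<And>r. h r = 3 * lam * (\<alpha> r * clip01 (v r) ^ 3)"
    "(\<And>r. 0 \<le> r \<Longrightarrow> r \<le> R \<Longrightarrow> 0 \<le> v r) \<Longrightarrow> solves_radial_integral_eq R \<alpha> lam 1 v"
    using truncated_solution[OF lam] by blast
  have vR: "v R = 0"
    by (rule eigenvalue_solution_vanishes_on_boundary[OF lam eig \<delta>0 v(1-3)])
  have pos: "v r > 0" if "0 \<le> r" "r < R" for r
    using radial_profile_strictly_decreasing[OF v(1) that] vR by simp
  have "0 \<le> v r" if "0 \<le> r" "r \<le> R" for r
    using pos[of r] vR that by (cases "r = R") auto
  moreover have "h r = 3 * lam * (\<alpha> r * v r ^ 3)" if "0 \<le> r" "r < R" for r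
    using pos[OF that] radial_profile_le_center[OF v(1), of r] v(2,3) that by (simp add: clip01_def)
  then have "positive_dirichlet_solution R a lam (v R) (\<lambda>x. v (norm x))"
    by (rule positive_profile_is_dirichlet_solution[OF v(1) _ pos])
  ultimately show ?thesis using v(4) vR pos by auto
qed

lemma subcritical_radial_solution:
  assumes lam: "lam > 0" and sub: "ereal lam < first_eigenvalue \<delta>\<^sub>0 R a" and \<delta>0: "\<delta>\<^sub>0 > 0"
    and u: "solves_radial_integral_eq R \<alpha> lam m u" and m: "m > 0"
  shows "0 \<le> r \<Longrightarrow> r \<le> R \<Longrightarrow> u r > 0"
    and "positive_dirichlet_solution R a lam (u R) (\<lambda>x. u (norm x))"
    and "positive_dirichlet_solution R a lam (u R) w \<Longrightarrow> norm x \<le> R \<Longrightarrow> w x = u (norm x)"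
proof -
  obtain lam' w' where lam': "lam < lam'" and w': "positive_dirichlet_solution R a lam' \<delta>\<^sub>0 w'"
    using sub unfolding first_eigenvalue_def less_SUP_iff by auto
  note super = positive_dirichlet_solutionD(1)[OF w'] and contw = positive_dirichlet_solutionD(3)[OF w']
    and posw = positive_dirichlet_solutionD(5)[OF w' \<delta>0]
  have pos: "u r > 0" if "0 \<le> r" "r \<le> R" for r
  proof (rule radial_solution_positive[OF super contw posw lam' _ _ _ that])
    fix \<rho> assume "0 < \<rho>" "\<rho> \<le> R" "\<And>r. 0 \<le> r \<Longrightarrow> r < \<rho> \<Longrightarrow> u r > 0"
    then show "\<exists>Z h. radial_profile \<rho> u Z h \<and> (\<forall>r\<in>{0..<\<rho>}. h r = 3 * lam * (\<alpha> r * u r ^ 3))"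
      using solution_profile[OF u lam] by blast
  qed (use solution_continuous[OF u] m in auto)
  then show "0 \<le> r \<Longrightarrow> r \<le> R \<Longrightarrow> u r > 0" .
  have prof: "radial_profile R u (\<lambda>r. 3 * lam * integral {0..r} (\<lambda>s. \<alpha> s * u s ^ 3))
      (\<lambda>r. 3 * lam * (\<alpha> r * u r ^ 3))"
    by (rule solution_profile[OF u lam R_pos order_refl]) (use pos in auto)
  show "positive_dirichlet_solution R a lam (u R) (\<lambda>x. u (norm x))"
    by (rule positive_profile_is_dirichlet_solution[OF prof refl]) (use pos in auto)
  show "positive_dirichlet_solution R a lam (u R) w \<Longrightarrow> norm x \<le> R \<Longrightarrow> w x = u (norm x)"
    using dirichlet_solution_unique[OF prof refl lam] pos[of R] R_pos by simp
qed

end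

section \<open>Constant weight\<close>

lemma quartic_bounds:
  fixes s :: real
  assumes "0 \<le> s" "s < 1"
  shows "1 - s \<le> 1 - s ^ 4" "0 < 1 - s ^ 4"
proof -
  have "s ^ 4 \<le> s ^ 1" by (rule power_decreasing) (use assms in auto)
  then show "1 - s \<le> 1 - s ^ 4" by simp
  then show "0 < 1 - s ^ 4" using assms by simp
qed

text \<open>The singularity at \<open>1\<close> is dominated by \<open>(1 - s) powr - (1/4)\<close>, because \<open>1 - s\<^sup>4 \<ge> 1 - s\<close>.\<close>

lemma F_integrand_integrable: "(\<lambda>s. 1 / root 4 (1 - s ^ 4)) integrable_on {0..1::real}"
proof -
  let ?g = "\<lambda>s::real. (1 - s) powr - (1/4)"
  have "((\<lambda>s. ?g s) has_integral (- (4/3) * (1 - 1) powr (3/4)) - (- (4/3) * (1 - 0) powr (3/4))) {0..1::real}"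
  proof (rule fundamental_theorem_of_calculus_interior)
    show "continuous_on {0..1::real} (\<lambda>s. - (4/3) * (1 - s) powr (3/4))"
      by (intro continuous_on_mult continuous_on_const continuous_on_powr') (auto intro!: continuous_intros)
    fix x :: real assume "x \<in> {0<..<1}"
    then have "((\<lambda>s. - (4/3) * (1 - s) powr (3/4)) has_real_derivative ?g x) (at x)"
      by (auto intro!: derivative_eq_intros)
    then show "((\<lambda>s. - (4/3) * (1 - s) powr (3/4)) has_vector_derivative ?g x) (at x)"
      by (simp add: has_real_derivative_iff_has_vector_derivative)
  qed simp
  then have "?g integrable_on {0..1}" by blast
  then have g: "?g integrable_on {0..<1}"
    by (rule integrable_spike_set) (auto intro: negligible_subset[of "{1}"])
  have "continuous_on {0..<1} (\<lambda>s::real. 1 / root 4 (1 - s ^ 4))"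
    using quartic_bounds(2) by (intro continuous_intros) force
  then have "(\<lambda>s::real. 1 / root 4 (1 - s ^ 4)) \<in> borel_measurable (lebesgue_on {0..<1})"
    by (rule continuous_imp_measurable_on_sets_lebesgue) auto
  then have "(\<lambda>s. 1 / root 4 (1 - s ^ 4)) integrable_on {0..<1::real}"
  proof (rule measurable_bounded_by_integrable_imp_integrable[OF _ g])
    fix s :: real assume "s \<in> {0..<1}"
    then have s: "0 \<le> s" "s < 1" by auto
    have "root 4 (1 - s) \<le> root 4 (1 - s ^ 4)" "root 4 (1 - s) > 0"
      using quartic_bounds[OF s] s by auto
    moreover have "root 4 (1 - s) = (1 - s) powr (1/4)"
      using s by (simp add: root_powr_inverse)
    ultimately show "norm (1 / root 4 (1 - s ^ 4)) \<le> ?g s"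
      by (simp add: powr_minus_divide frac_le)
  qed simp
  then show ?thesis
    by (rule integrable_spike_set) (auto intro: negligible_subset[of "{1}"])
qed

lemma F_one: "F 1 = 0"
  by (simp add: F_def)

lemma F_continuous: "continuous_on {0..1} F"
  unfolding F_def[abs_def] by (rule indefinite_integral_continuous_1'[OF F_integrand_integrable])

lemma F_has_derivative:
  assumes "0 < t" "t < 1"
  shows "(F has_real_derivative - (1 / root 4 (1 - t ^ 4))) (at t)"
proof -
  let ?g = "\<lambda>s::real. 1 / root 4 (1 - s ^ 4)"
  have "continuous_on {0..<1} ?g"
    using quartic_bounds(2) by (intro continuous_intros) force
  from integral_has_derivative_interior[OF this assms]
  have "((\<lambda>x. integral {0..1} ?g - integral {0..x} ?g) has_real_derivative - ?g t) (at t)"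
    by (auto intro!: derivative_eq_intros)
  moreover have "\<forall>\<^sub>F x in nhds t. x \<in> {0<..<1}"
    using assms by (intro eventually_nhds_in_open) auto
  then have "\<forall>\<^sub>F x in nhds t. F x = integral {0..1} ?g - integral {0..x} ?g"
  proof eventually_elim
    case (elim x)
    have "integral {0..x} ?g + integral {x..1} ?g = integral {0..1} ?g"
      by (rule Henstock_Kurzweil_Integration.integral_combine[OF _ _ F_integrand_integrable]) (use elim in auto)
    then show ?case by (simp add: F_def)
  qed
  ultimately show ?thesis
    by (simp add: DERIV_cong_ev[OF refl _ refl])
qed

lemma F_strictly_decreasing:
  assumes "0 \<le> s" "s < t" "t \<le> 1"
  shows "F t < F s"
proof (rule DERIV_neg_imp_decreasing_open[OF assms(2)])
  show "continuous_on {s..t} F"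
    using assms by (auto intro: continuous_on_subset[OF F_continuous])
  fix x assume "s < x" "x < t"
  then show "\<exists>y. (F has_real_derivative y) (at x) \<and> y < 0"
    using F_has_derivative[of x] quartic_bounds(2)[of x] assms
    by (intro exI[of _ "- (1 / root 4 (1 - x ^ 4))"]) auto
qed

lemma root4_homogeneous:
  assumes "m > 0"
  shows "root 4 (m ^ 4 - x ^ 4) = m * root 4 (1 - (x / m) ^ 4)"
proof -
  have "m ^ 4 - x ^ 4 = m ^ 4 * (1 - (x / m) ^ 4)"
    using assms by (simp add: power_divide field_simps)
  then show ?thesis
    using assms by (simp add: real_root_mult real_root_power_cancel)
qed

text \<open>The function \<open>u / m\<close> is the inverse of \<open>F\<close> composed with a linear map.  The inverse function rule
gives the first integral \<open>u' = - \<kappa> (m\<^sup>4 - u\<^sup>4)\<^sup>1\<^sup>/\<^sup>4\<close> of the equation, and one more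
differentiation gives the equation itself.\<close>

lemma radial_profile_if_F_equation:
  assumes R: "R > 0" and m: "m > 0" and \<kappa>: "\<kappa> > 0"
    and u: "\<And>r. r \<in> {0..R} \<Longrightarrow> 0 \<le> u r \<and> u r \<le> m \<and> F (u r / m) = \<kappa> * r"
  shows "u 0 = m" and "\<And>r. 0 \<le> r \<Longrightarrow> r < R \<Longrightarrow> u r > 0"
    and "radial_profile R u (\<lambda>r. (\<kappa> * root 4 (m ^ 4 - u r ^ 4)) ^ 3) (\<lambda>r. 3 * (\<kappa> ^ 4 * u r ^ 3))"
proof -
  define y where "y = (\<lambda>r. u r / m)"
  have y01: "0 \<le> y r" "y r \<le> 1" "F (y r) = \<kappa> * r" if "r \<in> {0..R}" for r
    using u[OF that] m by (auto simp: y_def)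
  have u_eq: "u = (\<lambda>r. m * y r)" using m by (simp add: y_def)
  then have u_y: "u r = m * y r" for r by simp
  have y0: "y 0 = 1"
  proof (rule ccontr)
    assume "y 0 \<noteq> 1"
    then have "F 1 < F (y 0)" using y01[of 0] R by (intro F_strictly_decreasing) auto
    then show False using y01(3)[of 0] R F_one by simp
  qed
  then show u0: "u 0 = m" by (simp add: u_y)
  have y_lt: "y r < 1" if "0 < r" "r \<le> R" for r
  proof (rule ccontr)
    assume "\<not> y r < 1"
    then have "y r = 1" using y01(2)[of r] that by simp
    then show False using y01(3)[of r] that \<kappa> F_one by simp
  qed
  have y_pos: "y r > 0" if "0 \<le> r" "r < R" for r
  proof (rule ccontr)
    assume "\<not> y r > 0"
    then have "y r = 0" using y01(1)[of r] that by simp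
    then have "F (y R) \<le> F (y r)"
      using y01(1,2)[of R] R F_strictly_decreasing[of 0 "y R"] by (cases "y R = 0") auto
    then show False using y01(3)[of R] y01(3)[of r] that \<kappa> by simp
  qed
  then show u_pos: "u r > 0" if "0 \<le> r" "r < R" for r
    using that m by (simp add: u_y)
  have inj: "inj_on F {0..1}"
    by (rule linorder_inj_onI) (use F_strictly_decreasing in \<open>force+\<close>)
  have "continuous_on (F ` {0..1}) (the_inv_into {0..1} F)"
    by (rule continuous_on_inv_into[OF F_continuous compact_Icc inj])
  then have conty: "continuous_on {0..R} y"
  proof -
    have "continuous_on {0..R} (\<lambda>r. the_inv_into {0..1} F (\<kappa> * r))"
      by (rule continuous_on_compose2[OF \<open>continuous_on (F ` {0..1}) _\<close>])
         (use y01 in \<open>force intro!: continuous_intros\<close>)+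
    then show ?thesis
      by (rule continuous_on_eq) (metis y01 atLeastAtMost_iff inj the_inv_into_f_f)
  qed
  have contu: "continuous_on {0..R} u"
    unfolding u_eq by (intro continuous_intros conty)
  have dy: "(y has_real_derivative - \<kappa> * root 4 (1 - y r ^ 4)) (at r)" if r: "0 < r" "r < R" for r
  proof -
    have yr: "0 < y r" "y r < 1" using y_pos[of r] y_lt[of r] r by auto
    have "((\<lambda>t. F t / \<kappa>) has_real_derivative - (1 / root 4 (1 - y r ^ 4)) / \<kappa>) (at (y r))"
      by (intro DERIV_cdivide F_has_derivative yr)
    moreover have "isCont y r"
      using conty r by (intro continuous_on_interior[of "{0..R}"]) auto
    ultimately have "(y has_real_derivative inverse (- (1 / root 4 (1 - y r ^ 4)) / \<kappa>)) (at r)"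
      using quartic_bounds(2)[of "y r"] yr \<kappa> y01(3)
      by (intro DERIV_inverse_function[where f = "\<lambda>t. F t / \<kappa>" and g = y and a = 0 and b = R] r) auto
    then show ?thesis by (simp add: mult.commute)
  qed
  define q where "q = (\<lambda>r. root 4 (m ^ 4 - u r ^ 4))"
  have q_y: "q r = m * root 4 (1 - y r ^ 4)" for r
    unfolding q_def y_def by (rule root4_homogeneous[OF m])
  have q_pos: "q r > 0" if "0 < r" "r < R" for r
    using quartic_bounds(2)[of "y r"] y_pos[of r] y_lt[of r] that m by (simp add: q_y)
  have q4: "q r ^ 4 = m ^ 4 - u r ^ 4" if "0 < r" "r < R" for r
    using q_pos[OF that] unfolding q_def by (intro real_root_pow_pos2) auto
  have du: "(u has_real_derivative - (\<kappa> * q r)) (at r)" if r: "0 < r" "r < R" for r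
  proof -
    have "((\<lambda>r. m * y r) has_real_derivative - (\<kappa> * q r)) (at r)"
      using DERIV_cmult[OF dy[OF r], of m] by (simp add: q_y mult_ac)
    then show ?thesis unfolding u_eq[symmetric] .
  qed
  have dq: "((\<lambda>r. (\<kappa> * q r) ^ 3) has_real_derivative 3 * (\<kappa> ^ 4 * u r ^ 3)) (at r)"
    if r: "0 < r" "r < R" for r
  proof -
    have pos: "m ^ 4 - u r ^ 4 > 0" using q4[OF r] q_pos[OF r] by (metis zero_less_power)
    have "((\<lambda>r. m ^ 4 - u r ^ 4) has_real_derivative 4 * u r ^ 3 * (\<kappa> * q r)) (at r)"
      using du[OF r] by (auto intro!: derivative_eq_intros)
    from DERIV_chain2[OF DERIV_real_root[of 4 "m ^ 4 - u r ^ 4"] this]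
    have "(q has_real_derivative inverse (4 * q r ^ 3) * (4 * u r ^ 3 * (\<kappa> * q r))) (at r)"
      using pos by (simp add: q_def)
    also have "inverse (4 * q r ^ 3) * (4 * u r ^ 3 * (\<kappa> * q r)) = \<kappa> * u r ^ 3 / (q r)\<^sup>2"
      using q_pos[OF r] by (simp add: field_simps power2_eq_square power3_eq_cube)
    finally have "((\<lambda>r. (\<kappa> * q r) ^ 3) has_real_derivative
        3 * (\<kappa> * q r)\<^sup>2 * (\<kappa> * (\<kappa> * u r ^ 3 / (q r)\<^sup>2))) (at r)"
      by (auto intro!: derivative_eq_intros simp: power2_eq_square)
    then show ?thesis
      using q_pos[OF r] by (simp add: power2_eq_square power4_eq_xxxx mult_ac)
  qed
  have "root 3 ((\<kappa> * q r) ^ 3) = \<kappa> * q r" if "0 < r" "r < R" for r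
    using q_pos[OF that] \<kappa> by (simp add: real_root_power_cancel)
  then have "radial_profile R u (\<lambda>r. (\<kappa> * q r) ^ 3) (\<lambda>r. 3 * (\<kappa> ^ 4 * u r ^ 3))"
    unfolding radial_profile_def
    using R contu du dq q_pos \<kappa> m u0
    by (auto intro!: continuous_intros continuous_on_subset[OF contu] simp: q_def)
  then show "radial_profile R u (\<lambda>r. (\<kappa> * root 4 (m ^ 4 - u r ^ 4)) ^ 3) (\<lambda>r. 3 * (\<kappa> ^ 4 * u r ^ 3))"
    by (simp add: q_def)
qed

text \<open>The energy \<open>u'\<^sup>4 + \<kappa>\<^sup>4 u\<^sup>4\<close> is conserved.  Solving for \<open>u'\<close> separates the variables,
and \<open>F (u / m)\<close> turns out to have constant derivative \<open>\<kappa>\<close>.\<close>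

lemma F_equation_if_radial_profile:
  assumes prof: "radial_profile R u Z h" and \<kappa>: "\<kappa> > 0" and m: "m > 0" and u0: "u 0 = m"
    and h: "\<And>r. 0 \<le> r \<Longrightarrow> r < R \<Longrightarrow> h r = 3 * (\<kappa> ^ 4 * u r ^ 3)"
    and pos: "\<And>r. 0 \<le> r \<Longrightarrow> r < R \<Longrightarrow> u r > 0"
    and r: "0 \<le> r" "r \<le> R"
  shows "F (u r / m) = \<kappa> * r"
proof -
  have contu: "continuous_on {0..R} u" and contZ: "continuous_on {0..<R} Z" and Z0: "Z 0 = 0"
    and R: "R > 0"
    and der: "\<And>r. 0 < r \<Longrightarrow> r < R \<Longrightarrow> (u has_real_derivative - root 3 (Z r)) (at r)"
             "\<And>r. 0 < r \<Longrightarrow> r < R \<Longrightarrow> (Z has_real_derivative h r) (at r)"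
             "\<And>r. 0 < r \<Longrightarrow> r < R \<Longrightarrow> Z r > 0"
    using prof by (auto simp: radial_profile_def)
  have uR: "u R \<ge> 0"
  proof -
    have "continuous_on (closure {0..<R}) u" using contu R by simp
    then show ?thesis
      by (rule continuous_ge_on_closure[of _ _ R]) (use R pos in \<open>auto intro: less_imp_le\<close>)
  qed
  have u_range: "0 \<le> u s / m" "u s / m \<le> 1" if "0 \<le> s" "s \<le> R" for s
  proof -
    have "u s \<ge> 0" using radial_profile_ge_boundary[OF prof that] uR by simp
    then show "0 \<le> u s / m" using m by simp
    show "u s / m \<le> 1" using radial_profile_le_center[OF prof that] m by (simp add: u0)
  qed
  have energy: "root 3 (Z s) = \<kappa> * root 4 (m ^ 4 - u s ^ 4)" if s: "0 < s" "s < R" for s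
  proof -
    let ?E = "\<lambda>s. root 3 (Z s) ^ 4 + \<kappa> ^ 4 * u s ^ 4"
    have "?E s = ?E 0"
    proof (rule DERIV_isconst_end[OF s(1)])
      show "continuous_on {0..s} ?E"
        using s by (intro continuous_intros continuous_on_subset[OF contu] continuous_on_subset[OF contZ]) auto
      fix x assume "0 < x" "x < s"
      then have x: "0 < x" "x < R" using s by auto
      have p: "root 3 (Z x) > 0" using der(3)[OF x] by simp
      have "((\<lambda>x. root 3 (Z x)) has_real_derivative inverse (3 * (root 3 (Z x))\<^sup>2) * h x) (at x)"
        using DERIV_chain2[OF DERIV_real_root[of 3 "Z x"] der(2)[OF x]] der(3)[OF x]
        by (simp add: numeral_2_eq_2)
      then have "(?E has_real_derivative
          of_nat 4 * (inverse (3 * (root 3 (Z x))\<^sup>2) * h x * root 3 (Z x) ^ (4 - Suc 0))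
          + \<kappa> ^ 4 * (of_nat 4 * (- root 3 (Z x) * u x ^ (4 - Suc 0)))) (at x)"
        by (intro DERIV_add DERIV_cmult DERIV_power der(1)[OF x])
      moreover have "of_nat 4 * (inverse (3 * (root 3 (Z x))\<^sup>2) * h x * root 3 (Z x) ^ (4 - Suc 0))
          + \<kappa> ^ 4 * (of_nat 4 * (- root 3 (Z x) * u x ^ (4 - Suc 0))) = 0"
        using p h[of x] x by (simp add: field_simps power2_eq_square power3_eq_cube)
      ultimately show "(?E has_real_derivative 0) (at x)" by (rule DERIV_cong)
    qed
    then have "root 3 (Z s) ^ 4 = \<kappa> ^ 4 * (m ^ 4 - u s ^ 4)"
      by (simp add: Z0 u0 algebra_simps)
    then have "root 4 (root 3 (Z s) ^ 4) = root 4 (\<kappa> ^ 4 * (m ^ 4 - u s ^ 4))" by simp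
    then show ?thesis
      using der(3)[OF s] \<kappa> by (simp add: real_root_mult real_root_power_cancel)
  qed
  have contF: "continuous_on {0..R} (\<lambda>s. F (u s / m))"
    by (rule continuous_on_compose2[OF F_continuous])
       (use u_range m in \<open>auto intro!: continuous_intros contu\<close>)
  show ?thesis
  proof (cases "r = 0")
    case True
    then show ?thesis using u0 m F_one by simp
  next
    case False
    then have r0: "0 < r" using r by simp
    have "F (u r / m) - \<kappa> * r = F (u 0 / m) - \<kappa> * 0"
    proof (rule DERIV_isconst_end[OF r0])
      show "continuous_on {0..r} (\<lambda>s. F (u s / m) - \<kappa> * s)"
        using r by (intro continuous_intros continuous_on_subset[OF contF]) auto
      fix s assume "0 < s" "s < r"
      then have s: "0 < s" "s < R" using r by auto
      have y: "0 < u s / m" "u s / m < 1"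
        using pos[of s] s m radial_profile_strictly_decreasing[OF prof, of 0 s] by (auto simp: u0)
      have "((\<lambda>s. u s / m) has_real_derivative - root 3 (Z s) / m) (at s)"
        by (intro DERIV_cdivide der s)
      from DERIV_chain2[OF F_has_derivative[OF y] this]
      have "((\<lambda>s. F (u s / m)) has_real_derivative
          - (1 / root 4 (1 - (u s / m) ^ 4)) * (- root 3 (Z s) / m)) (at s)" .
      moreover have "- (1 / root 4 (1 - (u s / m) ^ 4)) * (- root 3 (Z s) / m) = \<kappa>"
        using quartic_bounds(2)[of "u s / m"] y m
        unfolding energy[OF s] root4_homogeneous[OF m] by simp
      ultimately show "((\<lambda>s. F (u s / m) - \<kappa> * s) has_real_derivative 0) (at s)"
        by (auto intro!: derivative_eq_intros)
    qed
    then show ?thesis using u0 m F_one by simp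
  qed
qed

text \<open>What remains is to match the parts: for a constant weight \<open>k\<close> the parameter \<open>\<kappa>\<close> of the
preceding lemmas is the fourth root of \<open>lam * k\<close>.\<close>

theorem theorem6p1:
  fixes a :: "real ^ 'n \<Rightarrow> real" and \<alpha> :: "real \<Rightarrow> real" and R lam \<delta>\<^sub>0 :: real
  assumes "CARD('n) \<ge> 2"
    and "R > 0"
    and "continuous_on (ball 0 R) a"
    and "bounded (a ` ball 0 R)"
    and "\<forall>x\<in>ball 0 R. a x > 0"
    and "\<forall>x\<in>ball 0 R. a x = \<alpha> (norm x)"
    and "lam > 0"
    and "\<delta>\<^sub>0 > 0"
  shows "
    (\<forall>\<delta> m u. \<delta> \<ge> 0 \<and> m > 0 \<and> solves_radial_integral_eq R \<alpha> lam m u \<and> u R = \<delta> \<longrightarrow>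
       continuous_on (cball 0 R) (\<lambda>x :: real ^ 'n. u (norm x)) \<and>
       (ereal lam < first_eigenvalue \<delta>\<^sub>0 R a \<and> \<delta> > 0 \<longrightarrow>
          (\<forall>x \<in> ball (0 :: real ^ 'n) R. u (norm x) > 0) \<and>
          positive_dirichlet_solution R a lam \<delta> (\<lambda>x. u (norm x)) \<and>
          (\<forall>w. positive_dirichlet_solution R a lam \<delta> w \<longrightarrow>
             (\<forall>x \<in> cball 0 R. w x = u (norm x)))) \<and>
       (\<forall>k. (\<forall>x\<in>ball 0 R. a x = k) \<and> (\<forall>r\<in>{0..<R}. u r > 0) \<longrightarrow>
          (\<forall>r\<in>{0..R}. F (u r / m) = root 4 (lam * k) * r) \<and>
          positive_dirichlet_solution R a lam \<delta> (\<lambda>x. u (norm x)) \<and>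
          root 4 (lam * k) * R = F (\<delta> / m)))
    \<and>
    (ereal lam = first_eigenvalue \<delta>\<^sub>0 R a \<longrightarrow>
       (\<exists>v. solves_radial_integral_eq R \<alpha> lam 1 v \<and> v R = 0 \<and>
          (\<forall>r\<in>{0..<R}. v r > 0) \<and>
          positive_dirichlet_solution R a lam 0 (\<lambda>x. v (norm x))))
    \<and>
    (\<forall>k m \<delta> u. (\<forall>x\<in>ball 0 R. a x = k) \<and> m > 0 \<and> u R = \<delta> \<and>
         (\<forall>r\<in>{0..R}. 0 \<le> u r \<and> u r \<le> m \<and> F (u r / m) = root 4 (lam * k) * r) \<longrightarrow>
       u 0 = m \<and> \<delta> \<ge> 0 \<and>
       positive_dirichlet_solution R a lam \<delta> (\<lambda>x. u (norm x)) \<and>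
       root 4 (lam * k) * R = F (\<delta> / m))"
proof -
  interpret radial_weight a \<alpha> R
    by unfold_locales (use assms in auto)
  have const: "root 4 (lam * k) > 0" "root 4 (lam * k) ^ 4 = lam * k" "\<And>r. 0 \<le> r \<Longrightarrow> r < R \<Longrightarrow> \<alpha> r = k"
    if k: "\<forall>x\<in>ball 0 R. a x = k" for k
  proof -
    have "k > 0" using k a_pos[of 0] R_pos by simp
    then show "root 4 (lam * k) > 0" "root 4 (lam * k) ^ 4 = lam * k"
      using assms(7) by (auto simp: real_root_pow_pos2)
    show "\<alpha> r = k" if "0 \<le> r" "r < R" for r
      using weight_on_axis[OF that] k that by simp
  qed
  show ?thesis
  proof (intro conjI)
    show "\<forall>\<delta> m u. \<delta> \<ge> 0 \<and> m > 0 \<and> solves_radial_integral_eq R \<alpha> lam m u \<and> u R = \<delta> \<longrightarrow>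
       continuous_on (cball 0 R) (\<lambda>x :: real ^ 'n. u (norm x)) \<and>
       (ereal lam < first_eigenvalue \<delta>\<^sub>0 R a \<and> \<delta> > 0 \<longrightarrow>
          (\<forall>x \<in> ball (0 :: real ^ 'n) R. u (norm x) > 0) \<and>
          positive_dirichlet_solution R a lam \<delta> (\<lambda>x. u (norm x)) \<and>
          (\<forall>w. positive_dirichlet_solution R a lam \<delta> w \<longrightarrow>
             (\<forall>x \<in> cball 0 R. w x = u (norm x)))) \<and>
       (\<forall>k. (\<forall>x\<in>ball 0 R. a x = k) \<and> (\<forall>r\<in>{0..<R}. u r > 0) \<longrightarrow>
          (\<forall>r\<in>{0..R}. F (u r / m) = root 4 (lam * k) * r) \<and>
          positive_dirichlet_solution R a lam \<delta> (\<lambda>x. u (norm x)) \<and>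
          root 4 (lam * k) * R = F (\<delta> / m))"
    proof (intro allI impI, elim conjE)
      fix \<delta> m u
      assume m: "m > 0" and u: "solves_radial_integral_eq R \<alpha> lam m u" and uR: "u R = \<delta>"
      note contu = solution_continuous[OF u]
      have "continuous_on (cball 0 R) (\<lambda>x :: real ^ 'n. u (norm x))"
        by (rule continuous_on_compose2[OF contu(1)]) (auto intro!: continuous_intros)
      moreover have "(\<forall>x \<in> ball (0 :: real ^ 'n) R. u (norm x) > 0) \<and>
          positive_dirichlet_solution R a lam \<delta> (\<lambda>x. u (norm x)) \<and>
          (\<forall>w. positive_dirichlet_solution R a lam \<delta> w \<longrightarrow> (\<forall>x \<in> cball 0 R. w x = u (norm x)))"
        if sub: "ereal lam < first_eigenvalue \<delta>\<^sub>0 R a"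
      proof (intro conjI allI impI ballI)
        note subcritical = subcritical_radial_solution[OF assms(7) sub assms(8) u m]
        show "u (norm x) > 0" if "x \<in> ball 0 R" for x :: "real ^ 'n"
          by (rule subcritical(1)) (use that in auto)
        show "positive_dirichlet_solution R a lam \<delta> (\<lambda>x. u (norm x))"
          using subcritical(2) unfolding uR .
        show "w x = u (norm x)" if "positive_dirichlet_solution R a lam \<delta> w" "x \<in> cball 0 R" for w x
          by (rule subcritical(3)) (use that uR in simp_all)
      qed
      moreover have "(\<forall>r\<in>{0..R}. F (u r / m) = root 4 (lam * k) * r) \<and>
          positive_dirichlet_solution R a lam \<delta> (\<lambda>x. u (norm x)) \<and>
          root 4 (lam * k) * R = F (\<delta> / m)"
        if k: "\<forall>x\<in>ball 0 R. a x = k" and pos: "\<forall>r\<in>{0..<R}. u r > 0" for k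
      proof -
        have prof: "radial_profile R u (\<lambda>r. 3 * lam * integral {0..r} (\<lambda>s. \<alpha> s * u s ^ 3))
            (\<lambda>r. 3 * lam * (\<alpha> r * u r ^ 3))"
          by (rule solution_profile[OF u assms(7) R_pos order_refl]) (use pos in auto)
        have F: "F (u r / m) = root 4 (lam * k) * r" if "r \<in> {0..R}" for r
          by (rule F_equation_if_radial_profile[OF prof const(1)[OF k] m contu(2)])
             (use that pos const[OF k] in auto)
        moreover have "positive_dirichlet_solution R a lam (u R) (\<lambda>x. u (norm x))"
          by (rule positive_profile_is_dirichlet_solution[OF prof refl]) (use pos in auto)
        ultimately show ?thesis using uR R_pos F[of R] by simp
      qed
      ultimately show "continuous_on (cball 0 R) (\<lambda>x :: real ^ 'n. u (norm x)) \<and>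
       (ereal lam < first_eigenvalue \<delta>\<^sub>0 R a \<and> \<delta> > 0 \<longrightarrow>
          (\<forall>x \<in> ball (0 :: real ^ 'n) R. u (norm x) > 0) \<and>
          positive_dirichlet_solution R a lam \<delta> (\<lambda>x. u (norm x)) \<and>
          (\<forall>w. positive_dirichlet_solution R a lam \<delta> w \<longrightarrow>
             (\<forall>x \<in> cball 0 R. w x = u (norm x)))) \<and>
       (\<forall>k. (\<forall>x\<in>ball 0 R. a x = k) \<and> (\<forall>r\<in>{0..<R}. u r > 0) \<longrightarrow>
          (\<forall>r\<in>{0..R}. F (u r / m) = root 4 (lam * k) * r) \<and>
          positive_dirichlet_solution R a lam \<delta> (\<lambda>x. u (norm x)) \<and>
          root 4 (lam * k) * R = F (\<delta> / m))"
        by blast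
    qed
  next
    show "ereal lam = first_eigenvalue \<delta>\<^sub>0 R a \<longrightarrow>
       (\<exists>v. solves_radial_integral_eq R \<alpha> lam 1 v \<and> v R = 0 \<and>
          (\<forall>r\<in>{0..<R}. v r > 0) \<and>
          positive_dirichlet_solution R a lam 0 (\<lambda>x. v (norm x)))"
      using first_eigenfunction_exists[OF assms(7) _ assms(8)] by blast
  next
    show "\<forall>k m \<delta> u. (\<forall>x\<in>ball 0 R. a x = k) \<and> m > 0 \<and> u R = \<delta> \<and>
         (\<forall>r\<in>{0..R}. 0 \<le> u r \<and> u r \<le> m \<and> F (u r / m) = root 4 (lam * k) * r) \<longrightarrow>
       u 0 = m \<and> \<delta> \<ge> 0 \<and>
       positive_dirichlet_solution R a lam \<delta> (\<lambda>x. u (norm x)) \<and>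
       root 4 (lam * k) * R = F (\<delta> / m)"
    proof (intro allI impI, elim conjE)
      fix k m \<delta> u
      assume k: "\<forall>x\<in>ball 0 R. a x = k" and m: "m > 0" and uR: "u R = \<delta>"
        and u: "\<forall>r\<in>{0..R}. 0 \<le> u r \<and> u r \<le> m \<and> F (u r / m) = root 4 (lam * k) * r"
      note prof = radial_profile_if_F_equation[OF R_pos m const(1)[OF k] bspec[OF u]]
      have "positive_dirichlet_solution R a lam (u R) (\<lambda>x. u (norm x))"
        by (rule positive_profile_is_dirichlet_solution[OF prof(3) _ prof(2)])
           (simp_all add: const[OF k])
      then show "u 0 = m \<and> \<delta> \<ge> 0 \<and>
         positive_dirichlet_solution R a lam \<delta> (\<lambda>x. u (norm x)) \<and>
         root 4 (lam * k) * R = F (\<delta> / m)"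
        using prof(1) u uR R_pos by auto
    qed
  qed
qed

end
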